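(* Let $G$ be a maximally independent graph which has an edge contraction to a maximally independent graph $G/e$. If $G$ is radically soluble, then the graph $G/e$ is also radically soluble.
   Context: Graphs are finite and simple. A graph $G$ is independent if $2v_H-e_H\ge 3$ for every vertex-induced subgraph $H$ with at least $2$ vertices ($v_H$ vertices, $e_H$ edges), and maximally independent if also $2v_G-e_G=3$. $G/e$ is obtained from $G$ by deleting the edge $e=(xy)$, merging $x$ and $y$, and reducing resulting double edges to single edges. Normalised generic constraint equations for $G$: choose a base edge $b=(vw)$, set $d_b=1$, $(x_v,y_v)=(0,0)$, $(x_w,y_w)=(1,0)$, and let $\{d_e\}_{e\ne b}$ be algebraically independent over $\mathbb{Q}$; the equations are $(x_u-x_t)^2+(y_u-y_t)^2-d_e=0$ for the edges $e=(ut)\neq b$, in the coordinate variables of the non-base vertices. If $G$ has $n$ vertices they define a complex affine variety $V\subseteq\mathbb{C}^{2n-4}$. $G$ is radically soluble (soluble by radicals) if every coordinate of every point of $V$ lies in a radical extension of the base field $\mathbb{Q}(\{d_e\})$, i.e. in a field obtained from it by a finite tower of adjunctions of roots of arbitrary order. *)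

theory Defs
  imports
    Complex_Main
    "HOL-Library.FuncSet"
    "HOL-Library.Poly_Mapping"
    "HOL-Algebra.Generated_Fields"
    "HOL-Algebra.Algebraic_Closure_Type"
begin

section \<open>Maximally independent graphs and edge contraction\<close>

record 'a ugraph =
  verts :: "'a set"
  edges :: "'a set set"

definition finite_simple_graph :: "'a ugraph \<Rightarrow> bool" where
  "finite_simple_graph G \<longleftrightarrow>
     finite (verts G) \<and> (\<forall>e \<in> edges G. e \<subseteq> verts G \<and> card e = 2)"

definition induced_subgraph :: "'a ugraph \<Rightarrow> 'a set \<Rightarrow> 'a ugraph" where
  "induced_subgraph G U = \<lparr> verts = U, edges = {e \<in> edges G. e \<subseteq> U} \<rparr>"

definition freedom :: "'a ugraph \<Rightarrow> int" where
  "freedom G = 2 * int (card (verts G)) - int (card (edges G))"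

definition independent_graph :: "'a ugraph \<Rightarrow> bool" where
  "independent_graph G \<longleftrightarrow>
     (\<forall>U \<subseteq> verts G. card U \<ge> 2 \<longrightarrow> freedom (induced_subgraph G U) \<ge> 3)"

definition maximally_independent :: "'a ugraph \<Rightarrow> bool" where
  "maximally_independent G \<longleftrightarrow> independent_graph G \<and> freedom G = 3"

text \<open>
  In the contraction of the edge \<open>{x, y}\<close> the merged vertex is represented by \<open>x\<close>.  Edges are
  mapped as sets, so a pair of edges that become parallel is identified.
\<close>

definition merge_vertex :: "'a \<Rightarrow> 'a \<Rightarrow> 'a \<Rightarrow> 'a" where
  "merge_vertex x y u = (if u = y then x else u)"

definition contract_edge :: "'a ugraph \<Rightarrow> 'a \<Rightarrow> 'a \<Rightarrow> 'a ugraph" where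
  "contract_edge G x y =
     \<lparr> verts = merge_vertex x y ` verts G,
       edges = (\<lambda>e. merge_vertex x y ` e) ` (edges G - {{x, y}}) \<rparr>"

section \<open>Algebraic independence over the rationals\<close>

text \<open>
  A value of type \<open>('i \<Rightarrow>\<^sub>0 nat) \<Rightarrow>\<^sub>0 rat\<close> is a multivariate polynomial over the rationals with
  variables indexed by \<open>'i\<close>: it maps each monomial (its exponent vector) to its coefficient.
\<close>

definition mpoly_vars :: "(('i \<Rightarrow>\<^sub>0 nat) \<Rightarrow>\<^sub>0 rat) \<Rightarrow> 'i set" where
  "mpoly_vars P = (\<Union>m \<in> Poly_Mapping.keys P. Poly_Mapping.keys m)"

definition mpoly_eval :: "('i \<Rightarrow> complex) \<Rightarrow> (('i \<Rightarrow>\<^sub>0 nat) \<Rightarrow>\<^sub>0 rat) \<Rightarrow> complex" where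
  "mpoly_eval d P =
     (\<Sum>m \<in> Poly_Mapping.keys P. of_rat (Poly_Mapping.lookup P m) *
        (\<Prod>i \<in> Poly_Mapping.keys m. d i ^ Poly_Mapping.lookup m i))"

definition algebraically_independent :: "('i \<Rightarrow> complex) \<Rightarrow> 'i set \<Rightarrow> bool" where
  "algebraically_independent d I \<longleftrightarrow>
     (\<forall>P. mpoly_vars P \<subseteq> I \<and> mpoly_eval d P = 0 \<longrightarrow> P = 0)"

section \<open>Radical extensions inside the complex numbers\<close>

definition generated_subfield :: "complex set \<Rightarrow> complex set" where
  "generated_subfield S = generate_field ring_of_type_algebra S"

inductive radical_extension :: "complex set \<Rightarrow> complex set \<Rightarrow> bool" for K where
  base: "radical_extension K K"
| adjoin_root:
    "\<lbrakk> radical_extension K L; n > 0; r ^ n \<in> L \<rbrakk>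
       \<Longrightarrow> radical_extension K (generated_subfield (insert r L))"

section \<open>Normalised generic constraint equations\<close>

definition generic_lengths :: "'a ugraph \<Rightarrow> 'a set \<Rightarrow> ('a set \<Rightarrow> complex) \<Rightarrow> bool" where
  "generic_lengths G b d \<longleftrightarrow> d b = 1 \<and> algebraically_independent d (edges G - {b})"

definition base_field :: "'a ugraph \<Rightarrow> 'a set \<Rightarrow> ('a set \<Rightarrow> complex) \<Rightarrow> complex set" where
  "base_field G b d = generated_subfield (d ` (edges G - {b}))"

text \<open>
  A point assigns coordinates \<open>p u = (x\<^sub>u, y\<^sub>u)\<close> to every vertex \<open>u\<close>, with those of the base
  vertices \<open>v\<close> and \<open>w\<close> pinned; the coordinates of the remaining \<open>n - 2\<close> vertices are the
  \<open>2 n - 4\<close> affine coordinates of the variety.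
\<close>

definition constraint_variety ::
    "'a ugraph \<Rightarrow> 'a \<Rightarrow> 'a \<Rightarrow> ('a set \<Rightarrow> complex) \<Rightarrow> ('a \<Rightarrow> complex \<times> complex) set" where
  "constraint_variety G v w d =
     {p \<in> extensional (verts G).
        p v = (0, 0) \<and> p w = (1, 0) \<and>
        (\<forall>u t. {u, t} \<in> edges G - {{v, w}} \<longrightarrow>
           (fst (p u) - fst (p t))^2 + (snd (p u) - snd (p t))^2 - d {u, t} = 0)}"

text \<open>
  The choice of base edge \<open>{v, w}\<close>, of its orientation, and of the generic lengths \<open>d\<close> is
  arbitrary; the property is required for every choice.
\<close>

definition radically_soluble :: "'a ugraph \<Rightarrow> bool" where
  "radically_soluble G \<longleftrightarrow>
     (\<forall>v w d. {v, w} \<in> edges G \<and> generic_lengths G {v, w} d \<longrightarrow>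
        (\<forall>p \<in> constraint_variety G v w d. \<forall>u \<in> verts G.
           (\<exists>L. radical_extension (base_field G {v, w} d) L \<and> fst (p u) \<in> L) \<and>
           (\<exists>L. radical_extension (base_field G {v, w} d) L \<and> snd (p u) \<in> L)))"

end

theory Submission
  imports Defs "HOL-Analysis.Continuum_Not_Denumerable"
begin

text \<open>
  Degenerate \<open>G\<close> to \<open>G/e\<close> along a formal curve. Counting edges, the ends \<open>x\<close> and \<open>y\<close> of \<open>e\<close> have
  exactly one common neighbour \<open>z\<close>. Given generic lengths \<open>d\<close> for \<open>G/e\<close> and a point \<open>p\<close> of its
  variety, give \<open>G\<close> the lengths \<open>d\<close>, except that \<open>xy\<close> gets \<open>X\<^sup>2 + \<dots>\<close> and \<open>yz\<close> gets
  \<open>d\<^bsub>xz\<^esub> + X\<^sup>2 \<sigma>\<close>, with rational power series chosen so that these two are independent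
  transcendentals over \<open>\<rat>(d)\<close>. At \<open>p\<close> the equations of \<open>G/e\<close> are nondegenerate: derivations of \<open>\<rat>(d)\<close>
  extend to the coordinates of \<open>p\<close>, so the Jacobian is surjective. Hence the equations of \<open>G\<close> have a
  solution in complex power series in \<open>X\<close> that specialises to \<open>p\<close> at \<open>X = 0\<close>.

  A countable field of Laurent series embeds into the complex numbers, so solubility of \<open>G\<close> puts the
  images of the coordinates of this curve into a radical tower. Let \<open>R\<close> be the closure of \<open>\<rat>(d)\<close>
  under radicals. After replacing \<open>X\<close> by a power of \<open>X\<close>, every nonzero Laurent series over \<open>R\<close> has
  roots that are Laurent series over \<open>R\<close>. So the tower maps back into Laurent series over \<open>R\<close>, and
  the constant terms, which are the coordinates of \<open>p\<close>, lie in \<open>R\<close>.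
\<close>

section \<open>Subfields and partial homomorphisms\<close>

text \<open>A formula by radicals for the generic points of \<open>G\<close> cannot simply be
  specialised to \<open>G/e\<close>: denominators and radicands in it may vanish there. Over Laurent
  series every nonzero element stays invertible, and orders of vanishing are absorbed by powers of
  X, so the limit is taken only at the end and only on the coordinates.

  Solubility speaks of complex lengths, so the argument moves between complex numbers and series. It
  does so by graphs of homomorphisms; countability of the graphs leaves room for new transcendentals
  on both sides.

  The edge yz dictates the shape of the curve. With y - x of order X, the squared lengths of yz and
  xz differ at first order by the inner product of -2(y - x) and z - x. Taking the leading direction
  k of y - x orthogonal to z - x removes this term. Since z - x is not isotropic, k and z - x are
  then independent, and the later coefficients of y - x can meet the prescribed lengths of both xy
  and yz.

  The perturbing series have coefficients 0 and 1: there are uncountably many of them, yet they are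
  defined over every subfield.\<close>

definition is_subfield :: "'a::field set \<Rightarrow> bool" where
  "is_subfield S \<longleftrightarrow> 0 \<in> S \<and> 1 \<in> S \<and> (\<forall>a\<in>S. \<forall>b\<in>S. a + b \<in> S \<and> a - b \<in> S \<and> a * b \<in> S)
     \<and> (\<forall>a\<in>S. inverse a \<in> S)"

lemma is_subfieldD:
  assumes "is_subfield S"
  shows "0 \<in> S" "1 \<in> S" "a \<in> S \<Longrightarrow> b \<in> S \<Longrightarrow> a + b \<in> S" "a \<in> S \<Longrightarrow> b \<in> S \<Longrightarrow> a - b \<in> S"
    "a \<in> S \<Longrightarrow> b \<in> S \<Longrightarrow> a * b \<in> S" "a \<in> S \<Longrightarrow> inverse a \<in> S"
    "a \<in> S \<Longrightarrow> b \<in> S \<Longrightarrow> a / b \<in> S" "a \<in> S \<Longrightarrow> - a \<in> S"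
proof -
  show "a / b \<in> S" if "a \<in> S" "b \<in> S"
    using assms that unfolding is_subfield_def divide_inverse by blast
  show "- a \<in> S" if "a \<in> S"
    using assms that unfolding is_subfield_def by (metis diff_0)
qed (use assms in \<open>auto simp: is_subfield_def\<close>)

lemma is_subfield_sum:
  assumes "is_subfield S" "\<And>i. i \<in> I \<Longrightarrow> f i \<in> S"
  shows "sum f I \<in> S"
  using assms(2)
  by (induction I rule: infinite_finite_induct) (auto intro: is_subfieldD[OF assms(1)])

lemma is_subfield_power:
  assumes "is_subfield S" "a \<in> S" shows "a ^ n \<in> S"
  by (induction n) (auto intro: is_subfieldD[OF assms(1)] assms(2))

lemma is_subfield_of_nat: "is_subfield S \<Longrightarrow> of_nat n \<in> S"
  by (induction n) (auto intro: is_subfieldD)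

lemma is_subfield_of_rat:
  assumes "is_subfield S"
  shows "(of_rat q :: 'a::field_char_0) \<in> S"
proof (cases q)
  case (Fract a b)
  have *: "(of_int i :: 'a) \<in> S" for i
    by (cases i rule: int_cases2) (auto intro: is_subfieldD[OF assms] is_subfield_of_nat[OF assms])
  show ?thesis using Fract * by (simp add: of_rat_rat is_subfieldD(7)[OF assms])
qed

lemma is_subfield_Rats: "is_subfield (\<rat> :: 'a::field_char_0 set)"
  by (simp add: is_subfield_def)

section \<open>Generated subfields of the complex numbers\<close>

lemma ring_of_type_algebra_ops:
  "carrier (ring_of_type_algebra :: 'a::field ring) = UNIV"
  "monoid.mult (ring_of_type_algebra :: 'a ring) = (*)"
  "monoid.one (ring_of_type_algebra :: 'a ring) = 1"
  "ring.zero (ring_of_type_algebra :: 'a ring) = 0"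
  "add (ring_of_type_algebra :: 'a ring) = (+)"
  by (simp_all add: ring_of_type_algebra_def fun_eq_iff)

lemma ring_of_type_algebra_uminus: "\<ominus>\<^bsub>ring_of_type_algebra\<^esub> a = - (a :: 'a::field)"
proof -
  interpret R: field "ring_of_type_algebra :: 'a ring" by (rule field_from_type_algebra)
  show ?thesis by (rule R.minus_equality) (simp_all add: ring_of_type_algebra_ops)
qed

lemma ring_of_type_algebra_inverse:
  assumes "a \<noteq> 0"
  shows "inv\<^bsub>ring_of_type_algebra\<^esub> a = inverse (a :: 'a::field)"
proof -
  interpret R: field "ring_of_type_algebra :: 'a ring" by (rule field_from_type_algebra)
  show ?thesis by (rule R.comm_inv_char) (use assms in \<open>simp_all add: ring_of_type_algebra_ops\<close>)
qed

lemma is_subfield_generated: "is_subfield (generated_subfield S)"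
proof -
  let ?R = "ring_of_type_algebra :: complex ring"
  note ax = ring_of_type_algebra_ops generated_subfield_def
  have one: "1 \<in> generated_subfield S"
    using generate_field.one[of ?R S] by (simp add: ax)
  have add: "a + b \<in> generated_subfield S"
    if "a \<in> generated_subfield S" "b \<in> generated_subfield S" for a b
    using generate_field.eng_add[of a ?R S b] that by (simp add: ax)
  have mult: "a * b \<in> generated_subfield S"
    if "a \<in> generated_subfield S" "b \<in> generated_subfield S" for a b
    using generate_field.eng_mult[of a ?R S b] that by (simp add: ax)
  have uminus: "- a \<in> generated_subfield S" if "a \<in> generated_subfield S" for a
    using generate_field.a_inv[of a ?R S] that by (simp add: ax ring_of_type_algebra_uminus)
  have zero: "0 \<in> generated_subfield S"
    using add[OF one uminus[OF one]] by simp
  have inverse: "inverse a \<in> generated_subfield S" if "a \<in> generated_subfield S" for a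
    using generate_field.m_inv[of a ?R S] that zero by (cases "a = 0") (simp_all add: ax ring_of_type_algebra_inverse)
  have diff: "a - b \<in> generated_subfield S"
    if "a \<in> generated_subfield S" "b \<in> generated_subfield S" for a b
    using add[OF that(1) uminus[OF that(2)]] by simp
  show ?thesis
    unfolding is_subfield_def by (intro conjI ballI zero one add diff mult inverse)
qed

lemma generated_subfield_superset: "S \<subseteq> generated_subfield S"
  unfolding generated_subfield_def by (auto intro: generate_field.incl)

lemma generated_subfield_least:
  assumes "is_subfield F" "S \<subseteq> F"
  shows "generated_subfield S \<subseteq> F"
proof
  fix a assume "a \<in> generated_subfield S"
  then have "a \<in> generate_field ring_of_type_algebra S" by (simp add: generated_subfield_def)
  then show "a \<in> F"
    by (induction rule: generate_field.induct)
      (use assms is_subfieldD[OF assms(1)] in \<open>auto simp: ring_of_type_algebra_ops ring_of_type_algebra_uminus ring_of_type_algebra_inverse\<close>)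
qed

lemma generated_subfield_mono: "S \<subseteq> S' \<Longrightarrow> generated_subfield S \<subseteq> generated_subfield S'"
  by (meson generated_subfield_least generated_subfield_superset is_subfield_generated subset_trans)

text \<open>
  The graph of a ring homomorphism from a subfield of \<open>'a\<close> into \<open>'b\<close>, kept as a set of pairs so that
  it can be read in both directions when \<open>'b\<close> is a field.
\<close>

definition partial_hom :: "('a::field \<times> 'b::comm_ring_1) set \<Rightarrow> bool" where
  "partial_hom T \<longleftrightarrow> (0, 0) \<in> T \<and> (1, 1) \<in> T
     \<and> (\<forall>a b c d. (a, b) \<in> T \<and> (c, d) \<in> T \<longrightarrow> (a + c, b + d) \<in> T \<and> (a - c, b - d) \<in> T \<and> (a * c, b * d) \<in> T)
     \<and> (\<forall>a b. (a, b) \<in> T \<and> a \<noteq> 0 \<longrightarrow> (\<exists>b'. b * b' = 1 \<and> (inverse a, b') \<in> T))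
     \<and> (\<forall>b. (0, b) \<in> T \<longrightarrow> b = 0)"

lemma partial_homD:
  assumes "partial_hom T"
  shows "(0, 0) \<in> T" "(1, 1) \<in> T"
    "(a, b) \<in> T \<Longrightarrow> (c, d) \<in> T \<Longrightarrow> (a + c, b + d) \<in> T"
    "(a, b) \<in> T \<Longrightarrow> (c, d) \<in> T \<Longrightarrow> (a - c, b - d) \<in> T"
    "(a, b) \<in> T \<Longrightarrow> (c, d) \<in> T \<Longrightarrow> (a * c, b * d) \<in> T"
    "(a, b) \<in> T \<Longrightarrow> a \<noteq> 0 \<Longrightarrow> \<exists>b'. b * b' = 1 \<and> (inverse a, b') \<in> T"
    "(0, b) \<in> T \<Longrightarrow> b = 0"
  using assms unfolding partial_hom_def by blast+

lemma partial_homI: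
  assumes "(0, 0) \<in> T" "(1, 1) \<in> T"
    "\<And>a b c d. (a, b) \<in> T \<Longrightarrow> (c, d) \<in> T \<Longrightarrow> (a + c, b + d) \<in> T"
    "\<And>a b c d. (a, b) \<in> T \<Longrightarrow> (c, d) \<in> T \<Longrightarrow> (a - c, b - d) \<in> T"
    "\<And>a b c d. (a, b) \<in> T \<Longrightarrow> (c, d) \<in> T \<Longrightarrow> (a * c, b * d) \<in> T"
    "\<And>a b. (a, b) \<in> T \<Longrightarrow> a \<noteq> 0 \<Longrightarrow> \<exists>b'. b * b' = 1 \<and> (inverse a, b') \<in> T"
    "\<And>b. (0, b) \<in> T \<Longrightarrow> b = 0"
  shows "partial_hom T"
  unfolding partial_hom_def by (intro conjI allI impI; (elim conjE)?) (rule assms; assumption)+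

lemma partial_hom_graph:
  assumes K: "is_subfield K" and h: "h 0 = 0" "h 1 = 1" "\<And>a b. h (a + b) = h a + h b"
    "\<And>a b. h (a - b) = h a - h b" "\<And>a b. h (a * b) = h a * h b"
  shows "partial_hom ((\<lambda>a. (a, h a)) ` K)"
proof (rule partial_homI)
  fix a b assume "(a, b) \<in> (\<lambda>a. (a, h a)) ` K" "a \<noteq> 0"
  then have "b * h (inverse a) = 1" "inverse a \<in> K"
    using is_subfieldD(6)[OF K] by (auto simp: h(2) simp flip: h(5))
  then show "\<exists>b'. b * b' = 1 \<and> (inverse a, b') \<in> (\<lambda>a. (a, h a)) ` K" by blast
qed (auto simp: h image_iff intro: is_subfieldD[OF K])

lemma partial_hom_single_valued:
  assumes "partial_hom T" "(a, b) \<in> T" "(a, c) \<in> T"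
  shows "b = c"
  using partial_homD(4)[OF assms] partial_homD(7)[OF assms(1), of "b - c"] by simp

lemma partial_hom_injective:
  assumes "partial_hom T" "(a, b) \<in> T" "(a', b) \<in> T"
  shows "a = a'"
proof (rule ccontr)
  assume "a \<noteq> a'"
  moreover have "(a - a', 0) \<in> T" using partial_homD(4)[OF assms] by simp
  ultimately show False using partial_homD(6)[OF assms(1)] by fastforce
qed

lemma partial_hom_inverse:
  fixes T :: "('a::field \<times> 'b::field) set"
  assumes "partial_hom T" "(a, b) \<in> T"
  shows "(inverse a, inverse b) \<in> T"
proof (cases "a = 0")
  case True
  moreover from this have "b = 0" using assms(2) by (auto intro: partial_homD(7)[OF assms(1)])
  ultimately show ?thesis using partial_homD(1)[OF assms(1)] by simp
next
  case False
  then obtain b' where "b * b' = 1" "(inverse a, b') \<in> T" using partial_homD(6)[OF assms] by blast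
  then show ?thesis by (metis inverse_unique)
qed

text \<open>Nonzero elements go to units, so between fields the relation is injective and can be
  reversed. A map from complex numbers to Laurent series is thereby extended on the series side,
  where the target is the algebraically closed field.\<close>

lemma partial_hom_converse:
  fixes T :: "('a::field \<times> 'b::field) set"
  assumes "partial_hom T"
  shows "partial_hom (T\<inverse>)"
proof (rule partial_homI)
  fix a b assume ab: "(b, a) \<in> T\<inverse>" "b \<noteq> 0"
  then have "a \<noteq> 0" using partial_homD(7)[OF assms] by auto
  then show "\<exists>a'. a * a' = 1 \<and> (inverse b, a') \<in> T\<inverse>"
    using partial_hom_inverse[OF assms] ab(1) by (intro exI[of _ "inverse a"]) simp
next
  fix a assume "(0, a) \<in> T\<inverse>"
  then show "a = 0" using partial_hom_injective[OF assms _ partial_homD(1)[OF assms]] by simp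
qed (use partial_homD(1-5)[OF assms] in auto)

text \<open>This carries the property of having an image in \<open>S\<close> from generators to the
  field that they generate.\<close>

lemma is_subfield_partial_hom_preimage:
  fixes T :: "('a::field \<times> 'b::field) set"
  assumes "partial_hom T" "is_subfield S"
  shows "is_subfield {a. \<exists>b\<in>S. (a, b) \<in> T}"
  unfolding is_subfield_def
proof (intro conjI ballI)
  show "0 \<in> {a. \<exists>b\<in>S. (a, b) \<in> T}" "1 \<in> {a. \<exists>b\<in>S. (a, b) \<in> T}"
    using partial_homD(1,2)[OF assms(1)] is_subfieldD(1,2)[OF assms(2)] by blast+
  fix a c assume "a \<in> {a. \<exists>b\<in>S. (a, b) \<in> T}"
  then obtain b where a: "b \<in> S" "(a, b) \<in> T" by blast
  show "inverse a \<in> {a. \<exists>b\<in>S. (a, b) \<in> T}"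
    using partial_hom_inverse[OF assms(1) a(2)] is_subfieldD(6)[OF assms(2) a(1)] by blast
  assume "c \<in> {a. \<exists>b\<in>S. (a, b) \<in> T}"
  then obtain b' where c: "b' \<in> S" "(c, b') \<in> T" by blast
  show "a + c \<in> {a. \<exists>b\<in>S. (a, b) \<in> T}" "a - c \<in> {a. \<exists>b\<in>S. (a, b) \<in> T}" "a * c \<in> {a. \<exists>b\<in>S. (a, b) \<in> T}"
    using partial_homD(3-5)[OF assms(1) a(2) c(2)] is_subfieldD(3-5)[OF assms(2) a(1) c(1)] by blast+
qed

lemma is_subfield_fst_partial_hom:
  assumes "partial_hom T"
  shows "is_subfield (fst ` T)"
proof -
  have "inverse a \<in> fst ` T" if "(a, b) \<in> T" for a b
    using partial_homD(6)[OF assms that] partial_homD(1)[OF assms] by (cases "a = 0") force+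
  then show ?thesis
    unfolding is_subfield_def
    using imageI[OF partial_homD(1)[OF assms], of fst] imageI[OF partial_homD(2)[OF assms], of fst]
      imageI[OF partial_homD(3)[OF assms], of _ _ _ _ fst] imageI[OF partial_homD(4)[OF assms], of _ _ _ _ fst]
      imageI[OF partial_homD(5)[OF assms], of _ _ _ _ fst]
    by auto
qed

section \<open>Adjoining one element to a partial homomorphism\<close>

text \<open>Serves as an induction principle: the extension built in \<open>adjoin_pair\<close> lies
  in every such \<open>W\<close> that contains the old pairs and the new one. The second component
  lives in a ring, so its inverse is given by a witness \<open>b'\<close>.\<close>

definition hom_closed :: "('a::field \<times> 'b::comm_ring_1) set \<Rightarrow> bool" where
  "hom_closed W \<longleftrightarrow>
     (\<forall>a b a' b'. (a, b) \<in> W \<longrightarrow> (a', b') \<in> W \<longrightarrow> (a + a', b + b') \<in> W \<and> (a * a', b * b') \<in> W)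
     \<and> (\<forall>a b b'. (a, b) \<in> W \<longrightarrow> a \<noteq> 0 \<longrightarrow> b * b' = 1 \<longrightarrow> (inverse a, b') \<in> W)"

lemma hom_closedD:
  assumes "hom_closed W"
  shows "(a, b) \<in> W \<Longrightarrow> (a', b') \<in> W \<Longrightarrow> (a + a', b + b') \<in> W"
    "(a, b) \<in> W \<Longrightarrow> (a', b') \<in> W \<Longrightarrow> (a * a', b * b') \<in> W"
    "(a, b) \<in> W \<Longrightarrow> a \<noteq> 0 \<Longrightarrow> b * b' = 1 \<Longrightarrow> (inverse a, b') \<in> W"
  using assms unfolding hom_closed_def by blast+

definition hom_polys :: "('a::field \<times> 'b::comm_ring_1) set \<Rightarrow> ('a poly \<times> 'b poly) set" where
  "hom_polys T = {(f, g). \<forall>n. (coeff f n, coeff g n) \<in> T}"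

text \<open>The condition for sending \<open>r\<close> to \<open>c\<close> to be a well-defined extension of \<open>T\<close>.\<close>

definition hom_compatible :: "('a::field \<times> 'b::comm_ring_1) set \<Rightarrow> 'a \<Rightarrow> 'b \<Rightarrow> bool" where
  "hom_compatible T r c \<longleftrightarrow> (\<forall>(f, g) \<in> hom_polys T.
     (poly f r = 0 \<longrightarrow> poly g c = 0) \<and> (poly f r \<noteq> 0 \<longrightarrow> poly g c dvd 1))"

lemma hom_polysD: "(f, g) \<in> hom_polys T \<Longrightarrow> (coeff f n, coeff g n) \<in> T"
  by (simp add: hom_polys_def)

context
  fixes T :: "('a::field \<times> 'b::comm_ring_1) set"
  assumes T: "partial_hom T"
begin

lemma partial_hom_sum:
  assumes "\<And>i. i \<in> I \<Longrightarrow> (f i, g i) \<in> T"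
  shows "(sum f I, sum g I) \<in> T"
  using assms by (induction I rule: infinite_finite_induct) (auto intro: partial_homD[OF T])

lemma partial_hom_of_nat: "(of_nat n, of_nat n) \<in> T"
  by (induction n) (auto intro: partial_homD[OF T])

lemma hom_polys_add: "(f, g) \<in> hom_polys T \<Longrightarrow> (h, k) \<in> hom_polys T \<Longrightarrow> (f + h, g + k) \<in> hom_polys T"
  by (auto simp: hom_polys_def intro: partial_homD[OF T])

lemma hom_polys_diff: "(f, g) \<in> hom_polys T \<Longrightarrow> (h, k) \<in> hom_polys T \<Longrightarrow> (f - h, g - k) \<in> hom_polys T"
  by (auto simp: hom_polys_def intro: partial_homD[OF T])

lemma hom_polys_mult: "(f, g) \<in> hom_polys T \<Longrightarrow> (h, k) \<in> hom_polys T \<Longrightarrow> (f * h, g * k) \<in> hom_polys T"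
  by (auto simp: hom_polys_def coeff_mult intro!: partial_hom_sum partial_homD(5)[OF T])

lemma hom_polys_pCons: "(a, b) \<in> T \<Longrightarrow> (f, g) \<in> hom_polys T \<Longrightarrow> (pCons a f, pCons b g) \<in> hom_polys T"
  by (auto simp: hom_polys_def coeff_pCons split: nat.split)

lemma hom_polys_0: "(0, 0) \<in> hom_polys T"
  by (auto simp: hom_polys_def intro: partial_homD[OF T])

lemma hom_polys_const: "(a, b) \<in> T \<Longrightarrow> ([:a:], [:b:]) \<in> hom_polys T"
  by (intro hom_polys_pCons hom_polys_0)

lemma hom_polys_monom: "(a, b) \<in> T \<Longrightarrow> (monom a n, monom b n) \<in> hom_polys T"
  by (auto simp: hom_polys_def intro: partial_homD[OF T])

lemma ex_hom_polys_pderiv: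
  assumes "(f, g) \<in> hom_polys T"
  shows "\<exists>k. (pderiv f, k) \<in> hom_polys T"
proof
  \<comment> \<open>The target may have zero divisors, as the dual numbers do, so the image of the
    derivative is written out by its coefficients.\<close>
  let ?k = "Poly (map (\<lambda>n. of_nat (Suc n) * coeff g (Suc n)) [0..<degree g])"
  have "coeff ?k n = of_nat (Suc n) * coeff g (Suc n)" for n
    by (auto simp: coeff_Poly_eq nth_default_def coeff_eq_0)
  then show "(pderiv f, ?k) \<in> hom_polys T"
    using partial_homD(5)[OF T partial_hom_of_nat hom_polysD[OF assms], of "Suc _" "Suc _"]
    by (simp add: hom_polys_def coeff_pderiv del: of_nat_Suc)
qed

lemma hom_polys_zeroD: "(0, g) \<in> hom_polys T \<Longrightarrow> g = 0"
  using partial_homD(7)[OF T] by (auto simp: hom_polys_def poly_eq_iff)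

lemma hom_polys_eval:
  assumes "(f, g) \<in> hom_polys T" "T \<subseteq> W" "(r, c) \<in> W" and W: "hom_closed W"
  shows "(poly f r, poly g c) \<in> W"
  using assms(1)
proof (induction f arbitrary: g)
  case 0
  have "g = 0" by (rule hom_polys_zeroD[OF 0])
  then show ?case using partial_homD(1)[OF T] assms(2) by auto
next
  case (pCons a f)
  obtain b g' where g: "g = pCons b g'" by (cases g)
  have "(a, b) \<in> W" using hom_polysD[OF pCons.prems, of 0] assms(2) by (auto simp: g)
  moreover have "(f, g') \<in> hom_polys T"
    using hom_polysD[OF pCons.prems, of "Suc _"] by (auto simp: g hom_polys_def)
  ultimately show ?case
    using pCons.IH hom_closedD(1,2)[OF W] assms(3) by (simp add: g)
qed

text \<open>Long division is run in parallel on both sides. Only the leading coefficient of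
  \<open>m1\<close> has to be inverted, and \<open>T\<close> supplies an image \<open>l\<close> of
  that inverse, so the target need not be a field.\<close>

lemma hom_polys_division:
  assumes m: "(m1, m2) \<in> hom_polys T" "m1 \<noteq> 0" and f: "(f1, f2) \<in> hom_polys T"
  obtains q1 q2 s1 s2 where "(q1, q2) \<in> hom_polys T" "(s1, s2) \<in> hom_polys T"
    "f1 = q1 * m1 + s1" "f2 = q2 * m2 + s2" "s1 = 0 \<or> degree s1 < degree m1"
proof -
  obtain l where l: "(inverse (lead_coeff m1), l) \<in> T"
    using partial_homD(6)[OF T hom_polysD[OF m(1), of "degree m1"]] m(2) by auto
  \<comment> \<open>Induction on a bound \<open>n\<close> beyond which the coefficients of
    \<open>f1\<close> vanish; this treats the zero polynomial uniformly.\<close>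
  have "\<exists>q1 q2 s1 s2. (q1, q2) \<in> hom_polys T \<and> (s1, s2) \<in> hom_polys T \<and>
    f1 = q1 * m1 + s1 \<and> f2 = q2 * m2 + s2 \<and> (s1 = 0 \<or> degree s1 < degree m1)"
    if "\<forall>i\<ge>n. coeff f1 i = 0" "(f1, f2) \<in> hom_polys T" for n f1 f2
    using that
  proof (induction n arbitrary: f1 f2)
    case 0
    then have "f1 = 0" by (simp add: poly_eq_iff)
    then show ?case using 0 hom_polys_0 by (intro exI[of _ 0] exI[of _ f2]) auto
  next
    case (Suc n)
    show ?case
    proof (cases "n < degree m1")
      case True
      then have "degree f1 < degree m1"
        using degree_lessI[of f1 "degree m1"] Suc.prems(1) True by fastforce
      then show ?thesis using Suc.prems hom_polys_0 by (intro exI[of _ 0] exI[of _ f1] exI[of _ f2]) auto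
    next
      case False
      define k where "k = n - degree m1"
      define t1 where "t1 = monom (coeff f1 n * inverse (lead_coeff m1)) k"
      define t2 where "t2 = monom (coeff f2 n * l) k"
      have t: "(t1, t2) \<in> hom_polys T"
        unfolding t1_def t2_def
        by (intro hom_polys_monom partial_homD[OF T] l hom_polysD Suc.prems)
      have c: "coeff (f1 - t1 * m1) i = 0" if "i \<ge> n" for i
      proof (cases "i = n")
        case True
        then show ?thesis using False m(2) by (simp add: t1_def coeff_monom_mult k_def)
      next
        case neq: False
        then have "i > n" using that by simp
        moreover from this have "coeff m1 (i - k) = 0"
          using False by (intro coeff_eq_0) (auto simp: k_def)
        ultimately show ?thesis using Suc.prems(1) by (simp add: t1_def coeff_monom_mult)
      qed
      obtain q1 q2 s1 s2 where "(q1, q2) \<in> hom_polys T \<and> (s1, s2) \<in> hom_polys T \<and>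
        f1 - t1 * m1 = q1 * m1 + s1 \<and> f2 - t2 * m2 = q2 * m2 + s2 \<and> (s1 = 0 \<or> degree s1 < degree m1)"
        using Suc.IH[of "f1 - t1 * m1" "f2 - t2 * m2"] c
          hom_polys_diff[OF Suc.prems(2) hom_polys_mult[OF t m(1)]] by blast
      then show ?thesis using hom_polys_add[OF _ t, of q1 q2]
        by (intro exI[of _ "q1 + t1"] exI[of _ "q2 + t2"] exI[of _ s1] exI[of _ s2])
          (auto simp: algebra_simps)
    qed
  qed
  from this[of "Suc (degree f1)" f1 f2] f that show thesis
    by (meson Suc_le_lessD coeff_eq_0)
qed

text \<open>The minimal polynomial of \<open>r\<close> over the domain of \<open>T\<close>, up to a
  scalar, together with its image.\<close>

definition minimal_hom_poly :: "'a \<Rightarrow> 'a poly \<Rightarrow> 'b poly \<Rightarrow> bool" where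
  "minimal_hom_poly r m1 m2 \<longleftrightarrow> (m1, m2) \<in> hom_polys T \<and> m1 \<noteq> 0 \<and> poly m1 r = 0 \<and>
     (\<forall>g1 g2. (g1, g2) \<in> hom_polys T \<and> poly g1 r = 0 \<and> g1 \<noteq> 0 \<longrightarrow> degree m1 \<le> degree g1)"

lemma ex_minimal_hom_poly:
  assumes "(f1, f2) \<in> hom_polys T" "f1 \<noteq> 0" "poly f1 r = 0"
  shows "\<exists>m1 m2. minimal_hom_poly r m1 m2"
  using ex_has_least_nat[of "\<lambda>(f, g). (f, g) \<in> hom_polys T \<and> f \<noteq> 0 \<and> poly f r = 0" "(f1, f2)" "degree \<circ> fst"] assms
  by (force simp: minimal_hom_poly_def)

context
  fixes r m1 m2
  assumes min: "minimal_hom_poly r m1 m2"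
begin

lemma minimal_hom_poly_dvd:
  assumes "(g1, g2) \<in> hom_polys T" "poly g1 r = 0"
  obtains q1 q2 where "(q1, q2) \<in> hom_polys T" "g1 = q1 * m1" "g2 = q2 * m2"
proof -
  obtain q1 q2 s1 s2 where q: "(q1, q2) \<in> hom_polys T" "(s1, s2) \<in> hom_polys T"
    "g1 = q1 * m1 + s1" "g2 = q2 * m2 + s2" "s1 = 0 \<or> degree s1 < degree m1"
    by (rule hom_polys_division[of m1 m2 g1 g2]) (use min assms in \<open>auto simp: minimal_hom_poly_def\<close>)
  have "poly s1 r = 0" using q(3) assms(2) min by (simp add: minimal_hom_poly_def)
  then have "s1 = 0" using q(2,5) min by (fastforce simp: minimal_hom_poly_def)
  then show thesis using that q hom_polys_zeroD by auto
qed

text \<open>Euclid's algorithm: divide \<open>m1\<close> by \<open>f\<close> with remainder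
  \<open>s1\<close>. If \<open>s1\<close> vanished at \<open>r\<close>, it would be zero by
  minimality, and then the quotient would be a nonzero polynomial of smaller degree vanishing at
  \<open>r\<close>. So \<open>s1\<close> can be inverted at \<open>r\<close> by induction, and its
  value there is a multiple of that of \<open>f\<close>.\<close>

lemma hom_polys_unit_small:
  assumes "(f, g) \<in> hom_polys T" "poly f r \<noteq> 0" "degree f < degree m1"
  shows "\<exists>k l. (k, l) \<in> hom_polys T \<and> poly (f * k) r = 1"
  using assms
proof (induction "degree f" arbitrary: f g rule: less_induct)
  case less
  show ?case
  proof (cases "degree f = 0")
    case True
    then obtain a where f: "f = [:a:]" by (meson degree_eq_zeroE)
    then have "a \<noteq> 0" "(a, coeff g 0) \<in> T" using less.prems(2) hom_polysD[OF less.prems(1), of 0] by auto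
    then obtain b where "(inverse a, b) \<in> T" using partial_homD(6)[OF T] by blast
    then show ?thesis using \<open>a \<noteq> 0\<close> by (intro exI[of _ "[:inverse a:]"] exI[of _ "[:b:]"]) (simp add: f hom_polys_const)
  next
    case False
    obtain q1 q2 s1 s2 where q: "(q1, q2) \<in> hom_polys T" "(s1, s2) \<in> hom_polys T"
      "m1 = q1 * f + s1" "m2 = q2 * g + s2" "s1 = 0 \<or> degree s1 < degree f"
      by (rule hom_polys_division[of f g m1 m2])
        (use min less.prems False in \<open>auto simp: minimal_hom_poly_def\<close>)
    have m0: "poly m1 r = 0" using min by (simp add: minimal_hom_poly_def)
    have "poly s1 r \<noteq> 0"
    proof
      assume s: "poly s1 r = 0"
      have "s1 = 0"
      proof (rule ccontr)
        assume "s1 \<noteq> 0"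
        then have "degree m1 \<le> degree s1" using min q(2) s by (auto simp: minimal_hom_poly_def)
        with \<open>s1 \<noteq> 0\<close> q(5) less.prems(3) show False by linarith
      qed
      then have m: "m1 = q1 * f" using q by simp
      moreover have "m1 \<noteq> 0" using min by (simp add: minimal_hom_poly_def)
      ultimately have q0: "q1 \<noteq> 0" "f \<noteq> 0" by auto
      have "poly q1 r = 0" using m0 m less.prems(2) by simp
      then have "degree m1 \<le> degree q1" using min q(1) q0 by (auto simp: minimal_hom_poly_def)
      then show False using m q0 False by (simp add: degree_mult_eq)
    qed
    moreover from this have "degree s1 < degree f" using q(5) by auto
    ultimately obtain k l where k: "(k, l) \<in> hom_polys T" "poly (s1 * k) r = 1"
      using less.hyps[of s1 s2] q(2) less.prems(3) by auto
    have "poly s1 r = - poly q1 r * poly f r" using m0 q(3) by (simp add: eq_neg_iff_add_eq_0 add.commute)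
    then have "poly (f * (0 - q1 * k)) r = 1" using k(2) by (simp add: algebra_simps)
    moreover have "(0 - q1 * k, 0 - q2 * l) \<in> hom_polys T"
      by (intro hom_polys_diff hom_polys_mult hom_polys_0 q k)
    ultimately show ?thesis by blast
  qed
qed

lemma hom_polys_unit:
  assumes "(f, g) \<in> hom_polys T" "poly f r \<noteq> 0"
  shows "\<exists>k l. (k, l) \<in> hom_polys T \<and> poly (f * k) r = 1"
proof -
  obtain q1 q2 s1 s2 where q: "(q1, q2) \<in> hom_polys T" "(s1, s2) \<in> hom_polys T"
    "f = q1 * m1 + s1" "g = q2 * m2 + s2" "s1 = 0 \<or> degree s1 < degree m1"
    by (rule hom_polys_division[of m1 m2 f g]) (use min assms in \<open>auto simp: minimal_hom_poly_def\<close>)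
  have "poly f r = poly s1 r" using q(3) min by (simp add: minimal_hom_poly_def)
  moreover from this assms q(5) have "degree s1 < degree m1" by auto
  ultimately show ?thesis using hom_polys_unit_small[OF q(2)] assms(2) by (simp add: poly_mult)
qed

text \<open>A polynomial vanishing at \<open>r\<close> is a multiple of \<open>m1\<close>, so its
  image is a multiple of \<open>m2\<close> and vanishes at \<open>c\<close>. If \<open>f\<close>
  does not vanish at \<open>r\<close>, it has an inverse \<open>k\<close> there; applying the first
  case to \<open>f * k - 1\<close> makes the image of \<open>f\<close> a unit at
  \<open>c\<close>.\<close>

lemma minimal_hom_poly_root:
  assumes c: "poly m2 c = 0"
  shows "hom_compatible T r c"
proof -
  have zero: "poly g c = 0" if "(f, g) \<in> hom_polys T" "poly f r = 0" for f g
    using minimal_hom_poly_dvd[OF that] c by (metis mult_zero_right poly_mult)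
  have "poly g c dvd 1" if fg: "(f, g) \<in> hom_polys T" "poly f r \<noteq> 0" for f g
  proof -
    obtain k l where k: "(k, l) \<in> hom_polys T" "poly (f * k) r = 1" using hom_polys_unit[OF fg] by blast
    have "(f * k - [:1:], g * l - [:1:]) \<in> hom_polys T"
      by (intro hom_polys_diff hom_polys_mult hom_polys_const partial_homD[OF T] fg k)
    from zero[OF this] k(2) have "poly g c * poly l c = 1" by simp
    then show "poly g c dvd 1" by (metis dvd_triv_left)
  qed
  with zero show ?thesis by (auto simp: hom_compatible_def)
qed

end

lemma countable_hom_polys:
  assumes "countable T"
  shows "countable (hom_polys T)"
proof -
  have "hom_polys T \<subseteq> (\<lambda>xs. (Poly (map fst xs), Poly (map snd xs))) ` lists T"
  proof
    fix p assume "p \<in> hom_polys T"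
    then obtain f g where p: "p = (f, g)" and fg: "(f, g) \<in> hom_polys T" by (cases p) auto
    define xs where "xs = map (\<lambda>n. (coeff f n, coeff g n)) [0..<Suc (degree f + degree g)]"
    have "xs \<in> lists T" using hom_polysD[OF fg] by (auto simp: xs_def simp del: upt_Suc)
    moreover have "Poly (map fst xs) = f"
      by (rule poly_eqI) (auto simp: coeff_Poly_eq nth_default_def xs_def coeff_eq_0 simp del: upt_Suc)
    moreover have "Poly (map snd xs) = g"
      by (rule poly_eqI) (auto simp: coeff_Poly_eq nth_default_def xs_def coeff_eq_0 simp del: upt_Suc)
    ultimately show "p \<in> (\<lambda>xs. (Poly (map fst xs), Poly (map snd xs))) ` lists T"
      using p by force
  qed
  then show ?thesis using assms by (meson countable_lists countable_image countable_subset)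
qed

text \<open>The one extension step behind field embeddings, derivations and the lifting of radicals.
  The countability clause allows further transcendental choices; the last clause bounds the
  extension from above.\<close>

lemma adjoin_pair:
  assumes "hom_compatible T r c"
  shows "\<exists>T'. partial_hom T' \<and> T \<subseteq> T' \<and> (r, c) \<in> T' \<and> (countable T \<longrightarrow> countable T')
    \<and> (\<forall>W. hom_closed W \<and> T \<subseteq> W \<and> (r, c) \<in> W \<longrightarrow> T' \<subseteq> W)"
proof -
  have zero: "poly g c = 0" if "(f, g) \<in> hom_polys T" "poly f r = 0" for f g
    using assms that by (auto simp: hom_compatible_def)
  have unit: "poly g c dvd 1" if "(f, g) \<in> hom_polys T" "poly f r \<noteq> 0" for f g
    using assms that by (auto simp: hom_compatible_def)
  \<comment> \<open>Pairs of fractions f(r)/k(r) and g(c)/l(c), with the divisions multiplied out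
    because the second component lies in a ring. Compatibility makes l(c) a unit, so
    \<open>b\<close> is determined.\<close>
  define T' where "T' = {(a, b). \<exists>f g k l. (f, g) \<in> hom_polys T \<and> (k, l) \<in> hom_polys T \<and>
    poly k r \<noteq> 0 \<and> a * poly k r = poly f r \<and> b * poly l c = poly g c}"
  have intro: "(a, b) \<in> T'" if "(f, g) \<in> hom_polys T" "(k, l) \<in> hom_polys T" "poly k r \<noteq> 0"
    "a * poly k r = poly f r" "b * poly l c = poly g c" for a b f g k l
    using that unfolding T'_def by blast
  have one: "([:1:], [:1:]) \<in> hom_polys T" by (intro hom_polys_const partial_homD[OF T])
  have const: "(a, b) \<in> T'" if "(a, b) \<in> T" for a b
    by (rule intro[OF hom_polys_const[OF that] one]) auto
  have closed: "(a + a', b + b') \<in> T' \<and> (a - a', b - b') \<in> T' \<and> (a * a', b * b') \<in> T'"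
    if ab: "(a, b) \<in> T'" "(a', b') \<in> T'" for a b a' b'
  proof -
    obtain f g k l where 1: "(f, g) \<in> hom_polys T" "(k, l) \<in> hom_polys T"
      "poly k r \<noteq> 0" "a * poly k r = poly f r" "b * poly l c = poly g c"
      using ab(1) unfolding T'_def by blast
    obtain f' g' k' l' where 2: "(f', g') \<in> hom_polys T" "(k', l') \<in> hom_polys T"
      "poly k' r \<noteq> 0" "a' * poly k' r = poly f' r" "b' * poly l' c = poly g' c"
      using ab(2) unfolding T'_def by blast
    note kl = hom_polys_mult[OF 1(2) 2(2)]
    have nz: "poly (k * k') r \<noteq> 0" using 1 2 by simp
    have "(a + a', b + b') \<in> T'"
      by (rule intro[OF hom_polys_add[OF hom_polys_mult[OF 1(1) 2(2)] hom_polys_mult[OF 2(1) 1(2)]] kl nz])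
        (simp_all add: algebra_simps flip: 1(4,5) 2(4,5))
    moreover have "(a - a', b - b') \<in> T'"
      by (rule intro[OF hom_polys_diff[OF hom_polys_mult[OF 1(1) 2(2)] hom_polys_mult[OF 2(1) 1(2)]] kl nz])
        (simp_all add: algebra_simps flip: 1(4,5) 2(4,5))
    moreover have "(a * a', b * b') \<in> T'"
      by (rule intro[OF hom_polys_mult[OF 1(1) 2(1)] kl nz])
        (simp_all add: algebra_simps flip: 1(4,5) 2(4,5))
    ultimately show ?thesis by blast
  qed
  have inv: "\<exists>b'. b * b' = 1 \<and> (inverse a, b') \<in> T'" if ab: "(a, b) \<in> T'" "a \<noteq> 0" for a b
  proof -
    obtain f g k l where 1: "(f, g) \<in> hom_polys T" "(k, l) \<in> hom_polys T"
      "poly k r \<noteq> 0" "a * poly k r = poly f r" "b * poly l c = poly g c"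
      using ab(1) unfolding T'_def by blast
    have nz: "poly f r \<noteq> 0" using 1(3,4) ab(2) by (metis mult_eq_0_iff)
    then obtain h where h: "1 = poly g c * h" using unit[OF 1(1)] by (auto elim: dvdE)
    have "(inverse a, poly l c * h) \<in> T'"
    proof (rule intro[OF 1(2,1) nz])
      show "inverse a * poly f r = poly k r" using ab(2) by (simp flip: 1(4))
      have "poly l c * h * poly g c = poly l c * (poly g c * h)" by (simp only: mult_ac)
      then show "poly l c * h * poly g c = poly l c" by (simp flip: h)
    qed
    moreover have "b * (poly l c * h) = 1" using h 1(5) by (simp add: mult.assoc[symmetric])
    ultimately show ?thesis by blast
  qed
  have z: "b = 0" if ab: "(0, b) \<in> T'" for b
  proof -
    obtain f g k l where 1: "(f, g) \<in> hom_polys T" "(k, l) \<in> hom_polys T"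
      "poly k r \<noteq> 0" "0 * poly k r = poly f r" "b * poly l c = poly g c"
      using ab unfolding T'_def by blast
    then have "b * poly l c = 0" using zero[OF 1(1)] by simp
    moreover obtain h where "1 = poly l c * h" using unit[OF 1(2,3)] by (auto elim: dvdE)
    ultimately show ?thesis by (metis mult.assoc mult.right_neutral mult_zero_left)
  qed
  have hom: "partial_hom T'"
    by (rule partial_homI) (use const partial_homD(1,2)[OF T] closed inv z in auto)
  have rc: "(r, c) \<in> T'"
    by (rule intro[OF hom_polys_pCons[OF partial_homD(1)[OF T] one] one]) auto
  have count: "countable T'" if "countable T"
  proof -
    let ?F = "\<lambda>((f, g), (k, l)). (poly f r / poly k r, poly g c * (SOME h. poly l c * h = 1))"
    have "T' \<subseteq> ?F ` (hom_polys T \<times> hom_polys T)"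
    proof
      fix p assume "p \<in> T'"
      then obtain a b f g k l where p: "p = (a, b)" and 1: "(f, g) \<in> hom_polys T" "(k, l) \<in> hom_polys T"
        "poly k r \<noteq> 0" "a * poly k r = poly f r" "b * poly l c = poly g c"
        unfolding T'_def by blast
      obtain h where "poly l c * h = 1" using unit[OF 1(2,3)] by (metis dvdE)
      then have "poly l c * (SOME h. poly l c * h = 1) = 1" by (rule someI)
      then have "b = poly g c * (SOME h. poly l c * h = 1)"
        using 1(5) by (metis mult.assoc mult.right_neutral)
      moreover have "a = poly f r / poly k r" using 1(3,4) by (simp add: field_simps)
      ultimately have "p = ?F ((f, g), (k, l))" using p by simp
      then show "p \<in> ?F ` (hom_polys T \<times> hom_polys T)" using 1(1,2) by blast
    qed
    moreover have "countable (?F ` (hom_polys T \<times> hom_polys T))"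
      using countable_hom_polys[OF that] by auto
    ultimately show ?thesis using countable_subset by blast
  qed
  have least: "T' \<subseteq> W" if W: "hom_closed W" "T \<subseteq> W" "(r, c) \<in> W" for W
  proof
    fix p assume "p \<in> T'"
    then obtain a b f g k l where p: "p = (a, b)" and 1: "(f, g) \<in> hom_polys T" "(k, l) \<in> hom_polys T"
      "poly k r \<noteq> 0" "a * poly k r = poly f r" "b * poly l c = poly g c"
      unfolding T'_def by blast
    obtain h where h: "poly l c * h = 1" using unit[OF 1(2,3)] by (metis dvdE)
    have "(inverse (poly k r), h) \<in> W"
      by (rule hom_closedD(3)[OF W(1) hom_polys_eval[OF 1(2) W(2,3,1)] 1(3) h])
    then have "(poly f r * inverse (poly k r), poly g c * h) \<in> W"
      by (rule hom_closedD(2)[OF W(1) hom_polys_eval[OF 1(1) W(2,3,1)]])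
    moreover have "b = poly g c * h" using 1(5) h by (metis mult.assoc mult.right_neutral)
    moreover have "a = poly f r * inverse (poly k r)" using 1(3,4) by (simp add: field_simps)
    ultimately show "p \<in> W" using p by simp
  qed
  have "T \<subseteq> T'" using const by auto
  then show ?thesis using hom rc count least by blast
qed

end

section \<open>Algebraic independence and transcendence\<close>

lemma poly_mapping_sum_singles:
  "(\<Sum>k\<in>Poly_Mapping.keys p. Poly_Mapping.single k (Poly_Mapping.lookup p k)) = p"
proof (rule poly_mapping_eqI)
  fix k
  show "Poly_Mapping.lookup (\<Sum>k\<in>Poly_Mapping.keys p. Poly_Mapping.single k (Poly_Mapping.lookup p k)) k
    = Poly_Mapping.lookup p k"
    by (cases "k \<in> Poly_Mapping.keys p")
      (simp_all add: lookup_sum lookup_single when_def sum.delta' in_keys_iff)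
qed

lemma poly_mapping_single_induct [case_names zero add]:
  assumes "P 0" "\<And>p k v. P p \<Longrightarrow> P (Poly_Mapping.single k v + p)"
  shows "P (p :: 'b \<Rightarrow>\<^sub>0 'c::comm_monoid_add)"
proof -
  have "P (\<Sum>k\<in>A. Poly_Mapping.single k (f k))" if "finite A" for A and f :: "'b \<Rightarrow> 'c"
    using that by (induction A rule: finite_induct) (simp_all add: assms)
  then show ?thesis using poly_mapping_sum_singles[of p] by (metis finite_keys)
qed

definition monomial_eval :: "('i \<Rightarrow> complex) \<Rightarrow> ('i \<Rightarrow>\<^sub>0 nat) \<Rightarrow> complex" where
  "monomial_eval d m = (\<Prod>i\<in>Poly_Mapping.keys m. d i ^ Poly_Mapping.lookup m i)"

lemma monomial_eval_superset:
  assumes "finite A" "Poly_Mapping.keys m \<subseteq> A"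
  shows "monomial_eval d m = (\<Prod>i\<in>A. d i ^ Poly_Mapping.lookup m i)"
  unfolding monomial_eval_def using assms
  by (intro prod.mono_neutral_left) (auto simp: in_keys_iff)

lemma monomial_eval_add: "monomial_eval d (m + m') = monomial_eval d m * monomial_eval d m'"
proof -
  let ?A = "Poly_Mapping.keys m \<union> Poly_Mapping.keys m'"
  have "finite ?A" "Poly_Mapping.keys (m + m') \<subseteq> ?A" by (auto dest: subsetD[OF Poly_Mapping.keys_add])
  then show ?thesis
    by (simp add: monomial_eval_superset[of ?A] lookup_add power_add prod.distrib)
qed

lemma monomial_eval_single: "monomial_eval d (Poly_Mapping.single i n) = d i ^ n"
  by (subst monomial_eval_superset[of "{i}"]) auto

lemma mpoly_eval_superset:
  assumes "finite A" "Poly_Mapping.keys P \<subseteq> A"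
  shows "mpoly_eval d P = (\<Sum>m\<in>A. of_rat (Poly_Mapping.lookup P m) * monomial_eval d m)"
  unfolding mpoly_eval_def monomial_eval_def[symmetric] using assms
  by (intro sum.mono_neutral_left) (auto simp: in_keys_iff)

lemma mpoly_eval_0 [simp]: "mpoly_eval d 0 = 0"
  by (simp add: mpoly_eval_def)

lemma mpoly_eval_add: "mpoly_eval d (P + Q) = mpoly_eval d P + mpoly_eval d Q"
proof -
  let ?A = "Poly_Mapping.keys P \<union> Poly_Mapping.keys Q"
  have "finite ?A" "Poly_Mapping.keys (P + Q) \<subseteq> ?A" by (auto dest: subsetD[OF Poly_Mapping.keys_add])
  then show ?thesis
    by (simp add: mpoly_eval_superset[of ?A] lookup_add of_rat_add sum.distrib distrib_right)
qed

lemma mpoly_eval_sum: "mpoly_eval d (sum F A) = (\<Sum>a\<in>A. mpoly_eval d (F a))"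
  by (induction A rule: infinite_finite_induct) (auto simp: mpoly_eval_add)

lemma mpoly_eval_single: "mpoly_eval d (Poly_Mapping.single m c) = of_rat c * monomial_eval d m"
  by (subst mpoly_eval_superset[of "{m}"]) auto

lemma mpoly_eval_mult_single:
  "mpoly_eval d (P * Poly_Mapping.single m c) = mpoly_eval d P * (of_rat c * monomial_eval d m)"
  by (induction P rule: poly_mapping_single_induct)
    (simp_all add: mpoly_eval_add mpoly_eval_single distrib_right mult_single of_rat_mult monomial_eval_add)

lemma mpoly_eval_mult: "mpoly_eval d (P * Q) = mpoly_eval d P * mpoly_eval d Q"
  by (induction Q rule: poly_mapping_single_induct)
    (simp_all add: mpoly_eval_add mpoly_eval_single distrib_left mpoly_eval_mult_single)

lemma mpoly_vars_0 [simp]: "mpoly_vars 0 = {}"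
  by (simp add: mpoly_vars_def)

lemma mpoly_vars_single: "mpoly_vars (Poly_Mapping.single m c) \<subseteq> Poly_Mapping.keys m"
  by (auto simp: mpoly_vars_def split: if_splits)

lemma mpoly_vars_add: "mpoly_vars (P + Q) \<subseteq> mpoly_vars P \<union> mpoly_vars Q"
  by (auto simp: mpoly_vars_def dest!: subsetD[OF Poly_Mapping.keys_add])

lemma mpoly_vars_sum: "(\<And>a. a \<in> A \<Longrightarrow> mpoly_vars (F a) \<subseteq> I) \<Longrightarrow> mpoly_vars (sum F A) \<subseteq> I"
proof (induction A rule: infinite_finite_induct)
  case (insert a A)
  then show ?case using mpoly_vars_add[of "F a" "sum F A"] by simp blast
qed auto

lemma mpoly_vars_mult: "mpoly_vars (P * Q) \<subseteq> mpoly_vars P \<union> mpoly_vars Q"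
proof
  fix i assume "i \<in> mpoly_vars (P * Q)"
  then obtain m where "m \<in> Poly_Mapping.keys (P * Q)" "i \<in> Poly_Mapping.keys m" by (auto simp: mpoly_vars_def)
  then obtain a b where "a \<in> Poly_Mapping.keys P" "b \<in> Poly_Mapping.keys Q" "i \<in> Poly_Mapping.keys (a + b)"
    using keys_mult[of P Q] by blast
  then show "i \<in> mpoly_vars P \<union> mpoly_vars Q"
    using Poly_Mapping.keys_add[of a b] by (auto simp: mpoly_vars_def)
qed

lemma lookup_mult_single_add:
  fixes P :: "('i \<Rightarrow>\<^sub>0 nat) \<Rightarrow>\<^sub>0 rat"
  shows "Poly_Mapping.lookup (P * Poly_Mapping.single t 1) (m + t) = Poly_Mapping.lookup P m"
  by (induction P rule: poly_mapping_single_induct)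
    (simp_all add: lookup_add distrib_right mult_single lookup_single when_def)

section \<open>The ring generated by the lengths and its field of fractions\<close>

definition values_ring :: "('i \<Rightarrow> complex) \<Rightarrow> 'i set \<Rightarrow> complex set" where
  "values_ring d I = {mpoly_eval d P |P. mpoly_vars P \<subseteq> I}"

lemma values_ring_closed:
  shows "0 \<in> values_ring d I" "1 \<in> values_ring d I" "i \<in> I \<Longrightarrow> d i \<in> values_ring d I"
    "a \<in> values_ring d I \<Longrightarrow> b \<in> values_ring d I \<Longrightarrow> a + b \<in> values_ring d I"
    "a \<in> values_ring d I \<Longrightarrow> b \<in> values_ring d I \<Longrightarrow> a * b \<in> values_ring d I"
    "a \<in> values_ring d I \<Longrightarrow> - a \<in> values_ring d I"
proof -
  have intro: "mpoly_eval d P \<in> values_ring d I" if "mpoly_vars P \<subseteq> I" for P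
    using that by (auto simp: values_ring_def)
  have "mpoly_vars 0 \<subseteq> I" by simp
  from intro[OF this] show "0 \<in> values_ring d I" by simp
  have one: "mpoly_eval d (Poly_Mapping.single 0 c) \<in> values_ring d I" for c
    by (intro intro order.trans[OF mpoly_vars_single]) simp
  have "mpoly_eval d 1 = 1" using mpoly_eval_single[of d 0 1] by (simp add: monomial_eval_def)
  with one[of 1] show "1 \<in> values_ring d I" by simp
  show "d i \<in> values_ring d I" if "i \<in> I"
    using intro[OF order.trans[OF mpoly_vars_single[of "Poly_Mapping.single i 1" 1]]] that
    by (simp add: mpoly_eval_single monomial_eval_single)
  show "a + b \<in> values_ring d I" if ab: "a \<in> values_ring d I" "b \<in> values_ring d I" for a b
  proof -
    obtain P Q where "a = mpoly_eval d P" "mpoly_vars P \<subseteq> I" "b = mpoly_eval d Q" "mpoly_vars Q \<subseteq> I"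
      using ab by (auto simp: values_ring_def)
    then show ?thesis using intro[of "P + Q"] mpoly_vars_add[of P Q] by (auto simp: mpoly_eval_add)
  qed
  show mult: "a * b \<in> values_ring d I" if ab: "a \<in> values_ring d I" "b \<in> values_ring d I" for a b
  proof -
    obtain P Q where "a = mpoly_eval d P" "mpoly_vars P \<subseteq> I" "b = mpoly_eval d Q" "mpoly_vars Q \<subseteq> I"
      using ab by (auto simp: values_ring_def)
    then show ?thesis using intro[of "P * Q"] mpoly_vars_mult[of P Q] by (auto simp: mpoly_eval_mult)
  qed
  show "- a \<in> values_ring d I" if "a \<in> values_ring d I"
    using mult[OF one[of "-1"] that] by (simp add: mpoly_eval_single monomial_eval_def)
qed

lemma generated_subfield_values_ring:
  assumes "a \<in> generated_subfield (d ` I)"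
  obtains p q where "p \<in> values_ring d I" "q \<in> values_ring d I" "q \<noteq> 0" "a * q = p"
proof -
  let ?F = "{a. \<exists>p\<in>values_ring d I. \<exists>q\<in>values_ring d I. q \<noteq> 0 \<and> a * q = p}"
  note vr = values_ring_closed[where d = d and I = I]
  have F: "a \<in> ?F" if "p \<in> values_ring d I" "q \<in> values_ring d I" "q \<noteq> 0" "a * q = p" for a p q
    using that by blast
  have "is_subfield ?F"
    unfolding is_subfield_def
  proof (intro conjI ballI)
    show "0 \<in> ?F" "1 \<in> ?F" using F[OF vr(1,2)] F[OF vr(2,2)] by auto
    fix a assume "a \<in> ?F"
    then obtain p q where a: "p \<in> values_ring d I" "q \<in> values_ring d I" "q \<noteq> 0" "a * q = p" by blast
    show "inverse a \<in> ?F"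
    proof (cases "a = 0")
      case False
      then show ?thesis using a by (intro F[OF a(2,1)]) auto
    qed (use \<open>0 \<in> ?F\<close> in simp)
    fix b assume "b \<in> ?F"
    then obtain p' q' where b: "p' \<in> values_ring d I" "q' \<in> values_ring d I" "q' \<noteq> 0" "b * q' = p'" by blast
    have nz: "q * q' \<noteq> 0" using a b by simp
    show "a + b \<in> ?F"
      by (rule F[OF vr(4)[OF vr(5)[OF a(1) b(2)] vr(5)[OF b(1) a(2)]] vr(5)[OF a(2) b(2)] nz])
        (simp add: algebra_simps flip: a(4) b(4))
    show "a - b \<in> ?F"
      by (rule F[OF vr(4)[OF vr(5)[OF a(1) b(2)] vr(6)[OF vr(5)[OF b(1) a(2)]]] vr(5)[OF a(2) b(2)] nz])
        (simp add: algebra_simps flip: a(4) b(4))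
    show "a * b \<in> ?F"
      by (rule F[OF vr(5)[OF a(1) b(1)] vr(5)[OF a(2) b(2)] nz])
        (simp add: algebra_simps flip: a(4) b(4))
  qed
  moreover have "d ` I \<subseteq> ?F"
  proof
    fix a assume "a \<in> d ` I"
    then have "a \<in> values_ring d I" using vr(3) by blast
    then show "a \<in> ?F" by (intro F[OF _ vr(2)]) auto
  qed
  ultimately show thesis using generated_subfield_least assms that by blast
qed

lemma values_ring_subset_generated: "values_ring d I \<subseteq> generated_subfield (d ` I)"
proof
  note sf = is_subfield_generated[of "d ` I"]
  fix a assume "a \<in> values_ring d I"
  then obtain P where a: "a = mpoly_eval d P" and P: "mpoly_vars P \<subseteq> I" by (auto simp: values_ring_def)
  have "monomial_eval d m \<in> generated_subfield (d ` I)" if "m \<in> Poly_Mapping.keys P" for m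
  proof -
    have "(\<Prod>i\<in>A. d i ^ k i) \<in> generated_subfield (d ` I)" if "finite A" "A \<subseteq> I" for A k
      using that generated_subfield_superset[of "d ` I"]
      by (induction A rule: finite_induct)
        (auto intro!: is_subfieldD[OF sf] is_subfield_power[OF sf])
    moreover have "Poly_Mapping.keys m \<subseteq> I" using that P by (auto simp: mpoly_vars_def)
    ultimately show ?thesis by (simp add: monomial_eval_def)
  qed
  then show "a \<in> generated_subfield (d ` I)"
    unfolding a mpoly_eval_def monomial_eval_def[symmetric]
    by (intro is_subfield_sum[OF sf] is_subfieldD[OF sf] is_subfield_of_rat[OF sf])
qed

definition transcendental_over :: "'a::field set \<Rightarrow> 'a \<Rightarrow> bool" where
  "transcendental_over S r \<longleftrightarrow> (\<forall>f. (\<forall>n. coeff f n \<in> S) \<and> poly f r = 0 \<longrightarrow> f = 0)"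

lemma transcendental_over_mono: "transcendental_over S r \<Longrightarrow> S' \<subseteq> S \<Longrightarrow> transcendental_over S' r"
  by (auto simp: transcendental_over_def)

lemma clear_denominators:
  assumes "\<And>n. coeff f n \<in> generated_subfield (d ` I)"
  shows "\<exists>b\<in>values_ring d I. b \<noteq> 0 \<and> (\<forall>n. b * coeff f n \<in> values_ring d I)"
  using assms
proof (induction f)
  case 0
  then show ?case using values_ring_closed(1,2) by (intro bexI[of _ 1]) auto
next
  case (pCons a f)
  have "coeff f n \<in> generated_subfield (d ` I)" for n using pCons.prems[of "Suc n"] by simp
  then obtain b where b: "b \<in> values_ring d I" "b \<noteq> 0" "\<And>n. b * coeff f n \<in> values_ring d I"
    using pCons.IH by blast
  have "a \<in> generated_subfield (d ` I)" using pCons.prems[of 0] by simp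
  then obtain p q where q: "p \<in> values_ring d I" "q \<in> values_ring d I" "q \<noteq> 0" "a * q = p"
    by (rule generated_subfield_values_ring)
  have "b * q * coeff (pCons a f) n \<in> values_ring d I" for n
  proof (cases n)
    case 0
    then show ?thesis using values_ring_closed(5)[OF b(1) q(1)] by (simp add: mult_ac flip: q(4))
  next
    case (Suc k)
    then show ?thesis using values_ring_closed(5)[OF b(3)[of k] q(2)] by (simp add: mult_ac)
  qed
  then show ?case using b q values_ring_closed(5)[OF b(1) q(2)] by (intro bexI[of _ "b * q"]) auto
qed

text \<open>After clearing denominators, a relation for \<open>d i\<close> becomes the vanishing of
  a sum of terms \<open>P n\<close> times the n-th power of the variable \<open>i\<close>. As
  \<open>i\<close> does not occur in any \<open>P n\<close>, different \<open>n\<close> contribute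
  different monomials and cannot cancel.\<close>

lemma algebraically_independent_transcendental:
  assumes "algebraically_independent d (insert i I)" "i \<notin> I"
  shows "transcendental_over (generated_subfield (d ` I)) (d i)"
  unfolding transcendental_over_def
proof (intro allI impI, elim conjE)
  fix f assume f: "\<forall>n. coeff f n \<in> generated_subfield (d ` I)" "poly f (d i) = 0"
  obtain b where b: "b \<noteq> 0" "\<And>n. b * coeff f n \<in> values_ring d I"
    using clear_denominators f by blast
  have "\<exists>P. mpoly_vars P \<subseteq> I \<and> mpoly_eval d P = b * coeff f n" for n
    using b(2)[of n] by (auto simp: values_ring_def)
  then obtain P where P: "\<And>n. mpoly_vars (P n) \<subseteq> I" "\<And>n. mpoly_eval d (P n) = b * coeff f n"
    by metis
  let ?s = "\<lambda>n. Poly_Mapping.single i (n::nat)"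
  let ?Q = "\<Sum>n\<le>degree f. P n * Poly_Mapping.single (?s n) 1"
  have "mpoly_eval d ?Q = b * poly f (d i)"
    by (simp add: mpoly_eval_sum mpoly_eval_mult mpoly_eval_single monomial_eval_single P(2)
        poly_altdef sum_distrib_left mult_ac)
  moreover have "mpoly_vars ?Q \<subseteq> insert i I"
  proof (rule mpoly_vars_sum)
    fix n
    show "mpoly_vars (P n * Poly_Mapping.single (?s n) 1) \<subseteq> insert i I"
      using mpoly_vars_mult[of "P n" "Poly_Mapping.single (?s n) 1"] P(1)[of n]
        mpoly_vars_single[of "?s n" 1] by (force split: if_splits)
  qed
  ultimately have Q0: "?Q = 0" using assms(1) f(2) by (simp add: algebraically_independent_def)
  have "P n = 0" if n: "n \<le> degree f" for n
  proof (rule ccontr)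
    assume "P n \<noteq> 0"
    then obtain m where m: "m \<in> Poly_Mapping.keys (P n)" by (metis keys_eq_empty ex_in_conv)
    have zero: "Poly_Mapping.lookup m i = 0" if "m \<in> Poly_Mapping.keys (P k)" for m k
      using that P(1)[of k] assms(2) by (force simp: mpoly_vars_def in_keys_iff)
    have *: "Poly_Mapping.lookup (P k * Poly_Mapping.single (?s k) 1) (m + ?s n) = 0" if "k \<noteq> n" for k
    proof (rule ccontr)
      assume "Poly_Mapping.lookup (P k * Poly_Mapping.single (?s k) 1) (m + ?s n) \<noteq> 0"
      then have "m + ?s n \<in> Poly_Mapping.keys (P k * Poly_Mapping.single (?s k) 1)" by (simp add: in_keys_iff)
      then obtain a where "a \<in> Poly_Mapping.keys (P k)" "m + ?s n = a + ?s k"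
        using keys_mult[of "P k" "Poly_Mapping.single (?s k) 1"] by (auto split: if_splits)
      then have "Poly_Mapping.lookup (m + ?s n) i = Poly_Mapping.lookup (a + ?s k) i"
        and "Poly_Mapping.lookup a i = 0" using zero by auto
      then show False using that zero[OF m] by (simp add: lookup_add)
    qed
    have "Poly_Mapping.lookup ?Q (m + ?s n) = (\<Sum>k\<le>degree f. if k = n then Poly_Mapping.lookup (P n) m else 0)"
      unfolding lookup_sum by (intro sum.cong) (auto simp: lookup_mult_single_add *)
    also have "\<dots> = Poly_Mapping.lookup (P n) m" using n by simp
    finally show False using Q0 m by (simp add: in_keys_iff)
  qed
  then have "coeff f n = 0" if "n \<le> degree f" for n using P(2)[of n] b(1) that by simp
  then show "f = 0" by (metis le_refl leading_coeff_0_iff)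
qed

text \<open>A polynomial relation is sorted by powers of the variable \<open>i\<close>.
  Transcendence of \<open>d i\<close> kills the value of each coefficient, and independence over
  \<open>I\<close> then kills the coefficient itself.\<close>

lemma algebraically_independent_insert:
  assumes "algebraically_independent d I" "transcendental_over (generated_subfield (d ` I)) (d i)"
  shows "algebraically_independent d (insert i I)"
  unfolding algebraically_independent_def
proof (intro allI impI, elim conjE)
  fix P :: "('a \<Rightarrow>\<^sub>0 nat) \<Rightarrow>\<^sub>0 rat" assume P: "mpoly_vars P \<subseteq> insert i I" "mpoly_eval d P = 0"
  let ?s = "\<lambda>n. Poly_Mapping.single i (n::nat)"
  let ?K = "Poly_Mapping.keys P"
  \<comment> \<open>\<open>N\<close> exceeds each exponent of \<open>i\<close> in \<open>P\<close>,
    being one more than their sum. \<open>F n\<close> is the coefficient of the n-th power of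
    \<open>i\<close>; the truncated subtraction in it removes exactly the exponent of
    \<open>i\<close>.\<close>
  define N where "N = Suc (\<Sum>m\<in>?K. Poly_Mapping.lookup m i)"
  define F where "F n = (\<Sum>m\<in>{m\<in>?K. Poly_Mapping.lookup m i = n}.
    Poly_Mapping.single (m - ?s n) (Poly_Mapping.lookup P m))" for n
  have split: "m - ?s (Poly_Mapping.lookup m i) + ?s (Poly_Mapping.lookup m i) = m" for m :: "'a \<Rightarrow>\<^sub>0 nat"
    by (rule poly_mapping_eqI) (auto simp: lookup_add lookup_minus lookup_single when_def)
  have "(\<Sum>n<N. F n * Poly_Mapping.single (?s n) 1)
    = (\<Sum>n<N. \<Sum>m\<in>{m\<in>?K. Poly_Mapping.lookup m i = n}. Poly_Mapping.single m (Poly_Mapping.lookup P m))"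
    unfolding F_def sum_distrib_right using split by (auto simp: mult_single intro!: sum.cong)
  also have "\<dots> = (\<Sum>m\<in>?K. Poly_Mapping.single m (Poly_Mapping.lookup P m))"
    by (intro sum.group) (auto simp: N_def less_Suc_eq_le intro!: member_le_sum)
  finally have PF: "P = (\<Sum>n<N. F n * Poly_Mapping.single (?s n) 1)" by (simp add: poly_mapping_sum_singles)
  have vars: "mpoly_vars (F n) \<subseteq> I" for n
    unfolding F_def
  proof (rule mpoly_vars_sum)
    fix m assume m: "m \<in> {m\<in>?K. Poly_Mapping.lookup m i = n}"
    have "j \<in> I" if "j \<in> Poly_Mapping.keys (m - ?s n)" for j
    proof -
      have "Poly_Mapping.lookup (m - ?s n) j \<noteq> 0" using that by (simp add: in_keys_iff)
      then have "j \<noteq> i" "j \<in> Poly_Mapping.keys m"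
        using m by (auto simp: lookup_minus lookup_single when_def in_keys_iff split: if_splits)
      then show ?thesis using P(1) m by (auto simp: mpoly_vars_def)
    qed
    then show "mpoly_vars (Poly_Mapping.single (m - ?s n) (Poly_Mapping.lookup P m)) \<subseteq> I"
      using order.trans[OF mpoly_vars_single subsetI] by metis
  qed
  let ?f = "\<Sum>n<N. monom (mpoly_eval d (F n)) n"
  have coeff_f: "coeff ?f n = (if n < N then mpoly_eval d (F n) else 0)" for n
    by (simp add: coeff_sum)
  have "poly ?f (d i) = mpoly_eval d P"
    by (subst PF) (simp add: poly_sum poly_monom mpoly_eval_sum mpoly_eval_mult mpoly_eval_single monomial_eval_single)
  moreover have "coeff ?f n \<in> generated_subfield (d ` I)" for n
    using values_ring_subset_generated[of d I] vars[of n] is_subfieldD(1)[OF is_subfield_generated]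
    by (auto simp: coeff_f values_ring_def)
  ultimately have "?f = 0" using P(2) assms(2) unfolding transcendental_over_def by metis
  then have "mpoly_eval d (F n) = 0" if "n < N" for n using coeff_f[of n] that by simp
  then have "F n = 0" if "n < N" for n
    using assms(1) vars that by (auto simp: algebraically_independent_def)
  then show "P = 0" by (subst PF) simp
qed

lemma algebraically_independent_empty: "algebraically_independent d {}"
proof -
  have "P = 0" if "mpoly_vars P \<subseteq> {}" "mpoly_eval d P = 0" for P
  proof -
    have "Poly_Mapping.keys P \<subseteq> {0}" using that(1) by (auto simp: mpoly_vars_def)
    then have "mpoly_eval d P = of_rat (Poly_Mapping.lookup P 0)"
      by (subst mpoly_eval_superset[of "{0}"]) (auto simp: monomial_eval_def)
    then have "0 \<notin> Poly_Mapping.keys P" using that(2) by (simp add: in_keys_iff)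
    then show ?thesis using \<open>Poly_Mapping.keys P \<subseteq> {0}\<close> keys_eq_empty by blast
  qed
  then show ?thesis by (auto simp: algebraically_independent_def)
qed

lemma algebraically_independent_subset:
  "algebraically_independent d I \<Longrightarrow> J \<subseteq> I \<Longrightarrow> algebraically_independent d J"
  by (auto simp: algebraically_independent_def)

text \<open>Transcendence depends only on the set of values, so adjoining the indices one at a time
  avoids renaming variables in polynomials.\<close>

lemma algebraically_independent_reindex:
  assumes "finite J" "inj_on \<phi> J" "algebraically_independent d (\<phi> ` J)" "\<And>j. j \<in> J \<Longrightarrow> D j = d (\<phi> j)"
  shows "algebraically_independent D J"
  using assms
proof (induction J rule: finite_induct)
  case (insert j J)
  have "transcendental_over (generated_subfield (d ` \<phi> ` J)) (d (\<phi> j))"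
    using insert.prems insert.hyps by (intro algebraically_independent_transcendental) auto
  moreover have "d ` \<phi> ` J = D ` J" using insert.prems(3) by (force simp: image_iff)
  ultimately have "transcendental_over (generated_subfield (D ` J)) (D j)" using insert.prems(3) by simp
  moreover have "algebraically_independent D J"
    using insert by (auto intro: algebraically_independent_subset)
  ultimately show ?case by (rule algebraically_independent_insert[rotated])
qed (simp add: algebraically_independent_empty)

section \<open>Extending partial homomorphisms\<close>

text \<open>Countably many polynomials have countably many roots in all. The set \<open>U\<close> is
  left free so that the choice can be confined to series of a prescribed shape.\<close>

lemma ex_transcendental_over:
  fixes S :: "'a::field set"
  assumes "countable S" "uncountable U"
  shows "\<exists>u\<in>U. transcendental_over S u"
proof -
  let ?P = "{f :: 'a poly. f \<noteq> 0 \<and> (\<forall>n. coeff f n \<in> S)}"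
  have "?P \<subseteq> Poly ` lists S"
  proof
    fix f assume "f \<in> ?P"
    then have "coeffs f \<in> lists S" by (auto simp: coeffs_def)
    then show "f \<in> Poly ` lists S" by (metis Poly_coeffs image_eqI)
  qed
  then have "countable ?P" by (rule countable_subset[OF _ countable_image[OF countable_lists[OF assms(1)]]])
  moreover have "countable {x. poly f x = 0}" if "f \<in> ?P" for f
    using that poly_roots_finite[of f] by (simp add: countable_finite)
  ultimately have "countable (\<Union>f\<in>?P. {x. poly f x = 0})" by (rule countable_UN)
  with assms(2) have "\<not> U \<subseteq> (\<Union>f\<in>?P. {x. poly f x = 0})"
    using countable_subset[of U "\<Union>f\<in>?P. {x. poly f x = 0}"] by argo
  then obtain u where "u \<in> U" "u \<notin> (\<Union>f\<in>?P. {x. poly f x = 0})" by (meson subsetI)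
  then show ?thesis unfolding transcendental_over_def by blast
qed

lemma hom_polys_fst:
  assumes "(f, g) \<in> hom_polys T"
  shows "coeff f n \<in> fst ` T"
  using hom_polysD[OF assms, of n] by force

lemma hom_polys_snd:
  assumes "(f, g) \<in> hom_polys T"
  shows "coeff g n \<in> snd ` T"
  using hom_polysD[OF assms, of n] by force

lemma ex_hom_polys:
  assumes "partial_hom T" "\<And>n. coeff f n \<in> fst ` T"
  shows "\<exists>g. (f, g) \<in> hom_polys T"
  using assms(2)
proof (induction f)
  case 0
  then show ?case using hom_polys_0[OF assms(1)] by blast
next
  case (pCons a f)
  have "coeff f n \<in> fst ` T" for n using pCons.prems[of "Suc n"] by simp
  then obtain g where "(f, g) \<in> hom_polys T" using pCons.IH by blast
  moreover obtain b where "(a, b) \<in> T" using pCons.prems[of 0] by auto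
  ultimately show ?case using hom_polys_pCons[OF assms(1)] by blast
qed

lemma hom_compatible_transcendental:
  assumes T: "partial_hom T" and r: "transcendental_over (fst ` T) r"
    and unit: "\<And>f g. (f, g) \<in> hom_polys T \<Longrightarrow> poly f r \<noteq> 0 \<Longrightarrow> poly g c dvd 1"
  shows "hom_compatible T r c"
proof -
  have "poly g c = 0" if fg: "(f, g) \<in> hom_polys T" "poly f r = 0" for f g
  proof -
    have "f = 0" using r fg(2) hom_polys_fst[OF fg(1)] unfolding transcendental_over_def by blast
    then show ?thesis using fg(1) hom_polys_zeroD[OF T, of g] by simp
  qed
  then show ?thesis using unit by (auto simp: hom_compatible_def)
qed

lemma hom_polys_snd_eq_0_iff:
  assumes "partial_hom (T :: ('a::field \<times> 'b::field) set)" "(f, g) \<in> hom_polys T"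
  shows "f = 0 \<longleftrightarrow> g = 0"
proof
  show "f = 0 \<Longrightarrow> g = 0" using assms hom_polys_zeroD by blast
  assume g: "g = 0"
  show "f = 0"
  proof (rule poly_eqI)
    fix n
    have "(coeff f n, 0) \<in> T" using hom_polysD[OF assms(2), of n] g by simp
    then show "coeff f n = coeff 0 n"
      using partial_hom_injective[OF assms(1) _ partial_homD(1)[OF assms(1)]] by simp
  qed
qed

lemma adjoin_transcendental_pair:
  fixes T :: "('a::field \<times> 'b::field) set"
  assumes T: "partial_hom T" "countable T"
    and r: "transcendental_over (fst ` T) r" and c: "transcendental_over (snd ` T) c"
  obtains T' where "partial_hom T'" "T \<subseteq> T'" "(r, c) \<in> T'" "countable T'"
proof -
  have unit: "poly g c dvd 1" if "(f, g) \<in> hom_polys T" "poly f r \<noteq> 0" for f g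
  proof -
    have "f \<noteq> 0" using that(2) by auto
    then have "g \<noteq> 0" using hom_polys_snd_eq_0_iff[OF T(1) that(1)] by simp
    then have "poly g c \<noteq> 0" using c hom_polys_snd[OF that(1)] unfolding transcendental_over_def by blast
    then show ?thesis by (simp add: dvd_field_iff)
  qed
  have "hom_compatible T r c"
    by (rule hom_compatible_transcendental[OF T(1) r unit])
  then show thesis using adjoin_pair[OF T(1)] that T(2) by blast
qed

section \<open>Embedding countable fields into an algebraically closed field\<close>

lemma minimal_hom_poly_degree:
  fixes T :: "('a::field \<times> 'b::field) set"
  assumes T: "partial_hom T" and m: "minimal_hom_poly T r m1 m2"
  shows "degree m2 > 0"
proof -
  have m': "(m1, m2) \<in> hom_polys T" "m1 \<noteq> 0" "poly m1 r = 0"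
    using m by (auto simp: minimal_hom_poly_def[OF T])
  have "degree m1 > 0" using m'(2,3) by (metis degree_eq_zeroE gr0I mult_zero_right pCons_0_0 poly_const_conv)
  moreover have "coeff m2 (degree m1) \<noteq> 0"
    using hom_polysD[OF m'(1), of "degree m1"] m'(2)
      partial_hom_injective[OF T _ partial_homD(1)[OF T]] by (metis leading_coeff_0_iff)
  ultimately show ?thesis using le_degree by (metis gr_zeroI le_zero_eq)
qed

text \<open>An algebraic \<open>r\<close> may go to any root of the image of its minimal polynomial.
  A transcendental \<open>r\<close> needs an image transcendental over the countable range of
  \<open>T\<close>, which an uncountable target provides.\<close>

lemma adjoin_alg_closed:
  fixes T :: "('a::field \<times> 'b::alg_closed_field) set"
  assumes T: "partial_hom T" "countable T" and unc: "uncountable (UNIV :: 'b set)"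
  obtains T' c where "partial_hom T'" "T \<subseteq> T'" "(r, c) \<in> T'" "countable T'"
proof (cases "transcendental_over (fst ` T) r")
  case True
  obtain c where "transcendental_over (snd ` T) c"
    using ex_transcendental_over[OF countable_image[OF T(2)] unc] by blast
  then show thesis by (rule adjoin_transcendental_pair[OF T True]) (rule that)
next
  case False
  then obtain f where f: "\<And>n. coeff f n \<in> fst ` T" "poly f r = 0" "f \<noteq> 0"
    by (auto simp: transcendental_over_def)
  obtain g where "(f, g) \<in> hom_polys T" using ex_hom_polys[OF T(1) f(1)] by blast
  then obtain m1 m2 where m: "minimal_hom_poly T r m1 m2"
    using ex_minimal_hom_poly[OF T(1)] f by blast
  have "degree m2 > 0" by (rule minimal_hom_poly_degree[OF T(1) m])
  then obtain c where "poly m2 c = 0" using alg_closed_imp_poly_has_root by blast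
  note root = minimal_hom_poly_root[OF T(1) m this]
  show thesis using adjoin_pair[OF T(1) root] that T(2) by blast
qed

lemma adjoin_alg_closed_finite:
  fixes T :: "('a::field \<times> 'b::alg_closed_field) set"
  assumes "partial_hom T" "countable T" "uncountable (UNIV :: 'b set)" "finite A"
  shows "\<exists>T'. partial_hom T' \<and> T \<subseteq> T' \<and> countable T' \<and> (\<forall>r\<in>A. \<exists>c. (r, c) \<in> T')"
  using assms(4)
proof (induction A rule: finite_induct)
  case empty
  then show ?case using assms by blast
next
  case (insert r A)
  then obtain T1 where T1: "partial_hom T1" "T \<subseteq> T1" "countable T1" "\<forall>r\<in>A. \<exists>c. (r, c) \<in> T1" by blast
  obtain T' c where "partial_hom T'" "T1 \<subseteq> T'" "(r, c) \<in> T'" "countable T'"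
    by (rule adjoin_alg_closed[OF T1(1,3) assms(3), of r])
  then show ?case using T1 by (intro exI[of _ T']) blast
qed

text \<open>
  A derivation \<open>\<delta>\<close> is the homomorphism \<open>a \<mapsto> a + \<delta>(a) \<epsilon>\<close> into the dual numbers, so derivations are
  extended by the same adjunction lemma as field embeddings.
\<close>

datatype 'a dual_number = Dual (std_part: 'a) (eps_part: 'a)

instantiation dual_number :: (comm_ring_1) comm_ring_1
begin
definition "0 = Dual 0 0"
definition "1 = Dual 1 0"
definition "a + b = Dual (std_part a + std_part b) (eps_part a + eps_part b)"
definition "a - b = Dual (std_part a - std_part b) (eps_part a - eps_part b)"
definition "- a = Dual (- std_part a) (- eps_part a)"
definition "a * b = Dual (std_part a * std_part b) (std_part a * eps_part b + eps_part a * std_part b)"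
instance
  by standard (auto simp: zero_dual_number_def one_dual_number_def plus_dual_number_def
      minus_dual_number_def uminus_dual_number_def times_dual_number_def algebra_simps
      intro: dual_number.expand)
end

lemmas dual_number_defs = zero_dual_number_def one_dual_number_def plus_dual_number_def
  minus_dual_number_def uminus_dual_number_def times_dual_number_def

lemma dual_number_dvd_1:
  assumes "std_part (z :: 'a::field dual_number) \<noteq> 0"
  shows "z dvd 1"
proof (rule dvdI)
  show "1 = z * Dual (1 / std_part z) (- eps_part z / (std_part z)\<^sup>2)"
    using assms by (simp add: dual_number_defs power2_eq_square field_simps)
qed

text \<open>A partial homomorphism inside this set is a derivation on its domain, written as a +
  \<delta>(a) \<epsilon>.\<close>

definition dual_lifts :: "('a \<times> 'a::comm_ring_1 dual_number) set" where
  "dual_lifts = {(a, b). std_part b = a}"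

lemma hom_closed_dual_lifts: "hom_closed (dual_lifts :: ('a::field \<times> 'a dual_number) set)"
  unfolding hom_closed_def
  by (auto simp: dual_lifts_def dual_number_defs intro: inverse_unique[symmetric])

text \<open>First-order Taylor expansion. The coefficients of \<open>g\<close> may have
  infinitesimal parts; these enter only through the value at \<open>Dual r 0\<close>.\<close>

lemma poly_dual_number:
  assumes "\<And>n. std_part (coeff g n) = coeff f n"
  shows "poly g (Dual r \<rho>) = poly g (Dual r 0) + Dual 0 (\<rho> * poly (pderiv f) r)"
    and "std_part (poly g (Dual r \<rho>)) = poly f r"
proof -
  have "poly g (Dual r \<rho>) = poly g (Dual r 0) + Dual 0 (\<rho> * poly (pderiv f) r) \<and>
    (\<forall>\<rho>. std_part (poly g (Dual r \<rho>)) = poly f r)"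
    using assms
  proof (induction g arbitrary: f)
    case 0
    then have "f = 0" by (intro poly_eqI) (simp add: dual_number_defs)
    then show ?case by (simp add: dual_number_defs)
  next
    case (pCons b g)
    obtain a f' where f: "f = pCons a f'" by (cases f)
    have a: "std_part b = a" using pCons.prems[of 0] by (simp add: f)
    have "std_part (coeff g n) = coeff f' n" for n using pCons.prems[of "Suc n"] by (simp add: f)
    note IH = pCons.IH[OF this]
    have s: "std_part (poly g (Dual r \<rho>)) = poly f' r" for \<rho> using IH by blast
    have "poly (pCons b g) (Dual r \<rho>) = b + Dual r \<rho> * (poly g (Dual r 0) + Dual 0 (\<rho> * poly (pderiv f') r))"
      using IH by (metis poly_pCons)
    also have "\<dots> = poly (pCons b g) (Dual r 0) + Dual 0 (\<rho> * poly (pderiv f) r)"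
      using s[of 0] by (simp add: f pderiv_pCons dual_number_defs algebra_simps)
    finally show ?case using s a by (simp add: f dual_number_defs)
  qed
  then show "poly g (Dual r \<rho>) = poly g (Dual r 0) + Dual 0 (\<rho> * poly (pderiv f) r)"
    "std_part (poly g (Dual r \<rho>)) = poly f r" by blast+
qed

lemma hom_polys_dual_lifts:
  assumes "T \<subseteq> dual_lifts" "(f, g) \<in> hom_polys T"
  shows "std_part (coeff g n) = coeff f n"
  using hom_polysD[OF assms(2), of n] assms(1) by (auto simp: dual_lifts_def)

text \<open>The standard part decides which dual numbers are units, so the derivative \<rho> of a
  transcendental can be prescribed at will. The bound on the domain of \<open>T'\<close> keeps the
  next independent length transcendental over it.\<close>

lemma adjoin_dual_transcendental:
  fixes T :: "('a::field_char_0 \<times> 'a dual_number) set"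
  assumes T: "partial_hom T" "T \<subseteq> dual_lifts" and r: "transcendental_over (fst ` T) r"
  obtains T' where "partial_hom T'" "T' \<subseteq> dual_lifts" "T \<subseteq> T'" "(r, Dual r \<rho>) \<in> T'"
    "\<And>F. is_subfield F \<Longrightarrow> fst ` T \<subseteq> F \<Longrightarrow> r \<in> F \<Longrightarrow> fst ` T' \<subseteq> F"
proof -
  have unit: "poly g (Dual r \<rho>) dvd 1" if "(f, g) \<in> hom_polys T" "poly f r \<noteq> 0" for f g
    using poly_dual_number(2)[OF hom_polys_dual_lifts[OF T(2) that(1)], of r \<rho>] that(2)
    by (intro dual_number_dvd_1) simp
  have compat: "hom_compatible T r (Dual r \<rho>)"
    by (rule hom_compatible_transcendental[OF T(1) r unit])
  obtain T' where T': "partial_hom T'" "T \<subseteq> T'" "(r, Dual r \<rho>) \<in> T'"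
    and least: "\<And>W. hom_closed W \<and> T \<subseteq> W \<and> (r, Dual r \<rho>) \<in> W \<Longrightarrow> T' \<subseteq> W"
    using adjoin_pair[OF T(1) compat] by blast
  have "T' \<subseteq> dual_lifts"
    by (rule least) (use hom_closed_dual_lifts T(2) in \<open>auto simp: dual_lifts_def\<close>)
  moreover have "fst ` T' \<subseteq> F" if F: "is_subfield F" "fst ` T \<subseteq> F" "r \<in> F" for F
  proof -
    have "T' \<subseteq> F \<times> UNIV"
      by (rule least) (use F in \<open>auto simp: hom_closed_def intro: is_subfieldD[OF F(1)]\<close>)
    then show ?thesis by auto
  qed
  ultimately show thesis using that T' by blast
qed

lemma adjoin_dual:
  fixes T :: "('a::field_char_0 \<times> 'a dual_number) set"
  assumes T: "partial_hom T" "T \<subseteq> dual_lifts"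
  obtains T' \<rho> where "partial_hom T'" "T' \<subseteq> dual_lifts" "T \<subseteq> T'" "(r, Dual r \<rho>) \<in> T'"
proof (cases "transcendental_over (fst ` T) r")
  case True
  show thesis by (rule adjoin_dual_transcendental[OF T True, of 0]) (rule that)
next
  case False
  then obtain f where f: "\<And>n. coeff f n \<in> fst ` T" "poly f r = 0" "f \<noteq> 0"
    by (auto simp: transcendental_over_def)
  obtain g where "(f, g) \<in> hom_polys T" using ex_hom_polys[OF T(1) f(1)] by blast
  then obtain m1 m2 where m: "minimal_hom_poly T r m1 m2"
    using ex_minimal_hom_poly[OF T(1)] f by blast
  then have m': "(m1, m2) \<in> hom_polys T" "m1 \<noteq> 0" "poly m1 r = 0"
    and least: "\<And>g1 g2. (g1, g2) \<in> hom_polys T \<Longrightarrow> poly g1 r = 0 \<Longrightarrow> g1 \<noteq> 0 \<Longrightarrow> degree m1 \<le> degree g1"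
    by (auto simp: minimal_hom_poly_def[OF T(1)])
  have deg: "degree m1 > 0" using m'(2,3) by (metis degree_eq_zeroE gr0I mult_zero_right pCons_0_0 poly_const_conv)
  obtain k where k: "(pderiv m1, k) \<in> hom_polys T" using ex_hom_polys_pderiv[OF T(1) m'(1)] by blast
  \<comment> \<open>Separability: in characteristic zero the derivative of \<open>m1\<close> is
    nonzero of smaller degree, so by minimality it cannot vanish at \<open>r\<close>.\<close>
  have nz: "poly (pderiv m1) r \<noteq> 0"
    using least[OF k] deg by (auto simp: degree_pderiv pderiv_eq_0_iff)
  note m2 = poly_dual_number[OF hom_polys_dual_lifts[OF T(2) m'(1)], of r]
  \<comment> \<open>Differentiating the relation m1(r) = 0 forces this value: it cancels the
    infinitesimal part of \<open>m2\<close> at \<open>Dual r \<rho>\<close>.\<close>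
  define \<rho> where "\<rho> = - eps_part (poly m2 (Dual r 0)) / poly (pderiv m1) r"
  have "poly m2 (Dual r \<rho>) = 0"
    using m2(1)[of \<rho>] m2(2)[of 0] m'(3) nz by (simp add: \<rho>_def dual_number_defs)
  note root = minimal_hom_poly_root[OF T(1) m this]
  obtain T' where T': "partial_hom T'" "T \<subseteq> T'" "(r, Dual r \<rho>) \<in> T'"
    and least: "\<And>W. hom_closed W \<and> T \<subseteq> W \<and> (r, Dual r \<rho>) \<in> W \<Longrightarrow> T' \<subseteq> W"
    using adjoin_pair[OF T(1) root] by blast
  have "T' \<subseteq> dual_lifts"
    by (rule least) (use hom_closed_dual_lifts T(2) in \<open>auto simp: dual_lifts_def\<close>)
  then show thesis using that T' by blast
qed

lemma adjoin_dual_finite: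
  fixes T :: "('a::field_char_0 \<times> 'a dual_number) set"
  assumes "partial_hom T" "T \<subseteq> dual_lifts" "finite A"
  shows "\<exists>T'. partial_hom T' \<and> T' \<subseteq> dual_lifts \<and> T \<subseteq> T' \<and> (\<forall>r\<in>A. \<exists>\<rho>. (r, Dual r \<rho>) \<in> T')"
  using assms(3)
proof (induction A rule: finite_induct)
  case empty
  then show ?case using assms by blast
next
  case (insert r A)
  then obtain T1 where T1: "partial_hom T1" "T1 \<subseteq> dual_lifts" "T \<subseteq> T1" "\<forall>r\<in>A. \<exists>\<rho>. (r, Dual r \<rho>) \<in> T1" by blast
  obtain T' \<rho> where "partial_hom T'" "T' \<subseteq> dual_lifts" "T1 \<subseteq> T'" "(r, Dual r \<rho>) \<in> T'"
    by (rule adjoin_dual[OF T1(1,2), of r])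
  then show ?case using T1 by (intro exI[of _ T']) blast
qed

text \<open>Starting from the zero derivation on the rationals, the derivatives of the lengths are
  prescribed one at a time. Bounding the domain by the generated field is what lets the induction
  continue.\<close>

lemma ex_dual_hom_algebraically_independent:
  assumes "finite J" "algebraically_independent d J"
  shows "\<exists>T. partial_hom T \<and> T \<subseteq> dual_lifts \<and> fst ` T \<subseteq> generated_subfield (d ` J)
    \<and> (\<forall>j\<in>J. (d j, Dual (d j) (c j)) \<in> T)"
  using assms
proof (induction J rule: finite_induct)
  case empty
  let ?T = "(\<lambda>a :: complex. (a, Dual a 0)) ` \<rat>"
  have "partial_hom ?T"
    by (rule partial_hom_graph[OF is_subfield_Rats]) (auto simp: dual_number_defs)
  moreover have "fst ` ?T \<subseteq> generated_subfield {}"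
    using is_subfield_of_rat[OF is_subfield_generated] by (auto elim!: Rats_cases)
  ultimately show ?case by (intro exI[of _ ?T]) (auto simp: dual_lifts_def)
next
  case (insert j J)
  then have "algebraically_independent d J" by (auto intro: algebraically_independent_subset)
  then obtain T where T: "partial_hom T" "T \<subseteq> dual_lifts" "fst ` T \<subseteq> generated_subfield (d ` J)"
    "\<forall>j\<in>J. (d j, Dual (d j) (c j)) \<in> T"
    using insert.IH by blast
  have "transcendental_over (fst ` T) (d j)"
    using algebraically_independent_transcendental[OF insert.prems insert.hyps(2)] T(3)
    by (rule transcendental_over_mono)
  from adjoin_dual_transcendental[OF T(1,2) this, of "c j"]
  obtain T' where T': "partial_hom T'" "T' \<subseteq> dual_lifts" "T \<subseteq> T'" "(d j, Dual (d j) (c j)) \<in> T'"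
    "\<And>F. is_subfield F \<Longrightarrow> fst ` T \<subseteq> F \<Longrightarrow> d j \<in> F \<Longrightarrow> fst ` T' \<subseteq> F" by blast
  have "fst ` T' \<subseteq> generated_subfield (d ` insert j J)"
  proof (rule T'(5))
    show "is_subfield (generated_subfield (d ` insert j J))" by (rule is_subfield_generated)
    show "fst ` T \<subseteq> generated_subfield (d ` insert j J)"
      using T(3) generated_subfield_mono[of "d ` J" "d ` insert j J"] by blast
    show "d j \<in> generated_subfield (d ` insert j J)" using generated_subfield_superset[of "d ` insert j J"] by simp
  qed
  then show ?case using T' T(4) by (intro exI[of _ T']) auto
qed

lemma ex_dual_hom:
  assumes "finite J" "algebraically_independent d J" "finite A"
  obtains T \<delta> where "partial_hom T" "\<And>j. j \<in> J \<Longrightarrow> (d j, Dual (d j) (c j)) \<in> T"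
    "\<And>a. a \<in> A \<Longrightarrow> (a, Dual a (\<delta> a)) \<in> T"
proof -
  obtain T where T: "partial_hom T" "T \<subseteq> dual_lifts" "\<forall>j\<in>J. (d j, Dual (d j) (c j)) \<in> T"
    using ex_dual_hom_algebraically_independent[OF assms(1,2)] by blast
  obtain T' where T': "partial_hom T'" "T \<subseteq> T'" "\<forall>r\<in>A. \<exists>\<rho>. (r, Dual r \<rho>) \<in> T'"
    using adjoin_dual_finite[OF T(1,2) assms(3)] by blast
  then obtain \<delta> where "\<forall>r\<in>A. (r, Dual r (\<delta> r)) \<in> T'" by metis
  then show thesis using that T' T(3) by blast
qed

section \<open>Radical extensions and Laurent series\<close>

unbundle fps_syntax

section \<open>Radical towers and the closure under radicals\<close>

definition root_closed :: "complex set \<Rightarrow> bool" where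
  "root_closed R \<longleftrightarrow> is_subfield R \<and> (\<forall>a n. n > 0 \<and> a ^ n \<in> R \<longrightarrow> a \<in> R)"

lemma root_closed_is_subfield: "root_closed R \<Longrightarrow> is_subfield R"
  by (simp add: root_closed_def)

lemma is_subfield_radical_extension:
  assumes "radical_extension K L" "is_subfield K"
  shows "is_subfield L"
  using assms(1) by cases (use assms(2) is_subfield_generated in auto)

lemma radical_extension_superset:
  assumes "radical_extension K L"
  shows "K \<subseteq> L"
  using assms
proof induction
  case (adjoin_root L n r)
  then show ?case using generated_subfield_superset[of "insert r L"] by auto
qed simp

text \<open>The tower leading to \<open>M\<close> is replayed on top of \<open>L\<close>. This is
  what makes the union of all radical extensions a field.\<close>

lemma radical_extension_compositum:
  assumes "radical_extension K L" "radical_extension K M" "is_subfield K"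
  shows "\<exists>N. radical_extension K N \<and> L \<subseteq> N \<and> M \<subseteq> N"
  using assms(2)
proof induction
  case base
  then show ?case using assms(1) radical_extension_superset by blast
next
  case (adjoin_root M n r)
  then obtain N where N: "radical_extension K N" "L \<subseteq> N" "M \<subseteq> N" by blast
  let ?N = "generated_subfield (insert r N)"
  have "radical_extension K ?N"
    using N adjoin_root.hyps by (intro radical_extension.adjoin_root[of K N n r]) auto
  moreover have "insert r N \<subseteq> ?N" by (rule generated_subfield_superset)
  moreover have "generated_subfield (insert r M) \<subseteq> ?N"
    using N(3) by (intro generated_subfield_mono) auto
  ultimately show ?case using N(2) by (intro exI[of _ ?N]) blast
qed

definition radical_closure :: "complex set \<Rightarrow> complex set" where
  "radical_closure K = {a. \<exists>L. radical_extension K L \<and> a \<in> L}"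

lemma radical_closureI: "radical_extension K L \<Longrightarrow> a \<in> L \<Longrightarrow> a \<in> radical_closure K"
  by (auto simp: radical_closure_def)

lemma root_closed_radical_closure:
  assumes K: "is_subfield K"
  shows "root_closed (radical_closure K)"
  unfolding root_closed_def is_subfield_def
proof (intro conjI ballI allI impI)
  show "0 \<in> radical_closure K" "1 \<in> radical_closure K"
    using radical_closureI[OF radical_extension.base] is_subfieldD(1,2)[OF K] by auto
  fix a assume "a \<in> radical_closure K"
  then obtain L where L: "radical_extension K L" "a \<in> L" by (auto simp: radical_closure_def)
  show "inverse a \<in> radical_closure K"
    using radical_closureI[OF L(1)] is_subfieldD(6)[OF is_subfield_radical_extension[OF L(1) K] L(2)] .
  fix b assume "b \<in> radical_closure K"
  then obtain M where M: "radical_extension K M" "b \<in> M" by (auto simp: radical_closure_def)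
  obtain N where N: "radical_extension K N" "L \<subseteq> N" "M \<subseteq> N"
    using radical_extension_compositum[OF L(1) M(1) K] by blast
  note sf = is_subfield_radical_extension[OF N(1) K]
  have "a \<in> N" "b \<in> N" using L M N by auto
  then show "a + b \<in> radical_closure K" "a - b \<in> radical_closure K" "a * b \<in> radical_closure K"
    by (auto intro!: radical_closureI[OF N(1)] is_subfieldD(3-5)[OF sf])
next
  fix a and n :: nat assume an: "n > 0 \<and> a ^ n \<in> radical_closure K"
  then obtain L where L: "radical_extension K L" "a ^ n \<in> L" by (auto simp: radical_closure_def)
  have "radical_extension K (generated_subfield (insert a L))"
    using an L by (intro radical_extension.adjoin_root) auto
  then show "a \<in> radical_closure K"
    by (rule radical_closureI) (use generated_subfield_superset[of "insert a L"] in simp)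
qed

section \<open>Series with coefficients in a subfield\<close>

definition fls_over :: "'a::field set \<Rightarrow> 'a fls set" where
  "fls_over R = {f. \<forall>n. f $$ n \<in> R}"

definition fps_over :: "'a::field set \<Rightarrow> 'a fps set" where
  "fps_over R = {f. \<forall>n. f $ n \<in> R}"

context
  fixes R :: "'a::field set"
  assumes R: "is_subfield R"
begin


lemma fps_over_mult: "f \<in> fps_over R \<Longrightarrow> g \<in> fps_over R \<Longrightarrow> f * g \<in> fps_over R"
  by (auto simp: fps_over_def fps_mult_nth intro!: is_subfield_sum[OF R] is_subfieldD(5)[OF R])

lemma fps_over_1: "1 \<in> fps_over R"
  by (auto simp: fps_over_def intro: is_subfieldD[OF R])

lemma fps_over_power: "f \<in> fps_over R \<Longrightarrow> f ^ n \<in> fps_over R"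
  by (induction n) (auto intro: fps_over_mult fps_over_1)

lemma fps_over_inverse:
  assumes "f \<in> fps_over R" "f $ 0 \<noteq> 0"
  shows "inverse f \<in> fps_over R"
proof -
  let ?g = "inverse f"
  have "?g $ n \<in> R" for n
  proof (induction n rule: less_induct)
    case (less n)
    show ?case
    proof (cases "n = 0")
      case True
      then show ?thesis using assms by (auto simp: fps_over_def intro: is_subfieldD[OF R])
    next
      case False
      have "0 = (f * ?g) $ n" using False assms(2) by (simp add: inverse_mult_eq_1')
      also have "\<dots> = f $ 0 * ?g $ n + (\<Sum>i=1..n. f $ i * ?g $ (n - i))"
        by (simp add: fps_mult_nth sum.atLeast_Suc_atMost)
      finally have "?g $ n = - (\<Sum>i=1..n. f $ i * ?g $ (n - i)) / f $ 0"
        using assms(2) by (simp add: field_simps add_eq_0_iff)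
      moreover have "(\<Sum>i=1..n. f $ i * ?g $ (n - i)) \<in> R"
        by (intro is_subfield_sum[OF R] is_subfieldD(5)[OF R]) (use assms less False in \<open>auto simp: fps_over_def\<close>)
      ultimately show ?thesis
        using assms(1) by (auto simp: fps_over_def intro: is_subfieldD[OF R])
    qed
  qed
  then show ?thesis by (simp add: fps_over_def)
qed

lemma fls_over_shift_fps:
  "f \<in> fps_over R \<Longrightarrow> fls_shift k (fps_to_fls f) \<in> fls_over R"
  by (auto simp: fls_over_def fps_over_def intro: is_subfieldD[OF R])

lemma fls_over_decompose:
  assumes "f \<in> fls_over R" "f \<noteq> 0"
  obtains u k where "f = fls_shift k (fps_to_fls u)" "u \<in> fps_over R" "u $ 0 \<noteq> 0"
proof
  show "f = fls_shift (- fls_subdegree f) (fps_to_fls (fls_base_factor_to_fps f))"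
    by (rule fls_conv_base_factor_to_fps_shift_subdegree)
  show "fls_base_factor_to_fps f \<in> fps_over R"
    using assms(1) by (auto simp: fps_over_def fls_over_def fls_base_factor_to_fps_nth)
  show "fls_base_factor_to_fps f $ 0 \<noteq> 0" using assms(2) by (rule fls_base_factor_to_fps_base)
qed

lemma is_subfield_fls_over: "is_subfield (fls_over R)"
proof -
  have "inverse f \<in> fls_over R" if f: "f \<in> fls_over R" for f
  proof (cases "f = 0")
    case False
    obtain u k where u: "f = fls_shift k (fps_to_fls u)" "u \<in> fps_over R" "u $ 0 \<noteq> 0"
      by (rule fls_over_decompose[OF f False])
    have "f * fls_shift (- k) (fps_to_fls (inverse u)) = fps_to_fls (u * inverse u)"
      by (simp add: u(1) fls_times_both_shifted_simp fls_times_fps_to_fls)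
    also have "u * inverse u = 1" using u(3) by (rule inverse_mult_eq_1')
    finally have "inverse f = fls_shift (- k) (fps_to_fls (inverse u))" by (simp add: inverse_unique)
    then show ?thesis using fls_over_shift_fps fps_over_inverse[OF u(2,3)] by simp
  qed (use f in simp)
  moreover have "f * g \<in> fls_over R" if "f \<in> fls_over R" "g \<in> fls_over R" for f g
    using that
    by (auto simp: fls_over_def fls_times_nth(4) intro!: is_subfield_sum[OF R] is_subfieldD(5)[OF R])
  ultimately show ?thesis
    unfolding is_subfield_def by (auto simp: fls_over_def one_fls_def intro: is_subfieldD[OF R])
qed

end

section \<open>Roots of power and Laurent series\<close>

text \<open>The order m coefficient of an n-th power depends on the order m coefficient of the base
  in an affine way, with slope n times the (n-1)-th power of the constant term. For m > 0 the higher
  terms of the expansion do not reach order m.\<close>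

lemma fps_power_add_X_power:
  fixes h k :: "'a::comm_ring_1 fps"
  assumes "m > 0"
  shows "\<exists>w. (h + fps_X ^ m * k) ^ n = h ^ n + fps_X ^ m * w \<and> w $ 0 = of_nat n * (h $ 0) ^ (n - 1) * k $ 0"
proof (induction n)
  case 0
  then show ?case by (intro exI[of _ 0]) simp
next
  case (Suc n)
  then obtain w where w: "(h + fps_X ^ m * k) ^ n = h ^ n + fps_X ^ m * w"
    "w $ 0 = of_nat n * (h $ 0) ^ (n - 1) * k $ 0" by blast
  let ?w = "w * h + h ^ n * k + fps_X ^ m * (w * k)"
  have "(h + fps_X ^ m * k) ^ Suc n = (h + fps_X ^ m * k) * (h ^ n + fps_X ^ m * w)"
    by (simp only: power_Suc w(1))
  also have "\<dots> = h ^ Suc n + fps_X ^ m * ?w" by (simp add: algebra_simps)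
  finally have "(h + fps_X ^ m * k) ^ Suc n = h ^ Suc n + fps_X ^ m * ?w" .
  moreover have "?w $ 0 = of_nat (Suc n) * (h $ 0) ^ (Suc n - 1) * k $ 0"
    using assms w(2) by (cases n) (simp_all add: algebra_simps fps_power_zeroth zero_power)
  ultimately show ?case by blast
qed

text \<open>A root exists over the complex numbers. Its constant term \<open>c\<close> lies in
  \<open>R\<close> because \<open>R\<close> is closed under roots, and every later coefficient is
  rational in the earlier ones and those of \<open>u\<close>.\<close>

lemma fps_over_root:
  fixes u :: "complex fps"
  assumes R: "root_closed R" and u: "u \<in> fps_over R" "u $ 0 \<noteq> 0" and n: "n > 0"
  obtains v where "v \<in> fps_over R" "v ^ n = u"
proof -
  note sf = root_closed_is_subfield[OF R]
  obtain c where c: "c ^ n = u $ 0" using nth_root_exists[OF n] by blast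
  define v where "v = fps_radical (\<lambda>_ _. c) n u"
  obtain k where k: "n = Suc k" using n by (cases n) auto
  have v: "v ^ n = u"
    using power_radical[OF u(2), of "\<lambda>_ _. c" k] c by (simp add: v_def k)
  have v0: "v $ 0 = c" using n by (simp add: v_def)
  have c0: "c \<noteq> 0" using c u(2) n by (metis power_0_left not_gr0)
  have "c ^ n \<in> R" using u(1) c by (simp add: fps_over_def)
  then have cR: "c \<in> R" using R n unfolding root_closed_def by blast
  have "v $ m \<in> R" for m
  proof (induction m rule: less_induct)
    case (less m)
    show ?case
    proof (cases "m = 0")
      case True
      then show ?thesis using cR v0 by simp
    next
      case False
      define h where "h = fps_cutoff m v"
      have h: "h \<in> fps_over R" using less by (auto simp: h_def fps_over_def intro: is_subfieldD[OF sf])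
      have vh: "v = h + fps_X ^ m * fps_shift m v"
        unfolding h_def by (metis add.commute fps_shift_cutoff')
      obtain w where w: "v ^ n = h ^ n + fps_X ^ m * w" "w $ 0 = of_nat n * (h $ 0) ^ (n - 1) * fps_shift m v $ 0"
        using fps_power_add_X_power[of m h "fps_shift m v" n] False vh by auto
      have "h $ 0 = c" using False v0 by (simp add: h_def)
      then have "u $ m = (h ^ n) $ m + of_nat n * c ^ (n - 1) * v $ m"
        using w v by (simp add: fps_X_power_mult_nth)
      then have "v $ m = (u $ m - (h ^ n) $ m) / (of_nat n * c ^ (n - 1))"
        using n c0 by (simp add: field_simps)
      then show ?thesis
        using cR u(1) fps_over_power[OF sf h, of n]
        by (auto simp: fps_over_def
            intro!: is_subfieldD(4,5,7)[OF sf] is_subfield_of_nat[OF sf] is_subfield_power[OF sf])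
    qed
  qed
  then show thesis using that v by (auto simp: fps_over_def)
qed

text \<open>Substituting X^n for X makes the order of vanishing divisible by n, so the power of X
  splits off and only the unit factor needs a root.\<close>

lemma fls_over_root:
  assumes R: "root_closed R" and f: "f \<in> fls_over R" "f \<noteq> 0" and n: "n > 0"
  obtains g where "g \<in> fls_over R" "g ^ n = fls_compose_power f n"
proof -
  note sf = root_closed_is_subfield[OF R]
  obtain u k where u: "f = fls_shift k (fps_to_fls u)" "u \<in> fps_over R" "u $ 0 \<noteq> 0"
    by (rule fls_over_decompose[OF sf f])
  define w where "w = fps_compose u (fps_X ^ n)"
  have w: "fls_compose_power (fps_to_fls u) n = fps_to_fls w"
    unfolding w_def by (rule fls_compose_power_fps_to_fls[OF n])
  have wj: "w $ j = fls_compose_power (fps_to_fls u) n $$ int j" for j by (simp add: w)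
  have "w \<in> fps_over R"
    using u(2) is_subfieldD(1)[OF sf] by (auto simp: fps_over_def wj fls_nth_compose_power[OF n])
  moreover have "w $ 0 \<noteq> 0" using u(3) by (simp add: wj fls_nth_compose_power[OF n])
  ultimately obtain v where v: "v \<in> fps_over R" "v ^ n = w" using fps_over_root[OF R _ _ n] by metis
  let ?g = "fls_shift k (fps_to_fls v)"
  have "?g ^ n = fls_compose_power f n"
    using n by (simp add: u(1) w fls_shifted_pow v(2) flip: fps_to_fls_power)
  then show thesis using that fls_over_shift_fps[OF sf v(1)] by blast
qed

text \<open>The factorisation of the complex polynomial t^n - 1 is transported along the constant
  series and then evaluated at a series.\<close>

lemma ex_roots_of_unity:
  assumes "n > 0"
  shows "\<exists>zs :: complex list. (\<forall>z\<in>set zs. z ^ n = 1) \<and> length zs = n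
    \<and> (\<forall>t :: complex fls. t ^ n - 1 = (\<Prod>z\<leftarrow>zs. t - fls_const z))"
proof -
  let ?p = "monom 1 n - 1 :: complex poly"
  have deg: "degree ?p = n" "lead_coeff ?p = 1"
  proof -
    show "degree ?p = n" using assms degree_add_eq_left[of "- 1" "monom (1::complex) n"] by (simp add: degree_monom_eq)
    then show "lead_coeff ?p = 1" using assms by simp
  qed
  obtain root where "smult (lead_coeff ?p) (\<Prod>i<degree ?p. [:- root i, 1:]) = ?p"
    by (rule complex_poly_decompose')
  then have root: "?p = (\<Prod>i<n. [:- root i, 1:])"
    unfolding deg(2) unfolding deg(1) smult_1_left by (rule sym)
  let ?zs = "map root [0..<n]"
  have pl: "?p = (\<Prod>z\<leftarrow>?zs. [:- z, 1:])"
    by (simp add: root prod.list_conv_set_nth atLeast0LessThan)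
  show ?thesis
  proof (intro exI[of _ ?zs] conjI ballI allI)
    fix z assume "z \<in> set ?zs"
    then have "poly ?p z = 0" by (subst root) (auto simp: poly_prod)
    then show "z ^ n = 1" by (simp add: poly_monom)
  next
    fix t :: "complex fls"
    have const: "poly (map_poly fls_const (\<Prod>z\<leftarrow>zs. [:- z, 1:])) t = (\<Prod>z\<leftarrow>zs. t - fls_const z)" for zs
    proof (induction zs)
      case (Cons z zs)
      have fls_const_sum: "fls_const (sum f A) = (\<Sum>a\<in>A. fls_const (f a))" for f :: "nat \<Rightarrow> complex" and A
        by (induction A rule: infinite_finite_induct) (simp_all flip: fls_plus_const)
      have mult: "map_poly fls_const (p * q) = map_poly fls_const p * map_poly fls_const q" for p q :: "complex poly"
        by (rule poly_eqI) (simp add: coeff_map_poly coeff_mult fls_const_sum)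
      show ?case
        by (simp only: list.simps(9) prod_list.Cons mult poly_mult Cons.IH) (simp add: map_poly_pCons)
    qed simp
    have "t ^ n - 1 = poly (map_poly fls_const ?p) t"
    proof -
      have "map_poly fls_const ?p = monom 1 n - 1"
        by (rule poly_eqI) (simp add: coeff_map_poly)
      then show ?thesis by (simp add: poly_monom)
    qed
    then show "t ^ n - 1 = (\<Prod>z\<leftarrow>?zs. t - fls_const z)" by (simp only: pl const)
  qed simp
qed

text \<open>All the roots are needed, not just one: the map already fixed on the lower field decides
  which factor of this polynomial is the image of the minimal polynomial, and that factor must have
  a root over \<open>R\<close>. The roots differ by roots of unity, which \<open>R\<close> contains.
  The zero series is separate, as it has no unit factor.\<close>

lemma fls_over_splits:
  assumes R: "root_closed R" and f: "f \<in> fls_over R" and n: "n > 0"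
  obtains rs where "set rs \<subseteq> fls_over R"
    "monom 1 n - [:fls_compose_power f n:] = (\<Prod>r\<leftarrow>rs. [:- r, 1:])"
proof (cases "f = 0")
  case True
  have "monom 1 n - [:fls_compose_power f n:] = (\<Prod>r\<leftarrow>replicate n 0. [:- r, 1:])"
    using True by (simp add: monom_altdef)
  moreover have "set (replicate n 0) \<subseteq> fls_over R"
    using f True by auto
  ultimately show thesis using that by blast
next
  case False
  note sf = root_closed_is_subfield[OF R]
  note sf' = is_subfield_fls_over[OF sf]
  obtain g where g: "g \<in> fls_over R" "g ^ n = fls_compose_power f n"
    by (rule fls_over_root[OF R f False n])
  have g0: "g \<noteq> 0"
  proof
    assume "g = 0"
    then have "fls_compose_power f n = 0" using g(2) n by (simp add: power_0_left)
    then have "f $$ k = 0" for k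
      using fls_nth_compose_power[OF n, of f "int n * k"] n by simp
    then show False using False by (simp add: fls_eq_iff)
  qed
  obtain zs :: "complex list" where zs: "\<forall>z\<in>set zs. z ^ n = 1" "length zs = n"
    "\<forall>t :: complex fls. t ^ n - 1 = (\<Prod>z\<leftarrow>zs. t - fls_const z)"
    using ex_roots_of_unity[OF n] by blast
  define rs where "rs = map (\<lambda>z. g * fls_const z) zs"
  have "set rs \<subseteq> fls_over R"
  proof
    fix r assume "r \<in> set rs"
    then obtain z where z: "z \<in> set zs" "r = g * fls_const z" by (auto simp: rs_def)
    have "z ^ n \<in> R" using zs(1) z(1) is_subfieldD(2)[OF sf] by simp
    then have "z \<in> R" using R n unfolding root_closed_def by blast
    then have "fls_const z \<in> fls_over R" using is_subfieldD(1)[OF sf] by (simp add: fls_over_def)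
    then show "r \<in> fls_over R" using z(2) g(1) is_subfieldD(5)[OF sf'] by simp
  qed
  moreover have "monom 1 n - [:fls_compose_power f n:] = (\<Prod>r\<leftarrow>rs. [:- r, 1:])"
  proof (rule poly_eq_poly_eq_iff[THEN iffD1], rule ext)
    fix t
    have "poly (monom 1 n - [:fls_compose_power f n:]) t = g ^ n * ((t / g) ^ n - 1)"
      using g0 by (simp add: poly_monom power_divide right_diff_distrib flip: g(2))
    also have "\<dots> = g ^ length zs * (\<Prod>z\<leftarrow>zs. t / g - fls_const z)" using zs(2,3) by simp
    also have "\<dots> = (\<Prod>z\<leftarrow>zs. t - g * fls_const z)"
      using g0 by (induction zs) (simp_all add: field_simps)
    also have "\<dots> = poly (\<Prod>r\<leftarrow>rs. [:- r, 1:]) t"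
      unfolding rs_def by (induction zs) (simp_all add: left_diff_distrib)
    finally show "poly (monom 1 n - [:fls_compose_power f n:]) t = poly (\<Prod>r\<leftarrow>rs. [:- r, 1:]) t" .
  qed
  ultimately show thesis using that by blast
qed

text \<open>Linear factors that do not have a root in common with \<open>f\<close> are cancelled
  against \<open>g\<close>; they cannot use up the whole product, since \<open>f\<close> is not
  constant.\<close>

lemma prod_linear_factor_root:
  fixes rs :: "'a::field list"
  assumes "f * g = (\<Prod>r\<leftarrow>rs. [:- r, 1:])" "degree f > 0"
  shows "\<exists>r\<in>set rs. poly f r = 0"
  using assms(1)
proof (induction rs arbitrary: g)
  case Nil
  then have "f * g = 1" by simp
  then have "degree (f * g) = 0" "f \<noteq> 0" "g \<noteq> 0" by auto
  then show ?case using assms(2) by (simp add: degree_mult_eq)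
next
  case (Cons r rs)
  show ?case
  proof (cases "poly f r = 0")
    case False
    have "poly (f * g) r = 0" by (simp only: Cons.prems) simp
    then have "poly g r = 0" using False by simp
    then obtain g' where g': "g = [:- r, 1:] * g'" by (auto simp: poly_eq_0_iff_dvd elim: dvdE)
    have "[:- r, 1:] * (f * g') = [:- r, 1:] * (\<Prod>r\<leftarrow>rs. [:- r, 1:])"
      using Cons.prems by (simp only: g' list.simps(9) prod_list.Cons mult_ac)
    then have "f * g' = (\<Prod>r\<leftarrow>rs. [:- r, 1:])" by (subst (asm) mult_cancel_left) simp
    then show ?thesis using Cons.IH by auto
  qed simp
qed

section \<open>Lifting a radical tower to Laurent series\<close>

lemma partial_hom_map_snd:
  assumes T: "partial_hom T" and h: "h 0 = 0" "h 1 = 1" "\<And>a b. h (a + b) = h a + h b"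
    "\<And>a b. h (a - b) = h a - h b" "\<And>a b. h (a * b) = h a * h b"
  shows "partial_hom (map_prod id h ` T)"
proof (rule partial_homI)
  show "(0, 0) \<in> map_prod id h ` T" "(1, 1) \<in> map_prod id h ` T"
    using imageI[OF partial_homD(1)[OF T], of "map_prod id h"] imageI[OF partial_homD(2)[OF T], of "map_prod id h"]
    by (simp_all add: h)
next
  fix a b c d assume "(a, b) \<in> map_prod id h ` T" "(c, d) \<in> map_prod id h ` T"
  then obtain b' d' where "(a, b') \<in> T" "b = h b'" "(c, d') \<in> T" "d = h d'" by auto
  then show "(a + c, b + d) \<in> map_prod id h ` T" "(a - c, b - d) \<in> map_prod id h ` T"
    "(a * c, b * d) \<in> map_prod id h ` T"
    using imageI[OF partial_homD(3)[OF T, of a b' c d'], of "map_prod id h"]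
      imageI[OF partial_homD(4)[OF T, of a b' c d'], of "map_prod id h"]
      imageI[OF partial_homD(5)[OF T, of a b' c d'], of "map_prod id h"]
    by (simp_all add: h)
next
  fix a b assume "(a, b) \<in> map_prod id h ` T" "a \<noteq> 0"
  then obtain b' where b': "(a, b') \<in> T" "b = h b'" by auto
  obtain c where c: "b' * c = 1" "(inverse a, c) \<in> T" using partial_homD(6)[OF T b'(1) \<open>a \<noteq> 0\<close>] by blast
  have "b * h c = 1" using c(1) by (simp add: b'(2) h(2) flip: h(5))
  moreover have "(inverse a, h c) \<in> map_prod id h ` T" using imageI[OF c(2), of "map_prod id h"] by simp
  ultimately show "\<exists>b'. b * b' = 1 \<and> (inverse a, b') \<in> map_prod id h ` T"
    by (intro exI[of _ "h c"] conjI)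
next
  fix b assume "(0, b) \<in> map_prod id h ` T"
  then obtain b' where "(0, b') \<in> T" "b = h b'" by auto
  then show "b = 0" using partial_homD(7)[OF T, of b'] h(1) by simp
qed

lemma fls_compose_power_1: "fls_compose_power f 1 = f"
  by (rule fls_eqI) (simp add: fls_nth_compose_power)

lemma fls_compose_power_compose:
  assumes "m > 0" "n > 0"
  shows "fls_compose_power (fls_compose_power f m) n = fls_compose_power f (m * n)"
proof (rule fls_eqI)
  fix k
  show "fls_compose_power (fls_compose_power f m) n $$ k = fls_compose_power f (m * n) $$ k"
  proof (cases "int n dvd k")
    case True
    then obtain j where "k = int n * j" by (elim dvdE)
    then show ?thesis using assms by (simp add: fls_nth_compose_power mult.commute)
  next
    case False
    then have "\<not> int (m * n) dvd k" by (metis dvd_mult_right of_nat_mult)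
    then show ?thesis using assms False by (simp add: fls_nth_compose_power)
  qed
qed

text \<open>Each adjunction of an n-th root costs one substitution of X^n for X, and
  \<open>N\<close> is the product of these orders. So \<open>T'\<close> does not extend
  \<open>T\<close> itself but \<open>T\<close> followed by the substitution of X^N.\<close>

lemma radical_extension_lift:
  fixes T :: "(complex \<times> complex fls) set"
  assumes "radical_extension K L" and R: "root_closed R" and T: "partial_hom T"
    and K: "\<And>a. a \<in> K \<Longrightarrow> \<exists>b\<in>fls_over R. (a, b) \<in> T"
  shows "\<exists>N T'. N > 0 \<and> partial_hom T' \<and> (\<forall>a b. (a, b) \<in> T \<longrightarrow> (a, fls_compose_power b N) \<in> T')
    \<and> (\<forall>a\<in>L. \<exists>b\<in>fls_over R. (a, b) \<in> T')"
  using assms(1)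
proof induction
  case base
  then show ?case using T K by (intro exI[of _ 1] exI[of _ T]) (auto simp: fls_compose_power_1[simplified])
next
  case (adjoin_root L n r)
  then obtain N T1 where N: "N > 0" and T1: "partial_hom T1"
    "\<And>a b. (a, b) \<in> T \<Longrightarrow> (a, fls_compose_power b N) \<in> T1"
    "\<And>a. a \<in> L \<Longrightarrow> \<exists>b\<in>fls_over R. (a, b) \<in> T1" by blast
  note n = \<open>n > 0\<close>
  note sf = root_closed_is_subfield[OF R]
  define T2 where "T2 = map_prod id (\<lambda>b. fls_compose_power b n) ` T1"
  have T2: "partial_hom T2" unfolding T2_def by (rule partial_hom_map_snd[OF T1(1)]) (simp_all add: n)
  have T12: "(a, fls_compose_power b n) \<in> T2" if "(a, b) \<in> T1" for a b
    using imageI[OF that, of "map_prod id (\<lambda>b. fls_compose_power b n)"] by (simp add: T2_def)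
  obtain f where f: "f \<in> fls_over R" "(r ^ n, f) \<in> T1" using T1(3) \<open>r ^ n \<in> L\<close> by blast
  obtain rs where rs: "set rs \<subseteq> fls_over R"
    "monom 1 n - [:fls_compose_power f n:] = (\<Prod>r\<leftarrow>rs. [:- r, 1:])"
    by (rule fls_over_splits[OF R f(1) n])
  have p: "(monom 1 n - [:r ^ n:], monom 1 n - [:fls_compose_power f n:]) \<in> hom_polys T2"
    by (intro hom_polys_diff[OF T2] hom_polys_monom[OF T2] hom_polys_const[OF T2] partial_homD(2)[OF T2] T12 f)
  have root: "poly (monom 1 n - [:r ^ n:]) r = 0" by (simp add: poly_monom)
  have "coeff (monom 1 n - [:r ^ n:]) n = 1" using n by (simp add: coeff_pCons split: nat.split)
  then have "monom 1 n - [:r ^ n:] \<noteq> 0" by (metis coeff_0 zero_neq_one)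
  from ex_minimal_hom_poly[OF T2 p this root] obtain m1 m2 where m: "minimal_hom_poly T2 r m1 m2" by blast
  obtain q1 q2 where "monom 1 n - [:fls_compose_power f n:] = q2 * m2"
    using minimal_hom_poly_dvd[OF T2 m p root] by metis
  \<comment> \<open>The image of the minimal polynomial of \<open>r\<close> divides a polynomial
    that splits over \<open>fls_over R\<close>; hence \<open>r\<close> can be sent to a series over
    \<open>R\<close>.\<close>
  then have "m2 * q2 = (\<Prod>r\<leftarrow>rs. [:- r, 1:])" using rs(2) by (simp add: mult.commute)
  then obtain c where c: "c \<in> set rs" "poly m2 c = 0"
    using prod_linear_factor_root minimal_hom_poly_degree[OF T2 m] by blast
  obtain T' where T': "partial_hom T'" "T2 \<subseteq> T'" "(r, c) \<in> T'"
    using adjoin_pair[OF T2 minimal_hom_poly_root[OF T2 m c(2)]] by blast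
  let ?S = "{a. \<exists>b\<in>fls_over R. (a, b) \<in> T'}"
  have "is_subfield ?S"
    by (rule is_subfield_partial_hom_preimage[OF T'(1) is_subfield_fls_over[OF sf]])
  moreover have "insert r L \<subseteq> ?S"
  proof
    fix a assume "a \<in> insert r L"
    then show "a \<in> ?S"
    proof
      assume "a = r" then show ?thesis using T'(3) c(1) rs(1) by blast
    next
      assume "a \<in> L"
      then obtain b where b: "b \<in> fls_over R" "(a, b) \<in> T1" using T1(3) by blast
      have "fls_compose_power b n \<in> fls_over R"
        using b(1) is_subfieldD(1)[OF sf] by (auto simp: fls_over_def fls_nth_compose_power[OF n])
      then show ?thesis using T12[OF b(2)] T'(2) by blast
    qed
  qed
  ultimately have "generated_subfield (insert r L) \<subseteq> ?S" by (rule generated_subfield_least)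
  then have "\<forall>a\<in>generated_subfield (insert r L). \<exists>b\<in>fls_over R. (a, b) \<in> T'" by blast
  moreover have "\<forall>a b. (a, b) \<in> T \<longrightarrow> (a, fls_compose_power b (N * n)) \<in> T'"
    using T12[OF T1(2)] T'(2) fls_compose_power_compose[OF N n] by (metis subsetD)
  moreover have "N * n > 0" using N n by simp
  ultimately show ?case using T'(1) by blast
qed

section \<open>The contraction and a formal curve of realisations\<close>

lemma merge_image_notin: "y \<notin> e \<Longrightarrow> merge_vertex x y ` e = e"
  by (force simp: merge_vertex_def image_iff)

lemma finite_edges:
  assumes "finite_simple_graph G"
  shows "finite (edges G)"
proof -
  have "edges G \<subseteq> Pow (verts G)" using assms by (auto simp: finite_simple_graph_def)
  then show ?thesis using assms by (meson finite_Pow_iff finite_simple_graph_def finite_subset)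
qed

lemma edge_ends:
  assumes "finite_simple_graph G" "e \<in> edges G"
  obtains a b where "e = {a, b}" "a \<noteq> b" "a \<in> verts G" "b \<in> verts G"
proof -
  have "card e = 2" "e \<subseteq> verts G" using assms by (auto simp: finite_simple_graph_def)
  then show thesis using that by (metis card_2_iff insert_subset)
qed

text \<open>Contraction loses one vertex, hence two edges by the two freedom counts. One of them is
  xy, so exactly one coincidence occurs among the other edges; it comes from a triangle xyz, and yz
  is the copy that is discarded.\<close>

lemma contract_edge_common_neighbour:
  assumes G: "finite_simple_graph G" and xy: "{x, y} \<in> edges G"
    and free: "freedom G = 3" "freedom (contract_edge G x y) = 3"
  obtains z where "x \<noteq> y" "z \<noteq> x" "z \<noteq> y" "{x, z} \<in> edges G" "{y, z} \<in> edges G"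
    "inj_on ((`) (merge_vertex x y)) (edges G - {{x, y}, {y, z}})"
    "edges (contract_edge G x y) = (`) (merge_vertex x y) ` (edges G - {{x, y}, {y, z}})"
proof -
  let ?M = "(`) (merge_vertex x y)"
  let ?E = "edges G - {{x, y}}"
  have fin: "finite (edges G)" by (rule finite_edges[OF G])
  have xny: "x \<noteq> y" and xV: "x \<in> verts G" and yV: "y \<in> verts G"
    using G xy by (auto simp: finite_simple_graph_def)
  have verts: "verts (contract_edge G x y) = verts G - {y}"
    using xny xV by (auto simp: contract_edge_def merge_vertex_def image_iff)
  have cardV: "card (verts G - {y}) = card (verts G) - 1" "card (verts G) > 0"
    using G yV by (auto simp: finite_simple_graph_def card_gt_0_iff)
  have cardE: "card ?E = card (edges G) - 1" "card (edges G) > 0"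
    using fin xy by (auto simp: card_gt_0_iff)
  have edges: "edges (contract_edge G x y) = ?M ` ?E" by (simp add: contract_edge_def)
  have "2 * int (card (verts G)) - int (card (edges G)) = 3" using free(1) by (simp add: freedom_def)
  moreover have "2 * (int (card (verts G)) - 1) - int (card (?M ` ?E)) = 3"
    using free(2) cardV by (simp add: freedom_def verts edges of_nat_diff)
  ultimately have "int (card (?M ` ?E)) + 1 = int (card ?E)"
    using cardE by (simp add: of_nat_diff)
  then have card_less: "card (?M ` ?E) + 1 = card ?E" by linarith
  then have "\<not> inj_on ?M ?E" using card_image[of ?M ?E] by auto
  then obtain e1 e2 where e: "e1 \<in> ?E" "e2 \<in> ?E" "?M e1 = ?M e2" "e1 \<noteq> e2" by (auto simp: inj_on_def)
  have other_end: "\<exists>a. e = {y, a} \<and> a \<noteq> y \<and> a \<noteq> x \<and> ?M e = {x, a}" if yE: "y \<in> e" "e \<in> ?E" for e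
  proof -
    obtain a b where ab: "e = {a, b}" "a \<noteq> b" using edge_ends[OF G] yE(2) by blast
    define c where "c = (if a = y then b else a)"
    have "e = {y, c}" "c \<noteq> y" using ab yE(1) by (auto simp: c_def)
    moreover from this have "c \<noteq> x" using yE(2) by (auto simp: insert_commute)
    moreover from calculation have "?M e = {x, c}" by (auto simp: merge_vertex_def)
    ultimately show ?thesis by blast
  qed
  have "\<exists>z. z \<noteq> x \<and> z \<noteq> y \<and> {x, z} \<in> ?E \<and> {y, z} \<in> ?E"
  proof -
    \<comment> \<open>Merging is injective on edges at \<open>y\<close> and on edges away from
      \<open>y\<close>, so a coincidence pairs one of each kind.\<close>
    have step: "\<exists>z. z \<noteq> x \<and> z \<noteq> y \<and> {x, z} \<in> ?E \<and> {y, z} \<in> ?E"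
      if *: "f1 \<in> ?E" "f2 \<in> ?E" "?M f1 = ?M f2" "y \<in> f1" "y \<notin> f2" for f1 f2
    proof -
      obtain a where a: "f1 = {y, a}" "a \<noteq> y" "a \<noteq> x" "?M f1 = {x, a}"
        using other_end[OF *(4,1)] by blast
      then have "f2 = {x, a}" using *(3) merge_image_notin[OF *(5)] by simp
      then have "{x, a} \<in> ?E" using *(2) by simp
      moreover have "{y, a} \<in> ?E" using *(1) a(1) by simp
      ultimately show ?thesis using a(2,3) by (intro exI[of _ a] conjI)
    qed
    consider "y \<in> e1" "y \<in> e2" | "y \<in> e1" "y \<notin> e2" | "y \<notin> e1" "y \<in> e2" | "y \<notin> e1" "y \<notin> e2" by blast
    then show ?thesis
    proof cases
      case 1
      obtain a where a: "e1 = {y, a}" "a \<noteq> y" "a \<noteq> x" "?M e1 = {x, a}" using other_end[OF 1(1) e(1)] by blast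
      obtain b where b: "e2 = {y, b}" "b \<noteq> y" "b \<noteq> x" "?M e2 = {x, b}" using other_end[OF 1(2) e(2)] by blast
      have "{x, a} = {x, b}" using a(4) b(4) e(3) by simp
      then have "a = b" using a b by (auto simp: doubleton_eq_iff)
      then show ?thesis using a b e(4) by simp
    next
      case 2
      then show ?thesis by (rule step[OF e(1-3)])
    next
      case 3
      then show ?thesis by (intro step[OF e(2,1) e(3)[symmetric]])
    next
      case 4
      then show ?thesis using merge_image_notin[of y e1 x] merge_image_notin[of y e2 x] e(3,4) by simp
    qed
  qed
  then obtain z where z: "z \<noteq> x" "z \<noteq> y" "{x, z} \<in> ?E" "{y, z} \<in> ?E" by blast
  let ?F = "edges G - {{x, y}, {y, z}}"
  have "{x, z} \<noteq> {y, z}" using xny z by (auto simp: doubleton_eq_iff)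
  then have xzF: "{x, z} \<in> ?F" using z(3) by auto
  have "?M {y, z} = ?M {x, z}" using z by (auto simp: merge_vertex_def)
  moreover have EF: "?E = insert {y, z} ?F" using z(4) by auto
  ultimately have image: "?M ` ?E = ?M ` ?F" using xzF by (metis image_insert insert_absorb image_eqI)
  \<comment> \<open>With yz removed, image and domain have the same size, which excludes a second
    coincidence.\<close>
  have "card ?E = Suc (card ?F)" unfolding EF using fin by (subst card_insert_disjoint) auto
  then have "card (?M ` ?F) = card ?F" using card_less image by simp
  then have inj: "inj_on ?M ?F" using fin by (intro eq_card_imp_inj_on) auto
  show thesis
    by (rule that[OF xny z(1,2) _ _ inj]) (use z image edges in auto)
qed

section \<open>Nondegeneracy of the edge equations\<close>

lemma dual_hom_edge:
  assumes T: "partial_hom T" and "(x1, Dual x1 \<xi>1) \<in> T" "(x2, Dual x2 \<xi>2) \<in> T"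
    "(y1, Dual y1 \<eta>1) \<in> T" "(y2, Dual y2 \<eta>2) \<in> T" "(d, Dual d c) \<in> T"
    and d: "(x1 - x2)\<^sup>2 + (y1 - y2)\<^sup>2 - d = (0::complex)"
  shows "2 * (x1 - x2) * (\<xi>1 - \<xi>2) + 2 * (y1 - y2) * (\<eta>1 - \<eta>2) = c"
proof -
  have "((x1 - x2) * (x1 - x2) + (y1 - y2) * (y1 - y2),
    (Dual x1 \<xi>1 - Dual x2 \<xi>2) * (Dual x1 \<xi>1 - Dual x2 \<xi>2) + (Dual y1 \<eta>1 - Dual y2 \<eta>2) * (Dual y1 \<eta>1 - Dual y2 \<eta>2)) \<in> T"
    by (intro partial_homD(3-5)[OF T] assms)
  moreover have "(x1 - x2) * (x1 - x2) + (y1 - y2) * (y1 - y2) = d"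
    using d by (simp add: power2_eq_square)
  ultimately have "(Dual x1 \<xi>1 - Dual x2 \<xi>2) * (Dual x1 \<xi>1 - Dual x2 \<xi>2) + (Dual y1 \<eta>1 - Dual y2 \<eta>2) * (Dual y1 \<eta>1 - Dual y2 \<eta>2) = Dual d c"
    using partial_hom_single_valued[OF T] assms(6) by metis
  then show ?thesis by (simp add: dual_number_defs algebra_simps)
qed

text \<open>Take a derivation with the value \<open>c e\<close> at each length \<open>d e\<close>
  and let \<xi>, \<eta> be its values at the coordinates of \<open>p\<close>. Differentiating the
  edge equations gives the system, and the pinned vertices get 0 because a derivation kills 0 and
  1.\<close>

lemma edge_equations_nondegenerate:
  assumes fin: "finite (verts H)" "finite (edges H)" and sub: "\<And>e. e \<in> edges H \<Longrightarrow> e \<subseteq> verts H"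
    and d: "generic_lengths H {v, w} d" and p: "p \<in> constraint_variety H v w d"
  shows "\<exists>\<xi> \<eta>. \<xi> v = 0 \<and> \<eta> v = 0 \<and> \<xi> w = 0 \<and> \<eta> w = 0 \<and>
    (\<forall>a b. {a, b} \<in> edges H - {{v, w}} \<longrightarrow>
      2 * (fst (p a) - fst (p b)) * (\<xi> a - \<xi> b) + 2 * (snd (p a) - snd (p b)) * (\<eta> a - \<eta> b) = c {a, b})"
proof -
  \<comment> \<open>The numbers 0 and 1 are included so that \<delta> is determined at the pinned
    coordinates.\<close>
  let ?A = "(fst \<circ> p) ` verts H \<union> (snd \<circ> p) ` verts H \<union> {0, 1}"
  have "finite (edges H - {{v, w}})" "finite ?A" using fin by auto
  then obtain T \<delta> where T: "partial_hom T"
    and Td: "\<And>j. j \<in> edges H - {{v, w}} \<Longrightarrow> (d j, Dual (d j) (c j)) \<in> T"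
    and TA: "\<And>a. a \<in> ?A \<Longrightarrow> (a, Dual a (\<delta> a)) \<in> T"
    using ex_dual_hom[of "edges H - {{v, w}}" d ?A c] d unfolding generic_lengths_def by blast
  have "Dual 0 (\<delta> 0) = 0" using TA[of 0] partial_homD(7)[OF T] by blast
  then have \<delta>0: "\<delta> 0 = 0" by (simp add: dual_number_defs)
  have "Dual 1 (\<delta> 1) = 1" using partial_hom_single_valued[OF T TA[of 1] partial_homD(2)[OF T]] by blast
  then have \<delta>1: "\<delta> 1 = 0" by (simp add: dual_number_defs)
  have pvw: "p v = (0, 0)" "p w = (1, 0)" using p by (auto simp: constraint_variety_def)
  have "2 * (fst (p a) - fst (p b)) * (\<delta> (fst (p a)) - \<delta> (fst (p b))) +
      2 * (snd (p a) - snd (p b)) * (\<delta> (snd (p a)) - \<delta> (snd (p b))) = c {a, b}"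
    if ab: "{a, b} \<in> edges H - {{v, w}}" for a b
  proof -
    have "a \<in> verts H" "b \<in> verts H" using sub[of "{a, b}"] ab by auto
    moreover have "(fst (p a) - fst (p b))\<^sup>2 + (snd (p a) - snd (p b))\<^sup>2 - d {a, b} = 0"
      using p ab by (auto simp: constraint_variety_def)
    ultimately show ?thesis by (intro dual_hom_edge[OF T _ _ _ _ Td[OF ab]] TA) auto
  qed
  then show ?thesis
    by (intro exI[of _ "\<lambda>a. \<delta> (fst (p a))"] exI[of _ "\<lambda>a. \<delta> (snd (p a))"])
      (simp add: pvw \<delta>0 \<delta>1)
qed

lemma algebraically_independent_nonzero:
  assumes "algebraically_independent d I" "i \<in> I"
  shows "d i \<noteq> 0"
proof
  assume "d i = 0"
  have "algebraically_independent d {i}"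
    using assms by (auto intro: algebraically_independent_subset)
  then have "transcendental_over (generated_subfield (d ` {})) (d i)"
    by (intro algebraically_independent_transcendental) auto
  moreover have "coeff [:0, 1:] n \<in> generated_subfield (d ` {})" for n
    by (auto simp: coeff_pCons split: nat.split intro: is_subfieldD[OF is_subfield_generated])
  moreover have "poly [:0, 1:] (d i) = 0" using \<open>d i = 0\<close> by simp
  ultimately have "[:0, 1:] = (0 :: complex poly)" unfolding transcendental_over_def by metis
  then show False by simp
qed

section \<open>Solving for the curve degree by degree\<close>

text \<open>Congruence modulo X^m. A factor X raises the precision by one, which makes the recursion
  for the coefficients well founded.\<close>

definition fps_agree :: "nat \<Rightarrow> 'a::comm_ring_1 fps \<Rightarrow> 'a fps \<Rightarrow> bool" where
  "fps_agree m A B \<longleftrightarrow> (\<forall>i<m. A $ i = B $ i)"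

lemma fps_agree_intros:
  "fps_agree m A A" "fps_agree m A B \<Longrightarrow> fps_agree m A' B' \<Longrightarrow> fps_agree m (A + A') (B + B')"
  "fps_agree m A B \<Longrightarrow> fps_agree m A' B' \<Longrightarrow> fps_agree m (A - A') (B - B')"
  "fps_agree m A B \<Longrightarrow> fps_agree m A' B' \<Longrightarrow> fps_agree m (A * A') (B * B')"
  by (auto simp: fps_agree_def fps_mult_nth intro!: sum.cong)

lemma fps_agree_power: "fps_agree m A B \<Longrightarrow> fps_agree m (A ^ n) (B ^ n)"
  by (induction n) (auto intro: fps_agree_intros)

lemma fps_X_mult_agree:
  "fps_agree m A B \<Longrightarrow> (fps_X * A) $ m = (fps_X * B) $ m"
  by (cases m) (auto simp: fps_agree_def)

text \<open>The change of squared length is \<open>Y\<close> times the assumed expression. With this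
  factor divided out, the condition on the velocities has the edge Jacobian as its linear
  part.\<close>

lemma curve_edge_identity:
  fixes Y :: "'a::comm_ring_1"
  assumes "2 * p1 * v1 + 2 * p2 * v2 + Y * (v1\<^sup>2 + v2\<^sup>2) = 0"
  shows "(p1 + Y * v1)\<^sup>2 + (p2 + Y * v2)\<^sup>2 = p1\<^sup>2 + p2\<^sup>2"
proof -
  have "(p1 + Y * v1)\<^sup>2 + (p2 + Y * v2)\<^sup>2
    = p1\<^sup>2 + p2\<^sup>2 + Y * (2 * p1 * v1 + 2 * p2 * v2 + Y * (v1\<^sup>2 + v2\<^sup>2))"
    by (simp add: power2_eq_square algebra_simps)
  then show ?thesis using assms by simp
qed

lemma curve_contracted_edge_identity:
  fixes Y :: "'a::comm_ring_1"
  assumes "k1\<^sup>2 + k2\<^sup>2 = 1" "2 * k1 * l1 + 2 * k2 * l2 = t - Y * (l1\<^sup>2 + l2\<^sup>2)"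
  shows "(Y * (k1 + Y * l1))\<^sup>2 + (Y * (k2 + Y * l2))\<^sup>2 = Y\<^sup>2 * (1 + Y * t)"
proof -
  have "(Y * (k1 + Y * l1))\<^sup>2 + (Y * (k2 + Y * l2))\<^sup>2
    = Y\<^sup>2 * ((k1\<^sup>2 + k2\<^sup>2) + Y * ((2 * k1 * l1 + 2 * k2 * l2) + Y * (l1\<^sup>2 + l2\<^sup>2)))"
    by (simp add: power2_eq_square algebra_simps)
  then show ?thesis using assms by simp
qed

text \<open>Write K = k + Y l, so that z - y = (z - x) - Y K. The difference of squared lengths is
  Y^2 |K|^2 minus twice Y times the product of K and z - x. Orthogonality of k and a removes its
  first-order part; hypothesis \<open>s\<close> prescribes what remains, with |K|^2 = 1 + Y
  t.\<close>

lemma curve_parallel_edge_identity: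
  fixes Y :: "'a::comm_ring_1"
  assumes k: "k1\<^sup>2 + k2\<^sup>2 = 1" "k1 * a1 + k2 * a2 = 0"
    and l: "2 * k1 * l1 + 2 * k2 * l2 = t - Y * (l1\<^sup>2 + l2\<^sup>2)"
    and s: "2 * a1 * l1 + 2 * a2 * l2 + 2 * k1 * u1 + 2 * k2 * u2
      = (2 * \<alpha> + 1) * (1 + Y * t) - s - Y * (2 * (l1 * u1 + l2 * u2))"
  shows "(a1 + Y * (u1 - (\<alpha> + 1) * (k1 + Y * l1)))\<^sup>2 + (a2 + Y * (u2 - (\<alpha> + 1) * (k2 + Y * l2)))\<^sup>2
    = (a1 + Y * (u1 - \<alpha> * (k1 + Y * l1)))\<^sup>2 + (a2 + Y * (u2 - \<alpha> * (k2 + Y * l2)))\<^sup>2 + Y\<^sup>2 * s"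
proof -
  let ?K = "k1 + Y * l1" and ?L = "k2 + Y * l2"
  have K: "Y\<^sup>2 * (?K\<^sup>2 + ?L\<^sup>2) = Y\<^sup>2 * (1 + Y * t)"
    using curve_contracted_edge_identity[OF k(1) l] by (simp only: power_mult_distrib distrib_left[of "Y\<^sup>2"])
  have s': "s = (2 * \<alpha> + 1) * (1 + Y * t) - Y * (2 * (l1 * u1 + l2 * u2))
    - (2 * a1 * l1 + 2 * a2 * l2 + 2 * k1 * u1 + 2 * k2 * u2)"
    by (simp add: s)
  have "(a1 + Y * (u1 - (\<alpha> + 1) * ?K))\<^sup>2 + (a2 + Y * (u2 - (\<alpha> + 1) * ?L))\<^sup>2
    = (a1 + Y * (u1 - \<alpha> * ?K))\<^sup>2 + (a2 + Y * (u2 - \<alpha> * ?L))\<^sup>2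
      + (2 * \<alpha> + 1) * (Y\<^sup>2 * (?K\<^sup>2 + ?L\<^sup>2)) - 2 * Y * (k1 * a1 + k2 * a2)
      - Y\<^sup>2 * (2 * a1 * l1 + 2 * a2 * l2 + 2 * k1 * u1 + 2 * k2 * u2)
      - Y\<^sup>2 * (Y * (2 * (l1 * u1 + l2 * u2)))"
    by (simp add: power2_eq_square algebra_simps)
  then show ?thesis unfolding s' K k(2) by (simp add: algebra_simps)
qed

text \<open>
  The vertex \<open>a\<close> of \<open>G\<close> is placed at \<open>p\<^bsub>\<pi> a\<^esub> + X ((U, W)\<^bsub>\<pi> a\<^esub> + \<tau>\<^sub>a (k + X l))\<close>, where \<open>\<pi>\<close> merges \<open>y\<close>
  into \<open>x\<close> and \<open>\<tau>\<^sub>y - \<tau>\<^sub>x = 1\<close>, so that \<open>y - x = X (k + X l)\<close>. The unit vector \<open>k\<close> is orthogonal to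
  \<open>a = p\<^sub>z - p\<^sub>x\<close>. The coefficients of the unknown series are found one degree at a time, since all
  nonlinear terms carry a factor \<open>X\<close>.
\<close>

lemma formal_curve:
  fixes \<pi> :: "'a \<Rightarrow> 'a" and px py \<tau> :: "'a \<Rightarrow> complex" and t C :: "complex fps"
  assumes surj: "\<And>c. (\<And>a b. c a b = c b a) \<Longrightarrow> \<exists>\<xi> \<eta>. \<xi> v = 0 \<and> \<eta> v = 0 \<and> \<xi> w = 0 \<and> \<eta> w = 0 \<and>
      (\<forall>a b. {a, b} \<in> F \<longrightarrow> 2 * (px (\<pi> a) - px (\<pi> b)) * (\<xi> (\<pi> a) - \<xi> (\<pi> b))
        + 2 * (py (\<pi> a) - py (\<pi> b)) * (\<eta> (\<pi> a) - \<eta> (\<pi> b)) = c a b)"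
    and det: "k1 * a2 - k2 * a1 \<noteq> 0"
  obtains U W :: "'a \<Rightarrow> complex fps" and l1 l2 :: "complex fps"
  where "U v = 0" "W v = 0" "U w = 0" "W w = 0"
    "\<forall>a b V1 V2. {a, b} \<in> F \<and>
      V1 = U (\<pi> a) - U (\<pi> b) + fps_const (\<tau> a - \<tau> b) * (fps_const k1 + fps_X * l1) \<and>
      V2 = W (\<pi> a) - W (\<pi> b) + fps_const (\<tau> a - \<tau> b) * (fps_const k2 + fps_X * l2) \<longrightarrow>
      2 * fps_const (px (\<pi> a) - px (\<pi> b)) * V1 + 2 * fps_const (py (\<pi> a) - py (\<pi> b)) * V2
        + fps_X * (V1\<^sup>2 + V2\<^sup>2) = 0"
    "2 * fps_const k1 * l1 + 2 * fps_const k2 * l2 = t - fps_X * (l1\<^sup>2 + l2\<^sup>2)"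
    "2 * fps_const a1 * l1 + 2 * fps_const a2 * l2 + 2 * fps_const k1 * (U z - U x) + 2 * fps_const k2 * (W z - W x)
      = C - fps_X * (2 * (l1 * (U z - U x) + l2 * (W z - W x)))"
proof -
  define U where "U f a = Abs_fps (\<lambda>m. fst (f m) a)"
    for f :: "nat \<Rightarrow> ('a \<Rightarrow> complex) \<times> ('a \<Rightarrow> complex) \<times> complex \<times> complex" and a
  define W where "W f a = Abs_fps (\<lambda>m. fst (snd (f m)) a)"
    for f :: "nat \<Rightarrow> ('a \<Rightarrow> complex) \<times> ('a \<Rightarrow> complex) \<times> complex \<times> complex" and a
  define l1 where "l1 f = Abs_fps (\<lambda>m. fst (snd (snd (f m))))"
    for f :: "nat \<Rightarrow> ('a \<Rightarrow> complex) \<times> ('a \<Rightarrow> complex) \<times> complex \<times> complex"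
  define l2 where "l2 f = Abs_fps (\<lambda>m. snd (snd (snd (f m))))"
    for f :: "nat \<Rightarrow> ('a \<Rightarrow> complex) \<times> ('a \<Rightarrow> complex) \<times> complex \<times> complex"
  note defs = U_def W_def l1_def l2_def
  define V1 where "V1 f a b = U f (\<pi> a) - U f (\<pi> b) + fps_const (\<tau> a - \<tau> b) * (fps_const k1 + fps_X * l1 f)" for f a b
  define V2 where "V2 f a b = W f (\<pi> a) - W f (\<pi> b) + fps_const (\<tau> a - \<tau> b) * (fps_const k2 + fps_X * l2 f)" for f a b
  define qx where "qx a b = 2 * (px (\<pi> a) - px (\<pi> b))" for a b
  define qy where "qy a b = 2 * (py (\<pi> a) - py (\<pi> b))" for a b
  \<comment> \<open>All of the edge equation except the terms linear in \<open>U\<close> and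
    \<open>W\<close>. Apart from a known constant it carries a factor X, so its coefficient at
    \<open>m\<close> involves only values of \<open>f\<close> below \<open>m\<close>; the same holds
    for \<open>rt\<close> and \<open>rC\<close>.\<close>
  define rhs where "rhs f a b = fps_const (qx a b * (\<tau> a - \<tau> b) * k1 + qy a b * (\<tau> a - \<tau> b) * k2)
    + fps_X * (fps_const (qx a b * (\<tau> a - \<tau> b)) * l1 f + fps_const (qy a b * (\<tau> a - \<tau> b)) * l2 f
      + ((V1 f a b)\<^sup>2 + (V2 f a b)\<^sup>2))" for f a b
  define rt where "rt f = t - fps_X * ((l1 f)\<^sup>2 + (l2 f)\<^sup>2)" for f
  define rC where "rC f = C - fps_X * (2 * (l1 f * (U f z - U f x) + l2 f * (W f z - W f x)))" for f
  define P where "P f m r \<longleftrightarrow> (case r of (\<xi>, \<eta>, \<mu>1, \<mu>2) \<Rightarrow>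
    \<xi> v = 0 \<and> \<eta> v = 0 \<and> \<xi> w = 0 \<and> \<eta> w = 0 \<and>
    (\<forall>a b. {a, b} \<in> F \<longrightarrow> qx a b * (\<xi> (\<pi> a) - \<xi> (\<pi> b)) + qy a b * (\<eta> (\<pi> a) - \<eta> (\<pi> b)) = - rhs f a b $ m) \<and>
    2 * k1 * \<mu>1 + 2 * k2 * \<mu>2 = rt f $ m \<and>
    2 * a1 * \<mu>1 + 2 * a2 * \<mu>2 + 2 * k1 * (\<xi> z - \<xi> x) + 2 * k2 * (\<eta> z - \<eta> x) = rC f $ m)" for f m r
  have "\<exists>f. \<forall>m. P f m (f m)"
  proof (rule dependent_wf_choice[OF wf_less])
    fix f g :: "nat \<Rightarrow> ('a \<Rightarrow> complex) \<times> ('a \<Rightarrow> complex) \<times> complex \<times> complex" and m r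
    assume "\<And>i. (i, m) \<in> {(x, y). x < y} \<Longrightarrow> f i = g i"
    then have fg: "f i = g i" if "i < m" for i using that by simp
    have agree: "fps_agree m (U f a) (U g a)" "fps_agree m (W f a) (W g a)"
      "fps_agree m (l1 f) (l1 g)" "fps_agree m (l2 f) (l2 g)" for a
      using fg by (simp_all add: fps_agree_def defs)
    note intros = fps_agree_intros fps_agree_power agree
    have agreeV: "fps_agree m (V1 f a b) (V1 g a b)" "fps_agree m (V2 f a b) (V2 g a b)" for a b
      unfolding V1_def V2_def by (intro intros)+
    have "rhs f a b $ m = rhs g a b $ m" for a b
      unfolding rhs_def fps_add_nth
      by (intro arg_cong2[of _ _ _ _ "(+)"] refl fps_X_mult_agree intros agreeV)
    moreover have "rt f $ m = rt g $ m"
      unfolding rt_def fps_sub_nth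
      by (intro arg_cong2[of _ _ _ _ "(-)"] refl fps_X_mult_agree intros)
    moreover have "rC f $ m = rC g $ m"
      unfolding rC_def fps_sub_nth
      by (intro arg_cong2[of _ _ _ _ "(-)"] refl fps_X_mult_agree intros)
    ultimately show "P f m r = P g m r" unfolding P_def by simp
  next
    fix m and f :: "nat \<Rightarrow> ('a \<Rightarrow> complex) \<times> ('a \<Rightarrow> complex) \<times> complex \<times> complex"
    have V: "V1 f a b = - V1 f b a" "V2 f a b = - V2 f b a" for a b
    proof -
      have c: "fps_const (\<tau> a - \<tau> b) = - fps_const (\<tau> b - \<tau> a)" by simp
      show "V1 f a b = - V1 f b a" "V2 f a b = - V2 f b a"
        unfolding V1_def V2_def c by (simp_all add: algebra_simps del: fps_const_neg)
    qed
    \<comment> \<open>Edges are unordered, so \<open>surj\<close> accepts only right-hand sides that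
      are symmetric in the two ends.\<close>
    have "rhs f a b = rhs f b a" for a b
    proof -
      have "qx a b * (\<tau> a - \<tau> b) = qx b a * (\<tau> b - \<tau> a)" "qy a b * (\<tau> a - \<tau> b) = qy b a * (\<tau> b - \<tau> a)"
        by (simp_all add: qx_def qy_def algebra_simps)
      moreover have "(V1 f a b)\<^sup>2 = (V1 f b a)\<^sup>2" "(V2 f a b)\<^sup>2 = (V2 f b a)\<^sup>2"
        using V[of a b] by simp_all
      ultimately show ?thesis unfolding rhs_def by simp
    qed
    then obtain \<xi> \<eta> where \<xi>: "\<xi> v = 0 \<and> \<eta> v = 0 \<and> \<xi> w = 0 \<and> \<eta> w = 0 \<and>
      (\<forall>a b. {a, b} \<in> F \<longrightarrow> 2 * (px (\<pi> a) - px (\<pi> b)) * (\<xi> (\<pi> a) - \<xi> (\<pi> b))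
        + 2 * (py (\<pi> a) - py (\<pi> b)) * (\<eta> (\<pi> a) - \<eta> (\<pi> b)) = - rhs f a b $ m)"
      using surj[of "\<lambda>a b. - rhs f a b $ m"] by (simp only: ) blast
    \<comment> \<open>The system is triangular: the edges in \<open>F\<close> have fixed \<xi> and
      \<eta>, and Cramer's rule now gives the coefficients of \<open>l1\<close> and
      \<open>l2\<close> from the two remaining equations.\<close>
    define \<Delta> where "\<Delta> = k1 * a2 - k2 * a1"
    define A where "A = rt f $ m / 2"
    define B where "B = (rC f $ m - 2 * k1 * (\<xi> z - \<xi> x) - 2 * k2 * (\<eta> z - \<eta> x)) / 2"
    define \<mu>1 where "\<mu>1 = (A * a2 - B * k2) / \<Delta>"
    define \<mu>2 where "\<mu>2 = (k1 * B - a1 * A) / \<Delta>"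
    have \<Delta>: "\<Delta> \<noteq> 0" using det by (simp add: \<Delta>_def)
    have "k1 * \<mu>1 + k2 * \<mu>2 = A * \<Delta> / \<Delta>"
      unfolding \<mu>1_def \<mu>2_def by (simp add: \<Delta>_def algebra_simps flip: add_divide_distrib diff_divide_distrib)
    then have 1: "k1 * \<mu>1 + k2 * \<mu>2 = A" using \<Delta> by simp
    have "a1 * \<mu>1 + a2 * \<mu>2 = B * \<Delta> / \<Delta>"
      unfolding \<mu>1_def \<mu>2_def by (simp add: \<Delta>_def algebra_simps flip: add_divide_distrib diff_divide_distrib)
    then have 2: "a1 * \<mu>1 + a2 * \<mu>2 = B" using \<Delta> by simp
    have "2 * k1 * \<mu>1 + 2 * k2 * \<mu>2 = rt f $ m" using arg_cong[OF 1, of "(*) 2"] by (simp add: A_def algebra_simps)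
    moreover have "2 * a1 * \<mu>1 + 2 * a2 * \<mu>2 + 2 * k1 * (\<xi> z - \<xi> x) + 2 * k2 * (\<eta> z - \<eta> x) = rC f $ m"
      using 2 by (simp add: B_def field_simps)
    ultimately have "P f m (\<xi>, \<eta>, \<mu>1, \<mu>2)" using \<xi> by (simp add: P_def qx_def qy_def)
    then show "\<exists>r. P f m r" by blast
  qed
  then obtain f where f: "\<And>m. P f m (f m)" by blast
  have f': "fst (f m) v = 0" "fst (snd (f m)) v = 0" "fst (f m) w = 0" "fst (snd (f m)) w = 0"
    "{a, b} \<in> F \<Longrightarrow> qx a b * (fst (f m) (\<pi> a) - fst (f m) (\<pi> b))
       + qy a b * (fst (snd (f m)) (\<pi> a) - fst (snd (f m)) (\<pi> b)) = - rhs f a b $ m"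
    "2 * k1 * fst (snd (snd (f m))) + 2 * k2 * snd (snd (snd (f m))) = rt f $ m"
    "2 * a1 * fst (snd (snd (f m))) + 2 * a2 * snd (snd (snd (f m)))
      + 2 * k1 * (fst (f m) z - fst (f m) x) + 2 * k2 * (fst (snd (f m)) z - fst (snd (f m)) x) = rC f $ m"
    for m a b
    using f[of m] unfolding P_def by (simp_all add: case_prod_beta)
  have two: "2 * fps_const c = fps_const (2 * c :: complex)" for c by (simp add: numeral_fps_const)
  show thesis
  proof (rule that[of "U f" "W f" "l1 f" "l2 f"])
    show "U f v = 0" "W f v = 0" "U f w = 0" "W f w = 0" by (rule fps_ext; simp add: defs f')+
  next
    show "\<forall>a b v1 v2. {a, b} \<in> F \<and>
      v1 = U f (\<pi> a) - U f (\<pi> b) + fps_const (\<tau> a - \<tau> b) * (fps_const k1 + fps_X * l1 f) \<and>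
      v2 = W f (\<pi> a) - W f (\<pi> b) + fps_const (\<tau> a - \<tau> b) * (fps_const k2 + fps_X * l2 f) \<longrightarrow>
      2 * fps_const (px (\<pi> a) - px (\<pi> b)) * v1 + 2 * fps_const (py (\<pi> a) - py (\<pi> b)) * v2
        + fps_X * (v1\<^sup>2 + v2\<^sup>2) = 0"
    proof (intro allI impI, elim conjE)
      fix a b v1 v2
      assume ab: "{a, b} \<in> F"
        and "v1 = U f (\<pi> a) - U f (\<pi> b) + fps_const (\<tau> a - \<tau> b) * (fps_const k1 + fps_X * l1 f)"
        and "v2 = W f (\<pi> a) - W f (\<pi> b) + fps_const (\<tau> a - \<tau> b) * (fps_const k2 + fps_X * l2 f)"
      then have v: "v1 = V1 f a b" "v2 = V2 f a b" by (simp_all add: V1_def V2_def)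
      have "2 * fps_const (px (\<pi> a) - px (\<pi> b)) * v1 + 2 * fps_const (py (\<pi> a) - py (\<pi> b)) * v2 + fps_X * (v1\<^sup>2 + v2\<^sup>2)
        = (fps_const (qx a b) * (U f (\<pi> a) - U f (\<pi> b)) + fps_const (qy a b) * (W f (\<pi> a) - W f (\<pi> b))) + rhs f a b"
        unfolding two qx_def[symmetric] qy_def[symmetric] v rhs_def
        unfolding V1_def[of f a b] V2_def[of f a b]
        unfolding fps_const_add[symmetric] fps_const_mult[symmetric]
        by (simp only: distrib_left distrib_right mult_ac add_ac)
      also have "\<dots> = 0"
        by (rule fps_ext) (use f'(5)[OF ab] in \<open>simp add: defs\<close>)
      finally show "2 * fps_const (px (\<pi> a) - px (\<pi> b)) * v1 + 2 * fps_const (py (\<pi> a) - py (\<pi> b)) * v2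
        + fps_X * (v1\<^sup>2 + v2\<^sup>2) = 0" .
    qed
  next
    show "2 * fps_const k1 * l1 f + 2 * fps_const k2 * l2 f = t - fps_X * ((l1 f)\<^sup>2 + (l2 f)\<^sup>2)"
      unfolding two rt_def[symmetric] by (rule fps_ext) (use f'(6) in \<open>simp add: l1_def l2_def\<close>)
    show "2 * fps_const a1 * l1 f + 2 * fps_const a2 * l2 f + 2 * fps_const k1 * (U f z - U f x) + 2 * fps_const k2 * (W f z - W f x)
      = C - fps_X * (2 * (l1 f * (U f z - U f x) + l2 f * (W f z - W f x)))"
      unfolding two rC_def[symmetric] by (rule fps_ext) (use f'(7) in \<open>simp add: defs\<close>)
  qed
qed

section \<open>Transfer of solubility to the contraction\<close>

text \<open>Countability is read off from the adjunction lemma: embedding the generators one at a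
  time yields a countable graph whose domain is a field containing them.\<close>

lemma countable_generated_subfield:
  assumes "finite S"
  shows "countable (generated_subfield S)"
proof -
  let ?T = "(\<lambda>a :: complex. (a, a)) ` \<rat>"
  have T: "partial_hom ?T" by (rule partial_hom_graph[OF is_subfield_Rats]) auto
  have cT: "countable ?T" by (simp add: countable_rat)
  obtain T' where T': "partial_hom T'" "countable T'" "\<forall>r\<in>S. \<exists>c. (r, c :: complex) \<in> T'"
    using adjoin_alg_closed_finite[OF T cT uncountable_UNIV_complex assms] by blast
  have "generated_subfield S \<subseteq> fst ` T'"
    by (rule generated_subfield_least[OF is_subfield_fst_partial_hom[OF T'(1)]]) (use T'(3) in force)
  then show ?thesis using countable_subset countable_image[OF T'(2)] by metis
qed

text \<open>Sets of naturals give uncountably many series whose coefficients lie in every subfield,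
  so the perturbed lengths can be transcendental over a countable field of series while staying
  defined over \<open>R\<close>.\<close>

definition indicator_fps :: "nat set \<Rightarrow> complex fps" where
  "indicator_fps A = Abs_fps (\<lambda>n. if n \<in> A then 1 else 0)"

lemma uncountable_indicator_family:
  "uncountable ((\<lambda>A. fps_to_fls (c + fps_X ^ k * indicator_fps A)) ` UNIV)"
proof
  let ?h = "\<lambda>A. fps_to_fls (c + fps_X ^ k * indicator_fps A)"
  assume "countable (?h ` UNIV)"
  moreover have "inj ?h"
  proof (rule injI)
    fix A B assume "?h A = ?h B"
    then have "indicator_fps A = indicator_fps B" by simp
    moreover have "A = {n. indicator_fps A $ n = 1}" for A by (auto simp: indicator_fps_def)
    ultimately show "A = B" by metis
  qed
  ultimately have count: "countable (UNIV :: nat set set)" by (simp add: countable_image_inj_eq)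
  have "range (from_nat_into (UNIV :: nat set set)) = UNIV"
    by (rule range_from_nat_into) (use count in auto)
  then show False using Cantors_theorem[of "UNIV :: nat set"] by (metis Pow_UNIV)
qed

text \<open>The numbers \<eta> and \<omega> become the lengths of xy and yz in \<open>G\<close>, and
  the series are their images along the curve. Each pair is transcendental on both sides, and
  \<omega> is chosen after \<eta> to be transcendental over the field containing it. The exponents
  fit the curve: |y - x|^2 starts with X^2, and the length of yz first moves at order X^2.\<close>

lemma ex_generic_perturbation:
  assumes K: "is_subfield K" "countable K"
  obtains T \<eta> A \<omega> B where "partial_hom T" "countable T" "\<forall>a\<in>K. (a, fls_const a) \<in> T"
    "(\<eta>, fps_to_fls (fps_X ^ 2 + fps_X ^ 3 * indicator_fps A)) \<in> T"
    "(\<omega>, fps_to_fls (fps_const c + fps_X ^ 2 * indicator_fps B)) \<in> T"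
    "transcendental_over K \<eta>" "transcendental_over (generated_subfield (insert \<eta> K)) \<omega>"
proof -
  let ?T0 = "(\<lambda>a. (a, fls_const a)) ` K"
  have T0: "partial_hom ?T0" by (rule partial_hom_graph[OF K(1)]) (auto simp: fls_plus_const fls_minus_const)
  have cT0: "countable ?T0" using K(2) by simp
  have fst0: "fst ` ?T0 = K" by force
  obtain \<eta> where \<eta>: "transcendental_over (fst ` ?T0) \<eta>"
    using ex_transcendental_over[OF countable_image[OF cT0] uncountable_UNIV_complex] by blast
  obtain h1 where "h1 \<in> (\<lambda>A. fps_to_fls (fps_X ^ 2 + fps_X ^ 3 * indicator_fps A)) ` UNIV"
    "transcendental_over (snd ` ?T0) h1"
    using ex_transcendental_over[OF countable_image[OF cT0] uncountable_indicator_family] by blast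
  then obtain A where A: "transcendental_over (snd ` ?T0) (fps_to_fls (fps_X ^ 2 + fps_X ^ 3 * indicator_fps A))"
    by auto
  obtain T1 where T1: "partial_hom T1" "?T0 \<subseteq> T1"
    "(\<eta>, fps_to_fls (fps_X ^ 2 + fps_X ^ 3 * indicator_fps A)) \<in> T1" "countable T1"
    by (rule adjoin_transcendental_pair[OF T0 cT0 \<eta> A])
  obtain \<omega> where \<omega>: "transcendental_over (fst ` T1) \<omega>"
    using ex_transcendental_over[OF countable_image[OF T1(4)] uncountable_UNIV_complex] by blast
  obtain h2 where "h2 \<in> (\<lambda>B. fps_to_fls (fps_const c + fps_X ^ 2 * indicator_fps B)) ` UNIV"
    "transcendental_over (snd ` T1) h2"
    using ex_transcendental_over[OF countable_image[OF T1(4)] uncountable_indicator_family] by blast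
  then obtain B where B: "transcendental_over (snd ` T1) (fps_to_fls (fps_const c + fps_X ^ 2 * indicator_fps B))"
    by auto
  obtain T where T: "partial_hom T" "T1 \<subseteq> T"
    "(\<omega>, fps_to_fls (fps_const c + fps_X ^ 2 * indicator_fps B)) \<in> T" "countable T"
    by (rule adjoin_transcendental_pair[OF T1(1,4) \<omega> B])
  have "insert \<eta> K \<subseteq> fst ` T1" using T1(2,3) fst0 by force
  then have "generated_subfield (insert \<eta> K) \<subseteq> fst ` T1"
    by (rule generated_subfield_least[OF is_subfield_fst_partial_hom[OF T1(1)]])
  then have "transcendental_over (generated_subfield (insert \<eta> K)) \<omega>"
    using transcendental_over_mono[OF \<omega>] by blast
  moreover have "(a, fls_const a) \<in> T" if "a \<in> K" for a using that T1(2) T(2) by blast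
  moreover have "(\<eta>, fps_to_fls (fps_X ^ 2 + fps_X ^ 3 * indicator_fps A)) \<in> T" using T1(3) T(2) by blast
  ultimately show thesis using that T(1,3,4) \<eta> unfolding fst0 by blast
qed

section \<open>A single point of the contraction as the limit of a curve for
  \<open>G\<close>\<close>

lemma contract_edge_coordinates:
  fixes G :: "'a ugraph" and x y :: 'a
  assumes G: "finite_simple_graph G" and xyE: "{x, y} \<in> edges G"
    and free: "freedom G = 3" "freedom (contract_edge G x y) = 3"
    and sol: "radically_soluble G"
    and vw: "{v, w} \<in> edges (contract_edge G x y)"
    and d: "generic_lengths (contract_edge G x y) {v, w} d"
    and p: "p \<in> constraint_variety (contract_edge G x y) v w d"
    and u: "u \<in> verts (contract_edge G x y)"
  shows "fst (p u) \<in> radical_closure (base_field (contract_edge G x y) {v, w} d) \<and>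
    snd (p u) \<in> radical_closure (base_field (contract_edge G x y) {v, w} d)"
proof -
  define H where "H = contract_edge G x y"
  define \<pi> where "\<pi> = merge_vertex x y"
  note vw = vw[folded H_def] and d = d[folded H_def] and p = p[folded H_def] and u = u[folded H_def]
  obtain z where xny: "x \<noteq> y" and zx: "z \<noteq> x" and zy: "z \<noteq> y" and xz: "{x, z} \<in> edges G" and yz: "{y, z} \<in> edges G"
    and inj: "inj_on ((`) \<pi>) (edges G - {{x, y}, {y, z}})"
    and edgesH: "edges H = (`) \<pi> ` (edges G - {{x, y}, {y, z}})"
    using contract_edge_common_neighbour[OF G xyE free] unfolding H_def \<pi>_def by metis
  have vertsH: "verts H = \<pi> ` verts G" by (simp add: H_def \<pi>_def contract_edge_def)
  have \<pi>: "\<pi> x = x" "\<pi> y = x" "\<pi> z = z" using zy xny by (auto simp: \<pi>_def merge_vertex_def)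
  have finV: "finite (verts G)" using G by (simp add: finite_simple_graph_def)
  have finE: "finite (edges G)" by (rule finite_edges[OF G])
  have edge_sub: "e \<subseteq> verts G" if "e \<in> edges G" for e using G that by (auto simp: finite_simple_graph_def)
  have finH: "finite (verts H)" "finite (edges H)" using finV finE by (simp_all add: vertsH edgesH)
  have subH: "e \<subseteq> verts H" if "e \<in> edges H" for e using that edge_sub by (auto simp: vertsH edgesH)
  let ?E = "edges G - {{x, y}, {y, z}}"
  have xz_ne: "{x, z} \<noteq> {x, y}" "{x, z} \<noteq> {y, z}" using xny zx zy by (auto simp: doubleton_eq_iff)
  have yz_ne: "{y, z} \<noteq> {x, y}" using xny zx zy by (auto simp: doubleton_eq_iff)
  \<comment> \<open>The base edge of \<open>G\<close> is the preimage of vw that survives the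
    removal of xy and yz. If vw is xz in the contraction, it is xz in \<open>G\<close> as
    well.\<close>
  obtain f0 where f0: "f0 \<in> ?E" "\<pi> ` f0 = {v, w}" using vw unfolding edgesH by auto
  obtain v0 w0 where f0_eq: "f0 = {v0, w0}" and \<pi>0: "\<pi> v0 = v" "\<pi> w0 = w"
  proof -
    obtain a b where ab: "f0 = {a, b}" using edge_ends[OF G] f0(1) by blast
    then have "{\<pi> a, \<pi> b} = {v, w}" using f0(2) by simp
    then consider "\<pi> a = v" "\<pi> b = w" | "\<pi> a = w" "\<pi> b = v" by (auto simp: doubleton_eq_iff)
    then show thesis
    proof cases
      case 1 then show thesis using that ab by blast
    next
      case 2 then show thesis using that[of b a] ab by (simp add: insert_commute)
    qed
  qed
  define F where "F = ?E - {f0}"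
  have \<pi>F: "\<pi> ` e \<in> edges H - {{v, w}}" if "e \<in> F" for e
  proof -
    have "\<pi> ` e \<noteq> \<pi> ` f0" using inj_onD[OF inj, of e f0] that f0(1) by (auto simp: F_def)
    then show ?thesis using that f0(2) by (auto simp: F_def edgesH)
  qed
  have image_F: "(`) \<pi> ` F = edges H - {{v, w}}"
  proof
    show "(`) \<pi> ` F \<subseteq> edges H - {{v, w}}" using \<pi>F by blast
    show "edges H - {{v, w}} \<subseteq> (`) \<pi> ` F" using f0(2) by (auto simp: F_def edgesH)
  qed
  have edgesG: "edges G - {f0} = insert {y, z} (insert {x, y} F)"
    using f0(1) xyE yz by (auto simp: F_def)
  define px where "px a = fst (p a)" for a
  define py where "py a = snd (p a)" for a
  have pvw: "px v = 0" "py v = 0" "px w = 1" "py w = 0" using p by (auto simp: constraint_variety_def px_def py_def)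
  have edge_eq: "(px a - px b)\<^sup>2 + (py a - py b)\<^sup>2 = d {a, b}" if "{a, b} \<in> edges H" for a b
  proof (cases "{a, b} = {v, w}")
    case True
    then have "d {a, b} = 1" using d by (simp add: generic_lengths_def)
    moreover have "a = v \<and> b = w \<or> a = w \<and> b = v" using True by (auto simp: doubleton_eq_iff)
    ultimately show ?thesis using pvw by auto
  next
    case False
    then show ?thesis using that p by (auto simp: constraint_variety_def px_def py_def)
  qed
  have d_nz: "d e \<noteq> 0" if "e \<in> edges H" for e
    using that d algebraically_independent_nonzero[of d "edges H - {{v, w}}" e]
    by (cases "e = {v, w}") (auto simp: generic_lengths_def)
  \<comment> \<open>The shift is put on the end of \<open>xy\<close> that is not on the base edge, which stays pinned.\<close>
  define \<tau> where "\<tau> a = (if y \<in> f0 then (if a = x then - 1 else 0) else (if a = y then 1 else 0) :: complex)" for a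
  have \<tau>0: "\<tau> v0 = 0" "\<tau> w0 = 0"
    using f0(1) xny unfolding \<tau>_def f0_eq by (auto simp: insert_commute)
  have \<tau>yx: "\<tau> y = \<tau> x + 1" and \<tau>z: "\<tau> z = 0" using xny zx zy by (auto simp: \<tau>_def)
  define a1 where "a1 = px z - px x"
  define a2 where "a2 = py z - py x"
  have xzH: "{x, z} \<in> edges H"
  proof -
    have "\<pi> ` {x, z} \<in> edges H" unfolding edgesH using xz xz_ne by blast
    then show ?thesis by (simp add: \<pi>)
  qed
  have aa: "a1\<^sup>2 + a2\<^sup>2 = d {x, z}" using edge_eq[of z x] xzH by (simp add: a1_def a2_def insert_commute)
  have aa_nz: "a1\<^sup>2 + a2\<^sup>2 \<noteq> 0" using aa d_nz[OF xzH] by simp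
  \<comment> \<open>k is z - x turned by a right angle and normalised. The normalisation is possible
    because d_xz is nonzero: it is 1 or a transcendental.\<close>
  define q where "q = csqrt (a1\<^sup>2 + a2\<^sup>2)"
  have q2: "q\<^sup>2 = a1\<^sup>2 + a2\<^sup>2" by (simp add: q_def)
  have q_nz: "q \<noteq> 0" using q2 aa_nz by auto
  define k1 where "k1 = - a2 / q"
  define k2 where "k2 = a1 / q"
  have kk: "k1\<^sup>2 + k2\<^sup>2 = 1"
    using q_nz q2 aa_nz by (simp add: k1_def k2_def power_divide flip: add_divide_distrib)
  have ka: "k1 * a1 + k2 * a2 = 0" by (simp add: k1_def k2_def)
  have det: "k1 * a2 - k2 * a1 \<noteq> 0"
  proof -
    have "(k1 * a2 - k2 * a1) * q = - (a1\<^sup>2 + a2\<^sup>2)" using q_nz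
      by (simp add: k1_def k2_def left_diff_distrib power2_eq_square)
    then show ?thesis using aa_nz by (metis mult_zero_left neg_equal_0_iff_equal)
  qed

  define K where "K = base_field H {v, w} d"
  have K: "is_subfield K" "countable K"
    using finH(2) unfolding K_def base_field_def
    by (simp_all add: is_subfield_generated countable_generated_subfield)
  have dK: "d e \<in> K" if "e \<in> edges H" for e
  proof (cases "e = {v, w}")
    case True
    then show ?thesis using d is_subfieldD(2)[OF K(1)] by (simp add: generic_lengths_def)
  next
    case False
    then show ?thesis using that generated_subfield_superset[of "d ` (edges H - {{v, w}})"]
      unfolding K_def base_field_def by blast
  qed
  define R where "R = radical_closure K"
  have R: "root_closed R" unfolding R_def by (rule root_closed_radical_closure[OF K(1)])
  note sfR = root_closed_is_subfield[OF R]
  note sfRR = is_subfield_fls_over[OF sfR]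
  have KR: "K \<subseteq> R" unfolding R_def using radical_closureI[OF radical_extension.base] by blast
  obtain T \<eta> A \<omega> B where T: "partial_hom T" "countable T" and TK: "\<forall>a\<in>K. (a, fls_const a) \<in> T"
    and T\<eta>: "(\<eta>, fps_to_fls (fps_X ^ 2 + fps_X ^ 3 * indicator_fps A)) \<in> T"
    and T\<omega>: "(\<omega>, fps_to_fls (fps_const (a1\<^sup>2 + a2\<^sup>2) + fps_X ^ 2 * indicator_fps B)) \<in> T"
    and \<eta>: "transcendental_over K \<eta>" and \<omega>: "transcendental_over (generated_subfield (insert \<eta> K)) \<omega>"
    by (rule ex_generic_perturbation[OF K, of "a1\<^sup>2 + a2\<^sup>2"])

  define D where "D e = (if e = {x, y} then \<eta> else if e = {y, z} then \<omega> else d (\<pi> ` e))" for e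
  have DF: "D e = d (\<pi> ` e)" if "e \<in> F" for e using that by (auto simp: D_def F_def)
  have D_F_image: "D ` F = d ` (edges H - {{v, w}})" unfolding image_F[symmetric] using DF by (auto simp: image_iff)
  have genD: "generic_lengths G f0 D"
  proof -
    have "D f0 = 1" using f0 d by (auto simp: D_def generic_lengths_def)
    moreover have "algebraically_independent D (edges G - {f0})"
      unfolding edgesG
    proof (intro algebraically_independent_insert)
      show "algebraically_independent D F"
      proof (rule algebraically_independent_reindex[where \<phi> = "(`) \<pi>" and d = d])
        show "finite F" using finE by (simp add: F_def)
        show "inj_on ((`) \<pi>) F" using inj by (rule inj_on_subset) (auto simp: F_def)
        show "algebraically_independent d ((`) \<pi> ` F)" unfolding image_F using d by (simp add: generic_lengths_def)
      qed (rule DF)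
      have Dxy: "D {x, y} = \<eta>" and Dyz: "D {y, z} = \<omega>" using yz_ne by (auto simp: D_def)
      show "transcendental_over (generated_subfield (D ` F)) (D {x, y})"
        using \<eta> unfolding Dxy D_F_image K_def base_field_def .
      have "D ` insert {x, y} F \<subseteq> generated_subfield (insert \<eta> K)"
        using generated_subfield_superset[of "insert \<eta> K"] generated_subfield_superset[of "D ` F"]
        unfolding image_insert Dxy D_F_image K_def base_field_def by blast
      then have "generated_subfield (D ` insert {x, y} F) \<subseteq> generated_subfield (insert \<eta> K)"
        by (rule generated_subfield_least[OF is_subfield_generated])
      then show "transcendental_over (generated_subfield (D ` insert {x, y} F)) (D {y, z})"
        unfolding Dyz by (rule transcendental_over_mono[OF \<omega>])
    qed
    ultimately show ?thesis by (simp add: generic_lengths_def)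
  qed

  \<comment> \<open>The right-hand side found in \<open>curve_parallel_edge_identity\<close>, with
    \<alpha> = \<tau>_x and the perturbations of xy and yz as t and s.\<close>
  define C where "C = (2 * fps_const (\<tau> x) + 1) * (1 + fps_X * indicator_fps A) - indicator_fps B"
  have surj: "\<exists>\<xi> \<eta>. \<xi> v = 0 \<and> \<eta> v = 0 \<and> \<xi> w = 0 \<and> \<eta> w = 0 \<and>
      (\<forall>a b. {a, b} \<in> F \<longrightarrow> 2 * (px (\<pi> a) - px (\<pi> b)) * (\<xi> (\<pi> a) - \<xi> (\<pi> b))
        + 2 * (py (\<pi> a) - py (\<pi> b)) * (\<eta> (\<pi> a) - \<eta> (\<pi> b)) = c a b)"
    if sym: "\<And>a b. c a b = c b a" for c :: "'a \<Rightarrow> 'a \<Rightarrow> complex"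
  proof -
    \<comment> \<open>Moves the right-hand side from edges in \<open>F\<close> to edges of
      \<open>H\<close>. The choice is harmless, since \<open>\<pi>\<close> is injective on these
      edges and \<open>c\<close> is symmetric.\<close>
    define c' where "c' e' = (SOME r. \<exists>a b. {a, b} \<in> F \<and> \<pi> ` {a, b} = e' \<and> r = c a b)" for e'
    have c': "c' {\<pi> a, \<pi> b} = c a b" if ab: "{a, b} \<in> F" for a b
    proof -
      have "\<exists>r. \<exists>a' b'. {a', b'} \<in> F \<and> \<pi> ` {a', b'} = {\<pi> a, \<pi> b} \<and> r = c a' b'" using ab by auto
      then have "\<exists>a' b'. {a', b'} \<in> F \<and> \<pi> ` {a', b'} = {\<pi> a, \<pi> b} \<and> c' {\<pi> a, \<pi> b} = c a' b'"
        unfolding c'_def by (rule someI_ex)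
      then obtain a' b' where ab': "{a', b'} \<in> F" "\<pi> ` {a', b'} = {\<pi> a, \<pi> b}" "c' {\<pi> a, \<pi> b} = c a' b'"
        by blast
      have "{a', b'} = {a, b}"
        by (rule inj_onD[OF inj]) (use ab ab' in \<open>auto simp: F_def\<close>)
      then show ?thesis using ab'(3) sym by (auto simp: doubleton_eq_iff)
    qed
    obtain \<xi> \<eta> where \<xi>: "\<xi> v = 0 \<and> \<eta> v = 0 \<and> \<xi> w = 0 \<and> \<eta> w = 0"
      and eq: "\<And>a b. {a, b} \<in> edges H - {{v, w}} \<Longrightarrow>
      2 * (fst (p a) - fst (p b)) * (\<xi> a - \<xi> b) + 2 * (snd (p a) - snd (p b)) * (\<eta> a - \<eta> b) = c' {a, b}"
      using edge_equations_nondegenerate[OF finH subH d p, of c'] by blast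
    have "2 * (px (\<pi> a) - px (\<pi> b)) * (\<xi> (\<pi> a) - \<xi> (\<pi> b))
        + 2 * (py (\<pi> a) - py (\<pi> b)) * (\<eta> (\<pi> a) - \<eta> (\<pi> b)) = c a b" if "{a, b} \<in> F" for a b
      using eq[of "\<pi> a" "\<pi> b"] \<pi>F[OF that] c'[OF that] by (simp add: px_def py_def)
    then show ?thesis using \<xi> by blast
  qed
  obtain U W :: "'a \<Rightarrow> complex fps" and l1 l2 :: "complex fps"
  where UW0: "U v = 0" "W v = 0" "U w = 0" "W w = 0"
    and UWF: "\<forall>a b V1 V2. {a, b} \<in> F \<and>
      V1 = U (\<pi> a) - U (\<pi> b) + fps_const (\<tau> a - \<tau> b) * (fps_const k1 + fps_X * l1) \<and>
      V2 = W (\<pi> a) - W (\<pi> b) + fps_const (\<tau> a - \<tau> b) * (fps_const k2 + fps_X * l2) \<longrightarrow>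
      2 * fps_const (px (\<pi> a) - px (\<pi> b)) * V1 + 2 * fps_const (py (\<pi> a) - py (\<pi> b)) * V2
        + fps_X * (V1\<^sup>2 + V2\<^sup>2) = 0"
    and lk: "2 * fps_const k1 * l1 + 2 * fps_const k2 * l2 = indicator_fps A - fps_X * (l1\<^sup>2 + l2\<^sup>2)"
    and la: "2 * fps_const a1 * l1 + 2 * fps_const a2 * l2 + 2 * fps_const k1 * (U z - U x) + 2 * fps_const k2 * (W z - W x)
      = C - fps_X * (2 * (l1 * (U z - U x) + l2 * (W z - W x)))"
    by (rule formal_curve[where v = v and w = w and F = F and \<pi> = \<pi> and px = px and py = py and \<tau> = \<tau>
          and t = "indicator_fps A" and C = C and z = z and x = x, OF surj det])
  define X1 where "X1 a = fps_const (px (\<pi> a)) + fps_X * (U (\<pi> a) + fps_const (\<tau> a) * (fps_const k1 + fps_X * l1))" for a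
  define X2 where "X2 a = fps_const (py (\<pi> a)) + fps_X * (W (\<pi> a) + fps_const (\<tau> a) * (fps_const k2 + fps_X * l2))" for a
  define L where "L e = (if e = {x, y} then fps_X ^ 2 + fps_X ^ 3 * indicator_fps A
    else if e = {y, z} then fps_const (a1\<^sup>2 + a2\<^sup>2) + fps_X ^ 2 * indicator_fps B
    else fps_const (d (\<pi> ` e)))" for e
  have XF: "(X1 a - X1 b)\<^sup>2 + (X2 a - X2 b)\<^sup>2 = fps_const (d {\<pi> a, \<pi> b})" if ab: "{a, b} \<in> F" for a b
  proof -
    let ?V1 = "U (\<pi> a) - U (\<pi> b) + fps_const (\<tau> a - \<tau> b) * (fps_const k1 + fps_X * l1)"
    let ?V2 = "W (\<pi> a) - W (\<pi> b) + fps_const (\<tau> a - \<tau> b) * (fps_const k2 + fps_X * l2)"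
    have "X1 a - X1 b = fps_const (px (\<pi> a) - px (\<pi> b)) + fps_X * ?V1"
      "X2 a - X2 b = fps_const (py (\<pi> a) - py (\<pi> b)) + fps_X * ?V2"
      unfolding X1_def X2_def fps_const_sub[symmetric] by (simp_all only: algebra_simps)
    then have "(X1 a - X1 b)\<^sup>2 + (X2 a - X2 b)\<^sup>2
      = (fps_const (px (\<pi> a) - px (\<pi> b)))\<^sup>2 + (fps_const (py (\<pi> a) - py (\<pi> b)))\<^sup>2"
      using curve_edge_identity[OF UWF[rule_format, of a b ?V1 ?V2]] ab by simp
    also have "\<dots> = fps_const ((px (\<pi> a) - px (\<pi> b))\<^sup>2 + (py (\<pi> a) - py (\<pi> b))\<^sup>2)"
      by (simp add: fps_const_power)
    finally show ?thesis using edge_eq[of "\<pi> a" "\<pi> b"] \<pi>F[OF ab] by simp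
  qed
  have kk': "(fps_const k1)\<^sup>2 + (fps_const k2)\<^sup>2 = (1 :: complex fps)" using kk by (simp add: fps_const_power)
  have ka': "fps_const k1 * fps_const a1 + fps_const k2 * fps_const a2 = (0 :: complex fps)" using ka by simp
  have Xxy: "(X1 y - X1 x)\<^sup>2 + (X2 y - X2 x)\<^sup>2 = fps_X ^ 2 + fps_X ^ 3 * indicator_fps A"
  proof -
    have \<tau>': "fps_const (\<tau> y) = fps_const (\<tau> x) + 1" unfolding \<tau>yx by (simp flip: fps_const_add)
    have "X1 y - X1 x = fps_X * (fps_const k1 + fps_X * l1)" "X2 y - X2 x = fps_X * (fps_const k2 + fps_X * l2)"
      unfolding X1_def X2_def \<pi> \<tau>' by (simp_all add: algebra_simps)
    then show ?thesis
      using curve_contracted_edge_identity[OF kk' lk]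
      by (simp add: algebra_simps power2_eq_square power3_eq_cube)
  qed
  have Xxz: "(X1 z - X1 x)\<^sup>2 + (X2 z - X2 x)\<^sup>2 = fps_const (a1\<^sup>2 + a2\<^sup>2)"
  proof (cases "{z, x} = f0")
    \<comment> \<open>The base edge is not in \<open>F\<close>, so no curve equation covers it; its
      length is constant because both its ends are pinned.\<close>
    case True
    then have "z = v0 \<and> x = w0 \<or> z = w0 \<and> x = v0" by (auto simp: f0_eq doubleton_eq_iff)
    then have "U z = 0" "U x = 0" "W z = 0" "W x = 0" "\<tau> x = 0"
      using \<pi> \<pi>0 UW0 \<tau>0 by auto
    then have "X1 z - X1 x = fps_const a1" "X2 z - X2 x = fps_const a2"
      using \<tau>z by (simp_all add: X1_def X2_def \<pi> a1_def a2_def)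
    then show ?thesis by (simp add: fps_const_power)
  next
    case False
    then have "{z, x} \<in> F" using xz xz_ne by (simp add: F_def insert_commute)
    from XF[OF this] show ?thesis by (simp add: \<pi> aa insert_commute)
  qed
  have Xyz: "(X1 z - X1 y)\<^sup>2 + (X2 z - X2 y)\<^sup>2 = fps_const (a1\<^sup>2 + a2\<^sup>2) + fps_X ^ 2 * indicator_fps B"
  proof -
    have \<tau>': "fps_const (\<tau> y) = fps_const (\<tau> x) + 1" unfolding \<tau>yx by (simp flip: fps_const_add)
    have c: "fps_const a1 = fps_const (px z) - fps_const (px x)" "fps_const a2 = fps_const (py z) - fps_const (py x)"
      by (simp_all add: a1_def a2_def)
    have x: "X1 z - X1 x = fps_const a1 + fps_X * (U z - U x - fps_const (\<tau> x) * (fps_const k1 + fps_X * l1))"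
      "X2 z - X2 x = fps_const a2 + fps_X * (W z - W x - fps_const (\<tau> x) * (fps_const k2 + fps_X * l2))"
      unfolding X1_def X2_def \<pi> \<tau>z c by (simp_all add: algebra_simps del: fps_const_sub)
    have y: "X1 z - X1 y = fps_const a1 + fps_X * (U z - U x - (fps_const (\<tau> x) + 1) * (fps_const k1 + fps_X * l1))"
      "X2 z - X2 y = fps_const a2 + fps_X * (W z - W x - (fps_const (\<tau> x) + 1) * (fps_const k2 + fps_X * l2))"
      unfolding X1_def X2_def \<pi> \<tau>z \<tau>' c by (simp_all add: algebra_simps del: fps_const_sub)
    show ?thesis
      unfolding Xxz[symmetric] unfolding x y
      by (rule curve_parallel_edge_identity[OF kk' ka' lk]) (use la in \<open>simp only: C_def\<close>)
  qed
  have XL: "(X1 a - X1 b)\<^sup>2 + (X2 a - X2 b)\<^sup>2 = L {a, b}" if ab: "{a, b} \<in> edges G - {f0}" for a b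
  proof -
    have sw: "(X1 a - X1 b)\<^sup>2 + (X2 a - X2 b)\<^sup>2 = (X1 b - X1 a)\<^sup>2 + (X2 b - X2 a)\<^sup>2" for a b
      by (simp add: power2_commute)
    consider "{a, b} = {x, y}" | "{a, b} = {y, z}" | "{a, b} \<in> F" using ab unfolding edgesG by blast
    then show ?thesis
    proof cases
      case 1
      then have "a = x \<and> b = y \<or> a = y \<and> b = x" by (auto simp: doubleton_eq_iff)
      then show ?thesis using Xxy sw[of x y] 1 by (auto simp: L_def)
    next
      case 2
      then have "a = y \<and> b = z \<or> a = z \<and> b = y" by (auto simp: doubleton_eq_iff)
      then show ?thesis using Xyz sw[of y z] 2 yz_ne by (auto simp: L_def insert_commute)
    next
      case 3
      then have "L {a, b} = fps_const (d (\<pi> ` {a, b}))" by (auto simp: L_def F_def)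
      then show ?thesis using XF[OF 3] by simp
    qed
  qed
  have TD: "(D e, fps_to_fls (L e)) \<in> T" if "e \<in> edges G - {f0}" for e
  proof -
    have "d (\<pi> ` e) \<in> K" if "e \<in> F" using \<pi>F[OF that] dK by blast
    then show ?thesis using that T\<eta> T\<omega> TK edgesG unfolding D_def L_def by (auto simp: F_def)
  qed

  \<comment> \<open>The reversed relation maps a countable field of series to complex numbers. It is
    extended to all coordinate series and then turned back into \<open>S\<close>, so that the curve
    becomes a complex point for the lengths \<open>D\<close>.\<close>
  have "finite ((\<lambda>a. fps_to_fls (X1 a)) ` verts G \<union> (\<lambda>a. fps_to_fls (X2 a)) ` verts G)" (is "finite ?A")
    using finV by simp
  moreover have "T\<inverse> = prod.swap ` T" by force
  then have "countable (T\<inverse>)" using T(2) by simp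
  ultimately obtain T' where T': "partial_hom T'" "T\<inverse> \<subseteq> T'" "\<forall>r\<in>?A. \<exists>c. (r, c) \<in> T'"
    using adjoin_alg_closed_finite[OF partial_hom_converse[OF T(1)] _ uncountable_UNIV_complex, of ?A] by blast
  define S where "S = T'\<inverse>"
  have S: "partial_hom S" "T \<subseteq> S" unfolding S_def using partial_hom_converse[OF T'(1)] T'(2) by auto
  have "\<exists>c. (c, fps_to_fls (X1 a)) \<in> S" "\<exists>c. (c, fps_to_fls (X2 a)) \<in> S" if "a \<in> verts G" for a
    using T'(3) that unfolding S_def by auto
  then obtain c1 c2 where c: "\<And>a. a \<in> verts G \<Longrightarrow> (c1 a, fps_to_fls (X1 a)) \<in> S"
    "\<And>a. a \<in> verts G \<Longrightarrow> (c2 a, fps_to_fls (X2 a)) \<in> S" by metis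
  define P where "P = restrict (\<lambda>a. (c1 a, c2 a)) (verts G)"
  have v0V: "v0 \<in> verts G" and w0V: "w0 \<in> verts G" using edge_sub[of f0] f0(1) f0_eq by auto
  have PV: "P \<in> constraint_variety G v0 w0 D"
    unfolding constraint_variety_def
  proof (intro CollectI conjI allI impI)
    show "P \<in> extensional (verts G)" by (simp add: P_def)
    \<comment> \<open>Equations between series hold exactly, and only 0 is paired with the zero
      series, so they descend to the complex coordinates.\<close>
    note injS = partial_hom_injective[OF S(1)]
    have X0: "X1 v0 = 0" "X2 v0 = 0" "X1 w0 = 1" "X2 w0 = 0"
      by (simp_all add: X1_def X2_def \<pi>0 \<tau>0 UW0 pvw)
    have "c1 v0 = 0" "c2 v0 = 0" "c1 w0 = 1" "c2 w0 = 0"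
      using c[OF v0V] c[OF w0V] injS[OF _ partial_homD(1)[OF S(1)]] injS[OF _ partial_homD(2)[OF S(1)]]
      by (simp_all add: X0)
    then show "P v0 = (0, 0)" "P w0 = (1, 0)" using v0V w0V by (simp_all add: P_def)
    fix a b assume "{a, b} \<in> edges G - {{v0, w0}}"
    then have ab: "{a, b} \<in> edges G - {f0}" by (simp add: f0_eq)
    then have V: "a \<in> verts G" "b \<in> verts G" using edge_sub[of "{a, b}"] by auto
    have "((c1 a - c1 b) * (c1 a - c1 b) + (c2 a - c2 b) * (c2 a - c2 b) - D {a, b},
      (fps_to_fls (X1 a) - fps_to_fls (X1 b)) * (fps_to_fls (X1 a) - fps_to_fls (X1 b))
      + (fps_to_fls (X2 a) - fps_to_fls (X2 b)) * (fps_to_fls (X2 a) - fps_to_fls (X2 b)) - fps_to_fls (L {a, b})) \<in> S"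
      using TD[OF ab] S(2) by (intro partial_homD(3-5)[OF S(1)] c V) auto
    moreover have "(fps_to_fls (X1 a) - fps_to_fls (X1 b)) * (fps_to_fls (X1 a) - fps_to_fls (X1 b))
      + (fps_to_fls (X2 a) - fps_to_fls (X2 b)) * (fps_to_fls (X2 a) - fps_to_fls (X2 b)) = fps_to_fls (L {a, b})"
      unfolding XL[OF ab, symmetric] power2_eq_square
      by (simp only: fps_to_fls_plus fps_to_fls_minus fls_times_fps_to_fls)
    ultimately have "((c1 a - c1 b) * (c1 a - c1 b) + (c2 a - c2 b) * (c2 a - c2 b) - D {a, b}, 0) \<in> S"
      by simp
    then have "(c1 a - c1 b) * (c1 a - c1 b) + (c2 a - c2 b) * (c2 a - c2 b) - D {a, b} = 0"
      by (rule injS[OF _ partial_homD(1)[OF S(1)]])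
    then show "(fst (P a) - fst (P b))\<^sup>2 + (snd (P a) - snd (P b))\<^sup>2 - D {a, b} = 0"
      using V by (simp add: P_def power2_eq_square)
  qed
  have ind_R: "indicator_fps A $ n \<in> R" for A n
    using is_subfieldD(1,2)[OF sfR] by (simp add: indicator_fps_def)
  \<comment> \<open>The starting point of the lift: the lengths correspond to series with
    coefficients 0, 1 and values of \<open>d\<close>, hence over \<open>R\<close>.\<close>
  have KD: "\<exists>b\<in>fls_over R. (a, b) \<in> S" if "a \<in> base_field G f0 D" for a
  proof -
    have "fps_X ^ n * indicator_fps A \<in> fps_over R" for n A
      using ind_R is_subfieldD(1)[OF sfR] by (simp add: fps_over_def fps_X_power_mult_nth)
    moreover have const: "fps_const b \<in> fps_over R" if "b \<in> R" for b
      using that is_subfieldD(1)[OF sfR] by (simp add: fps_over_def)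
    moreover have "f + g \<in> fps_over R" if "f \<in> fps_over R" "g \<in> fps_over R" for f g
      using that is_subfieldD(3)[OF sfR] by (simp add: fps_over_def)
    moreover have "fps_X ^ 2 \<in> fps_over R"
      using is_subfieldD(1,2)[OF sfR] by (simp add: fps_over_def fps_X_power_iff)
    moreover have "a1\<^sup>2 + a2\<^sup>2 \<in> R" using aa dK[OF xzH] KR by auto
    moreover have "d (\<pi> ` e) \<in> R" if "e \<in> F" for e using \<pi>F[OF that] dK KR by blast
    ultimately have "L e \<in> fps_over R" if "e \<in> edges G - {f0}" for e
      using that edgesG unfolding L_def by auto
    then have "fps_to_fls (L e) \<in> fls_over R" if "e \<in> edges G - {f0}" for e
      using fls_over_shift_fps[OF sfR, of "L e" 0] that by simp
    then have "D ` (edges G - {f0}) \<subseteq> {a. \<exists>b\<in>fls_over R. (a, b) \<in> S}"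
      using TD S(2) by blast
    then have "base_field G f0 D \<subseteq> {a. \<exists>b\<in>fls_over R. (a, b) \<in> S}"
      unfolding base_field_def
      by (rule generated_subfield_least[OF is_subfield_partial_hom_preimage[OF S(1) sfRR]])
    then show ?thesis using that by blast
  qed
  \<comment> \<open>Two images of \<open>a\<close> are compared: the lift yields one over
    \<open>R\<close>, and the pair with \<open>Q\<close> turns into a pair with Q(X^N). They
    coincide, and substituting X^N for X keeps the constant term. \<open>Q\<close> itself is not
    assumed to be over \<open>R\<close>.\<close>
  have coord: "Q $ 0 \<in> R"
    if aM: "radical_extension (base_field G f0 D) M" "a \<in> M" "(a, fps_to_fls Q) \<in> S" for M a Q
  proof -
    obtain N S' where N: "N > 0" "partial_hom S'" "\<And>a b. (a, b) \<in> S \<Longrightarrow> (a, fls_compose_power b N) \<in> S'"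
      "\<And>a. a \<in> M \<Longrightarrow> \<exists>b\<in>fls_over R. (a, b) \<in> S'"
      using radical_extension_lift[OF aM(1) R S(1) KD] by blast
    obtain b where b: "b \<in> fls_over R" "(a, b) \<in> S'" using N(4)[OF aM(2)] by blast
    have "b = fls_compose_power (fps_to_fls Q) N"
      by (rule partial_hom_single_valued[OF N(2) b(2) N(3)[OF aM(3)]])
    then have "Q $ 0 = b $$ 0" using N(1) by (simp add: fls_nth_compose_power)
    then show ?thesis using b(1) by (simp add: fls_over_def)
  qed
  obtain u' where u': "u' \<in> verts G" "u = \<pi> u'" using u by (auto simp: vertsH)
  have "{v0, w0} \<in> edges G" "generic_lengths G {v0, w0} D" using f0(1) genD by (auto simp: f0_eq)
  then have "(\<exists>M. radical_extension (base_field G f0 D) M \<and> fst (P u') \<in> M) \<and>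
    (\<exists>M. radical_extension (base_field G f0 D) M \<and> snd (P u') \<in> M)"
    using sol PV u'(1) unfolding radically_soluble_def f0_eq by blast
  then have "X1 u' $ 0 \<in> R" "X2 u' $ 0 \<in> R"
    using coord c[OF u'(1)] u'(1) by (auto simp: P_def)
  then show ?thesis by (simp add: X1_def X2_def px_def py_def u'(2) R_def K_def H_def)
qed

theorem theorem6p1:
  fixes G :: "'a ugraph" and x y :: 'a
  assumes "finite_simple_graph G"
    and "maximally_independent G"
    and "{x, y} \<in> edges G"
    and "maximally_independent (contract_edge G x y)"
    and "radically_soluble G"
  shows "radically_soluble (contract_edge G x y)"
proof -
  have "freedom G = 3" "freedom (contract_edge G x y) = 3"
    using assms(2,4) by (simp_all add: maximally_independent_def)
  from contract_edge_coordinates[OF assms(1,3) this assms(5)] show ?thesis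
    unfolding radically_soluble_def radical_closure_def by blast
qed

end
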